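(* Assume (J1)–(J3). The optimal control problem $$\text{(OH)}\qquad \text{Maximize } \Big\{-\int_{Q_{a_\dagger}}u(a,t,x)\,p^{u}(a,t,x)\,dt\,dx\,da\Big\}\quad\text{subject to } u\in U,$$ where $p^u$ is the solution of system $(\ast)$ with control $u$, admits at least one optimal pair $(u^*,p^* )$, i.e. $u^*\in U$, $p^*=p^{u^*}$, and $\int_{Q_{a_\dagger}}u^*p^{u^*}\le\int_{Q_{a_\dagger}}u\,p^{u}$ for all $u\in U$.
   Context: $a_\dagger>0$, $T>0$, $\delta>0$, $\eta>0$ are constants; $Q_{a_\dagger}=(0,a_\dagger)\times(0,T)\times(0,24)$. $D$ is the directional derivative along $(1,1,0)$ (equal to $\partial_t+\partial_a$ for smooth functions), $\Delta=\partial_x^2$. $K(x,s)=(x-s)^2e^{-(x-s)^2}$ if $s\in(0,24)$ and $0$ otherwise. System $(\ast)$: $Dp-\delta\Delta p+\mu(a)p=u p$ in $Q_{a_\dagger}$; $p(a,t,0)=p(a,t,24)$, $\partial_xp(a,t,0)=\partial_xp(a,t,24)$; $p(0,t,x)=\int_0^{a_\dagger}\beta(a)\int_{x-\eta}^{x+\eta}K(x,s)p(a,t,s)\,ds\,da$; $p(a,0,x)=p_0(a,x)$. Hypotheses: (J1) $\mu\in L^\infty_{loc}((0,a_\dagger))$, $\mu\ge0$, $\int_0^{a_\dagger}\mu=+\infty$; (J2) $\beta\in L^\infty((0,a_\dagger))$, $\beta\ge0$; (J3) $p_0\in L^2((0,a_\dagger)\times(0,24))$, $p_0\ge0$. $U=\{u\in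 L^2(Q_{a_\dagger}):\varsigma_1\le u\le\varsigma_2\text{ a.e.}\}$ with $\varsigma_1,\varsigma_2\in L^\infty(Q_{a_\dagger})$, $\varsigma_1\le\varsigma_2\le0$ a.e.; by Theorem 1, $p^u\in L^2(Q_{a_\dagger})$ exists uniquely for each $u\in U$. *)

theory Defs
  imports "HOL-Analysis.Analysis"
begin

definition QQ :: "real \<Rightarrow> real \<Rightarrow> (real \<times> real \<times> real) set" where
  "QQ ad T = {0<..<ad} \<times> {0<..<T} \<times> {0<..<24}"

definition KK :: "real \<Rightarrow> real \<Rightarrow> real" where
  "KK x s = (if s \<in> {0<..<24} then (x - s)^2 * exp (- ((x - s)^2)) else 0)"

definition L2_on :: "('a::euclidean_space) set \<Rightarrow> ('a \<Rightarrow> real) \<Rightarrow> bool" where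
  "L2_on S f \<longleftrightarrow> f \<in> borel_measurable lborel \<and> set_integrable lborel S (\<lambda>y. (f y)^2)"

definition Linf_on :: "('a::euclidean_space) set \<Rightarrow> ('a \<Rightarrow> real) \<Rightarrow> bool" where
  "Linf_on S f \<longleftrightarrow> f \<in> borel_measurable lborel \<and> (\<exists>C. AE y in lborel. y \<in> S \<longrightarrow> \<bar>f y\<bar> \<le> C)"

definition controls :: "real \<Rightarrow> real \<Rightarrow> (real \<times> real \<times> real \<Rightarrow> real)
     \<Rightarrow> (real \<times> real \<times> real \<Rightarrow> real) \<Rightarrow> (real \<times> real \<times> real \<Rightarrow> real) set" where
  "controls ad T s1 s2 = {u. L2_on (QQ ad T) u \<and>
      (AE y in lborel. y \<in> QQ ad T \<longrightarrow> s1 y \<le> u y \<and> u y \<le> s2 y)}"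

definition test_fun :: "real \<Rightarrow> real \<Rightarrow> (real \<times> real \<times> real \<Rightarrow> real)
   \<Rightarrow> (real \<times> real \<times> real \<Rightarrow> real) \<Rightarrow> (real \<times> real \<times> real \<Rightarrow> real)
   \<Rightarrow> (real \<times> real \<times> real \<Rightarrow> real) \<Rightarrow> bool" where
  "test_fun ad T \<phi> \<phi>a \<phi>t \<phi>xx \<longleftrightarrow>
     continuous_on UNIV \<phi> \<and> continuous_on UNIV \<phi>a \<and> continuous_on UNIV \<phi>t \<and>
     continuous_on UNIV \<phi>xx \<and>
     (\<forall>a t x. ((\<lambda>b. \<phi> (b, t, x)) has_real_derivative \<phi>a (a, t, x)) (at a)) \<and>
     (\<forall>a t x. ((\<lambda>s. \<phi> (a, s, x)) has_real_derivative \<phi>t (a, t, x)) (at t)) \<and>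
     (\<exists>\<phi>x. (\<forall>a t x. ((\<lambda>z. \<phi> (a, t, z)) has_real_derivative \<phi>x (a, t, x)) (at x)) \<and>
           (\<forall>a t x. ((\<lambda>z. \<phi>x (a, t, z)) has_real_derivative \<phi>xx (a, t, x)) (at x))) \<and>
     (\<forall>a t x. \<phi> (a, t, x + 24) = \<phi> (a, t, x)) \<and>
     (\<exists>\<epsilon>>0. \<forall>a t x. a \<ge> ad - \<epsilon> \<longrightarrow> \<phi> (a, t, x) = 0) \<and>
     (\<forall>a x. \<phi> (a, T, x) = 0)"

definition renewal :: "real \<Rightarrow> real \<Rightarrow> (real \<Rightarrow> real) \<Rightarrow> (real \<times> real \<times> real \<Rightarrow> real)
     \<Rightarrow> real \<Rightarrow> real \<Rightarrow> real" where
  "renewal ad \<eta> \<beta> p t x =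
     (LINT a:{0<..<ad}|lborel. \<beta> a * (LINT s:{x - \<eta><..<x + \<eta>}|lborel. KK x s * p (a, t, s)))"

definition is_solution :: "real \<Rightarrow> real \<Rightarrow> real \<Rightarrow> real \<Rightarrow> (real \<Rightarrow> real) \<Rightarrow> (real \<Rightarrow> real)
     \<Rightarrow> (real \<times> real \<Rightarrow> real) \<Rightarrow> (real \<times> real \<times> real \<Rightarrow> real)
     \<Rightarrow> (real \<times> real \<times> real \<Rightarrow> real) \<Rightarrow> bool" where
  "is_solution ad T \<delta> \<eta> \<mu> \<beta> p0 u p \<longleftrightarrow>
     L2_on (QQ ad T) p \<and>
     (\<forall>\<phi> \<phi>a \<phi>t \<phi>xx. test_fun ad T \<phi> \<phi>a \<phi>t \<phi>xx \<longrightarrow>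
        set_integrable lborel (QQ ad T) (\<lambda>y. \<mu> (fst y) * p y * \<phi> y) \<and>
        (LINT y:QQ ad T|lborel.
            p y * (- (\<phi>a y + \<phi>t y) - \<delta> * \<phi>xx y + \<mu> (fst y) * \<phi> y - u y * \<phi> y))
        = (LINT z:{0<..<T} \<times> {0<..<24}|lborel.
              renewal ad \<eta> \<beta> p (fst z) (snd z) * \<phi> (0, fst z, snd z))
          + (LINT z:{0<..<ad} \<times> {0<..<24}|lborel. p0 z * \<phi> (fst z, 0, snd z)))"

end

theory Submission
  imports Defs
begin

text \<open>
  Weak solutions are compared by duality, so that only smooth test functions are ever estimated.
  An energy estimate for the negative part of a test function bounds it by the negative part of its
  image under the dual operator, and this operator has dense range in $L^2$: the constant coefficient
  part is solved explicitly for right-hand sides $b(a)\,c(t)\cos(k(\pi/12)(x-m))$, and the control and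
  the renewal term are a small perturbation after multiplication by $e^{-\lambda t}$ with $\lambda$ large. The
  unbounded mortality is removed by the integrating factor $\exp(-\int_a^A\mu)$ on $(0,A)$, and then
  $A \to a_\dagger$. It follows that $0 \le p^u \le p^{\varsigma_2}$.

  The pairs $(p,v)$ with $\varsigma_1 p \le v \le \varsigma_2 p$ that solve the problem with right-hand side $v$ in place of $up$
  form a convex set on which the cost $\int v$ is linear. Near-minimisers chosen with almost minimal $L^2$ norm form a
  Cauchy sequence by the parallelogram law, so no weak compactness is needed, and the limit $(p,v)$ yields the
  optimal control $u = v/p$ where $p > 0$ and $u = \varsigma_2$ elsewhere.
\<close>

section \<open>Square-integrable functions\<close>

definition sqint :: "'a measure \<Rightarrow> ('a \<Rightarrow> 'b::euclidean_space) \<Rightarrow> bool" where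
  "sqint M f \<longleftrightarrow> f \<in> borel_measurable M \<and> integrable M (\<lambda>y. (norm (f y))\<^sup>2)"

lemma sqint_integrable_sq: "sqint M f \<Longrightarrow> integrable M (\<lambda>y. (norm (f y))\<^sup>2)"
  by (simp add: sqint_def)

lemma sqint_integrable_square:
  fixes f :: "'a \<Rightarrow> real"
  shows "sqint M f \<Longrightarrow> integrable M (\<lambda>y. (f y)\<^sup>2)"
  by (simp add: sqint_def)

lemma sqintI:
  assumes "f \<in> borel_measurable M" "integrable M g" "AE y in M. (norm (f y))\<^sup>2 \<le> g y"
  shows "sqint M f"
proof -
  have [measurable]: "f \<in> borel_measurable M" by fact
  have "integrable M (\<lambda>y. (norm (f y))\<^sup>2)"
    by (rule Bochner_Integration.integrable_bound[OF assms(2)]) (use assms(3) in auto)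
  then show ?thesis using assms by (simp add: sqint_def)
qed

lemma parallelogram_law:
  "(norm (x + y))\<^sup>2 + (norm (x - y))\<^sup>2 = 2 * (norm x)\<^sup>2 + 2 * (norm (y::'b::real_inner))\<^sup>2"
  by (simp add: power2_norm_eq_inner inner_add inner_diff inner_commute)

lemma tendsto_0_squeeze:
  fixes f g :: "nat \<Rightarrow> real"
  assumes "\<And>n. 0 \<le> f n" "\<And>n. f n \<le> g n" "g \<longlonglongrightarrow> 0" shows "f \<longlonglongrightarrow> 0"
  by (rule tendsto_sandwich[OF _ _ tendsto_const assms(3)]) (simp_all add: assms)

lemma norm_add_sq_le: "(norm (x + y))\<^sup>2 \<le> 2 * (norm x)\<^sup>2 + 2 * (norm (y::'b::real_inner))\<^sup>2"
  using parallelogram_law[of x y] by (smt (verit) zero_le_power2)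

lemma sqint_add: "sqint M f \<Longrightarrow> sqint M g \<Longrightarrow> sqint M (\<lambda>y. f y + g y)"
  by (rule sqintI[where g="\<lambda>y. 2 * (norm (f y))\<^sup>2 + 2 * (norm (g y))\<^sup>2"])
     (auto simp: sqint_def norm_add_sq_le)

lemma sqint_scaleR: "sqint M f \<Longrightarrow> sqint M (\<lambda>y. c *\<^sub>R f y)"
  by (auto simp: sqint_def power_mult_distrib)

lemma sqint_diff: "sqint M f \<Longrightarrow> sqint M g \<Longrightarrow> sqint M (\<lambda>y. f y - g y)"
  using sqint_add[of M f "\<lambda>y. (-1) *\<^sub>R g y"] sqint_scaleR[of M g "-1"] by simp

lemma sqint_cmult: fixes f :: "'a \<Rightarrow> real" shows "sqint M f \<Longrightarrow> sqint M (\<lambda>y. c * f y)"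
  using sqint_scaleR[of M f c] by simp

lemma sqint_bounded_mult:
  fixes f h :: "'a \<Rightarrow> real"
  assumes "sqint M f" "h \<in> borel_measurable M" "AE y in M. \<bar>h y\<bar> \<le> C"
  shows "sqint M (\<lambda>y. h y * f y)"
proof (rule sqintI[where g="\<lambda>y. C\<^sup>2 * (norm (f y))\<^sup>2"])
  show "AE y in M. (norm (h y * f y))\<^sup>2 \<le> C\<^sup>2 * (norm (f y))\<^sup>2"
    using assms(3)
  proof eventually_elim
    case (elim y)
    then have "(h y)\<^sup>2 \<le> C\<^sup>2" by (simp add: abs_le_square_iff[symmetric] abs_le_iff)
    then show ?case by (simp add: power_mult_distrib mult_right_mono)
  qed
qed (use assms in \<open>auto simp: sqint_def\<close>)

lemma sqint_inner:
  assumes "sqint M f" "sqint M g" shows "integrable M (\<lambda>y. f y \<bullet> g y)"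
proof (rule Bochner_Integration.integrable_bound[where f="\<lambda>y. (norm (f y))\<^sup>2 + (norm (g y))\<^sup>2"])
  show "AE y in M. norm (f y \<bullet> g y) \<le> norm ((norm (f y))\<^sup>2 + (norm (g y))\<^sup>2)"
  proof (rule AE_I2)
    fix y
    have "\<bar>f y \<bullet> g y\<bar> \<le> norm (f y) * norm (g y)" by (rule Cauchy_Schwarz_ineq2)
    also have "\<dots> \<le> (norm (f y))\<^sup>2 + (norm (g y))\<^sup>2"
      using sum_squares_bound[of "norm (f y)" "norm (g y)"]        mult_nonneg_nonneg[OF norm_ge_zero[of "f y"] norm_ge_zero[of "g y"]] by linarith
    finally show "norm (f y \<bullet> g y) \<le> norm ((norm (f y))\<^sup>2 + (norm (g y))\<^sup>2)" by simp
  qed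
qed (use assms in \<open>auto simp: sqint_def\<close>)

lemma sqint_mult: fixes f g :: "'a \<Rightarrow> real" shows "sqint M f \<Longrightarrow> sqint M g \<Longrightarrow> integrable M (\<lambda>y. f y * g y)"
  using sqint_inner[of M f g] by (simp add: mult.commute)

lemma sqint_integrable:
  assumes "finite_measure M" "sqint M f" shows "integrable M f"
proof -
  interpret finite_measure M by fact
  show ?thesis
  proof (rule Bochner_Integration.integrable_bound[where f="\<lambda>y. 1 + (norm (f y))\<^sup>2"])
    show "AE y in M. norm (f y) \<le> norm (1 + (norm (f y))\<^sup>2)"
    proof (rule AE_I2)
      fix y have "2 * norm (f y) * 1 \<le> (norm (f y))\<^sup>2 + 1\<^sup>2" by (rule sum_squares_bound)
      then show "norm (f y) \<le> norm (1 + (norm (f y))\<^sup>2)" by (smt (verit) norm_ge_zero one_power2 real_norm_def)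
    qed
  qed (use assms(2) in \<open>auto simp: sqint_def\<close>)
qed

lemma Cauchy_Schwarz_integral:
  fixes f g :: "'a \<Rightarrow> real"
  assumes "sqint M f" "sqint M g"
  shows "(\<integral>y. f y * g y \<partial>M)\<^sup>2 \<le> (\<integral>y. (f y)\<^sup>2 \<partial>M) * (\<integral>y. (g y)\<^sup>2 \<partial>M)"
proof -
  let ?a = "\<integral>y. (f y)\<^sup>2 \<partial>M" and ?b = "\<integral>y. f y * g y \<partial>M" and ?c = "\<integral>y. (g y)\<^sup>2 \<partial>M"
  have i: "integrable M (\<lambda>y. (f y)\<^sup>2)" "integrable M (\<lambda>y. (g y)\<^sup>2)" "integrable M (\<lambda>y. f y * g y)"
    using assms sqint_mult by (auto simp: sqint_def)
  have q: "0 \<le> ?a - 2 * t * ?b + t\<^sup>2 * ?c" for t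
  proof -
    have "0 \<le> (\<integral>y. (f y - t * g y)\<^sup>2 \<partial>M)" by simp
    also have "\<dots> = (\<integral>y. (f y)\<^sup>2 - 2 * t * (f y * g y) + t\<^sup>2 * (g y)\<^sup>2 \<partial>M)"
      by (rule Bochner_Integration.integral_cong) (auto simp: power2_eq_square algebra_simps)
    finally show ?thesis using i by simp
  qed
  have c0: "?c \<ge> 0" by simp
  show ?thesis
  proof (cases "?c = 0")
    case True
    have "?b = 0"
    proof (rule ccontr)
      assume "?b \<noteq> 0"
      then show False using q[of "(?a + 1) / (2 * ?b)"] True by simp
    qed
    then show ?thesis by simp
  next
    case False
    then have "?c > 0" using c0 by linarith
    have "?a - 2 * (?b / ?c) * ?b + (?b / ?c)\<^sup>2 * ?c = ?a - ?b\<^sup>2 / ?c"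
      using False by (simp add: power2_eq_square)
    then have "?b\<^sup>2 / ?c \<le> ?a" using q[of "?b / ?c"] by linarith
    then show ?thesis using \<open>?c > 0\<close> by (simp add: pos_divide_le_eq)
  qed
qed

lemma integral_parallelogram:
  fixes f g :: "'a \<Rightarrow> 'b::euclidean_space"
  assumes "sqint M f" "sqint M g"
  shows "(\<integral>y. (norm (f y - g y))\<^sup>2 \<partial>M) = 2 * (\<integral>y. (norm (f y))\<^sup>2 \<partial>M) + 2 * (\<integral>y. (norm (g y))\<^sup>2 \<partial>M)
     - 4 * (\<integral>y. (norm ((1/2) *\<^sub>R (f y + g y)))\<^sup>2 \<partial>M)"
proof -
  have i: "integrable M (\<lambda>y. (norm (f y))\<^sup>2)" "integrable M (\<lambda>y. (norm (g y))\<^sup>2)"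
     "integrable M (\<lambda>y. (norm ((1/2) *\<^sub>R (f y + g y)))\<^sup>2)"
    using assms sqint_scaleR[OF sqint_add, of M f g "1/2"] by (auto simp: sqint_def)
  have "(\<integral>y. (norm (f y - g y))\<^sup>2 \<partial>M)
    = (\<integral>y. 2 * (norm (f y))\<^sup>2 + 2 * (norm (g y))\<^sup>2 - 4 * (norm ((1/2) *\<^sub>R (f y + g y)))\<^sup>2 \<partial>M)"
  proof (rule Bochner_Integration.integral_cong)
    fix y
    show "(norm (f y - g y))\<^sup>2 = 2 * (norm (f y))\<^sup>2 + 2 * (norm (g y))\<^sup>2 - 4 * (norm ((1/2) *\<^sub>R (f y + g y)))\<^sup>2"
      using parallelogram_law[of "f y" "g y"] by (simp add: power_mult_distrib power2_eq_square)
  qed simp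
  then show ?thesis using i by simp
qed

lemma L2_fast_Cauchy_limit:
  fixes x :: "nat \<Rightarrow> 'a \<Rightarrow> 'b::euclidean_space"
  assumes fin: "finite_measure M" and sq: "\<And>n. sqint M (x n)"
    and fast: "\<And>n m. n \<le> m \<Longrightarrow> (\<integral>y. (norm (x n y - x m y))\<^sup>2 \<partial>M) \<le> (1/4)^n"
  shows "\<exists>X. sqint M X \<and> (AE y in M. (\<lambda>n. x n y) \<longlonglongrightarrow> X y) \<and>
     (\<forall>n. (\<integral>y. (norm (x n y - X y))\<^sup>2 \<partial>M) \<le> (1/4)^n)"
proof -
  interpret finite_measure M by fact
  have [measurable]: "x n \<in> borel_measurable M" for n using sq by (simp add: sqint_def)
  define d where "d n y = x (Suc n) y - x n y" for n y
  have [measurable]: "d n \<in> borel_measurable M" for n unfolding d_def by measurable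
  have sqd: "sqint M (d n)" for n unfolding d_def[abs_def] by (intro sqint_diff sq)
  have dn: "(\<integral>y. (norm (d n y))\<^sup>2 \<partial>M) \<le> (1/4)^n" for n
    using fast[of n "Suc n"] by (simp add: d_def norm_minus_commute)
  have l1: "(\<integral>y. norm (d n y) \<partial>M) \<le> (measure M (space M) + 1) * (1/2)^n" for n
  proof -
    have "(\<integral>y. norm (d n y) \<partial>M) \<le> (\<integral>y. (1/2)^n + 2^n * (norm (d n y))\<^sup>2 \<partial>M)"
    proof (rule integral_mono)
      fix y
      define e where "e = (2::real)^n"
      have e: "e > 0" "(1/2)^n = 1 / e" by (auto simp: e_def power_divide)
      have "2 * (norm (d n y) * e) * 1 \<le> (norm (d n y) * e)\<^sup>2 + 1\<^sup>2" by (rule sum_squares_bound)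
      then have "norm (d n y) * e \<le> (norm (d n y) * e)\<^sup>2 + 1"
        using e by (smt (verit) norm_ge_zero mult_nonneg_nonneg one_power2)
      then have "norm (d n y) \<le> ((norm (d n y) * e)\<^sup>2 + 1) / e" using e by (simp add: field_simps)
      also have "\<dots> = 1 / e + e * (norm (d n y))\<^sup>2" using e by (simp add: field_simps power2_eq_square)
      finally show "norm (d n y) \<le> (1/2)^n + 2^n * (norm (d n y))\<^sup>2" using e by (simp add: e_def)
    qed (use sqd[of n] sqint_integrable[OF fin sqd[of n]] in \<open>auto simp: sqint_def\<close>)
    also have "\<dots> = (1/2)^n * measure M (space M) + 2^n * (\<integral>y. (norm (d n y))\<^sup>2 \<partial>M)"
      using sqd[of n] by (simp add: sqint_def mult.commute)
    also have "\<dots> \<le> (1/2)^n * measure M (space M) + 2^n * (1/4)^n"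
      using dn[of n] by simp
    also have "(2::real)^n * (1/4)^n = (1/2)^n" by (simp add: power_mult_distrib[symmetric])
    finally show ?thesis by (simp add: algebra_simps)
  qed
  have "(\<integral>\<^sup>+y. (\<Sum>n. ennreal (norm (d n y))) \<partial>M) = (\<Sum>n. ennreal (\<integral>y. norm (d n y) \<partial>M))"
    by (subst nn_integral_suminf)
       (auto intro!: arg_cong[where f=suminf] ext nn_integral_eq_integral integrable_norm sqint_integrable[OF fin sqd])
  also have "\<dots> \<le> (\<Sum>n. ennreal ((measure M (space M) + 1) * (1/2)^n))"
    by (intro suminf_le ennreal_leI l1) auto
  also have "\<dots> < \<infinity>"
    unfolding less_top[symmetric] infinity_ennreal_def
    by (intro ennreal_suminf_neq_top summable_mult summable_geometric) (auto simp: measure_nonneg)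
  finally have "AE y in M. (\<Sum>n. ennreal (norm (d n y))) \<noteq> \<infinity>"
    by (intro nn_integral_PInf_AE) auto
  then have conv: "AE y in M. convergent (\<lambda>n. x n y)"
  proof eventually_elim
    case (elim y)
    then have "summable (\<lambda>n. norm (d n y))" by (intro summable_suminf_not_top) (auto simp: top_ennreal_def[symmetric])
    then have "summable (\<lambda>n. d n y)" by (rule summable_norm_cancel)
    then have "convergent (\<lambda>n. \<Sum>i<n. d i y)" by (simp add: summable_iff_convergent)
    then have "convergent (\<lambda>n. (x n y - x 0 y) + x 0 y)"
      unfolding d_def by (intro convergent_add convergent_const) (simp add: sum_lessThan_telescope[of "\<lambda>n. x n y"])
    then show ?case by simp
  qed
  define X where "X y = lim (\<lambda>n. x n y)" for y
  have [measurable]: "X \<in> borel_measurable M" unfolding X_def by measurable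
  have lim: "AE y in M. (\<lambda>n. x n y) \<longlonglongrightarrow> X y"
    using conv by eventually_elim (simp add: X_def convergent_LIMSEQ_iff)
  have nb: "(\<integral>\<^sup>+y. ennreal ((norm (x n y - X y))\<^sup>2) \<partial>M) \<le> ennreal ((1/4)^n)" for n
  proof -
    have "(\<integral>\<^sup>+y. ennreal ((norm (x n y - X y))\<^sup>2) \<partial>M) = (\<integral>\<^sup>+y. liminf (\<lambda>m. ennreal ((norm (x n y - x m y))\<^sup>2)) \<partial>M)"
    proof (rule nn_integral_cong_AE)
      show "AE y in M. ennreal ((norm (x n y - X y))\<^sup>2) = liminf (\<lambda>m. ennreal ((norm (x n y - x m y))\<^sup>2))"
        using lim
      proof eventually_elim
        case (elim y)
        have "(\<lambda>m. ennreal ((norm (x n y - x m y))\<^sup>2)) \<longlonglongrightarrow> ennreal ((norm (x n y - X y))\<^sup>2)"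
          by (intro tendsto_intros tendsto_ennrealI elim)
        from lim_imp_Liminf[OF _ this] show ?case by simp
      qed
    qed
    also have "\<dots> \<le> liminf (\<lambda>m. \<integral>\<^sup>+y. ennreal ((norm (x n y - x m y))\<^sup>2) \<partial>M)"
      by (rule nn_integral_liminf) auto
    also have "\<dots> \<le> liminf (\<lambda>m::nat. ennreal ((1/4)^n))"
    proof (rule Liminf_mono, rule eventually_sequentiallyI[of n])
      fix m assume "n \<le> m"
      have "(\<integral>\<^sup>+y. ennreal ((norm (x n y - x m y))\<^sup>2) \<partial>M) = ennreal (\<integral>y. (norm (x n y - x m y))\<^sup>2 \<partial>M)"
        using sqint_diff[OF sq[of n] sq[of m]] by (intro nn_integral_eq_integral) (auto simp: sqint_def)
      then show "(\<integral>\<^sup>+y. ennreal ((norm (x n y - x m y))\<^sup>2) \<partial>M) \<le> ennreal ((1/4)^n)"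
        using fast[OF \<open>n \<le> m\<close>] by (auto intro: ennreal_leI)
    qed
    finally show ?thesis by (simp add: Liminf_const)
  qed
  have sqnX: "sqint M (\<lambda>y. x n y - X y)" for n
    unfolding sqint_def using nb[of n]
    by (auto intro!: integrableI_bounded le_less_trans[OF nb[of n]])
  have "sqint M X" using sqint_diff[OF sq[of 0] sqnX[of 0]] by simp
  moreover have "(\<integral>y. (norm (x n y - X y))\<^sup>2 \<partial>M) \<le> (1/4)^n" for n
  proof -
    have "ennreal (\<integral>y. (norm (x n y - X y))\<^sup>2 \<partial>M) = (\<integral>\<^sup>+y. ennreal ((norm (x n y - X y))\<^sup>2) \<partial>M)"
      using sqnX[of n] by (intro nn_integral_eq_integral[symmetric]) (auto simp: sqint_def)
    then have "ennreal (\<integral>y. (norm (x n y - X y))\<^sup>2 \<partial>M) \<le> ennreal ((1/4)^n)" using nb[of n] by simp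
    then show ?thesis by (subst (asm) ennreal_le_iff) auto
  qed
  ultimately show ?thesis using lim by blast
qed

lemma convex_chain_limit:
  fixes C :: "nat \<Rightarrow> ('a \<Rightarrow> 'b::euclidean_space) set"
  assumes fin: "finite_measure M" and sq: "\<And>n f. f \<in> C n \<Longrightarrow> sqint M f"
    and dec: "\<And>n. C (Suc n) \<subseteq> C n"
    and mid: "\<And>n f g. f \<in> C n \<Longrightarrow> g \<in> C n \<Longrightarrow> (\<lambda>y. (1/2) *\<^sub>R (f y + g y)) \<in> C n"
    and bdd: "\<And>n. \<exists>f\<in>C n. (\<integral>y. (norm (f y))\<^sup>2 \<partial>M) \<le> B"
  shows "\<exists>x X. (\<forall>n. x n \<in> C n) \<and> sqint M X \<and> (AE y in M. (\<lambda>n. x n y) \<longlonglongrightarrow> X y) \<and>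
     (\<forall>n. (\<integral>y. (norm (x n y - X y))\<^sup>2 \<partial>M) \<le> (1/4)^n) \<and>
     (\<forall>n f. (\<forall>k. f \<in> C k) \<longrightarrow> (\<integral>y. (norm (x n y))\<^sup>2 \<partial>M) \<le> (\<integral>y. (norm (f y))\<^sup>2 \<partial>M) + (1/2)^n)"
proof -
  define N where "N f = (\<integral>y. (norm (f y))\<^sup>2 \<partial>M)" for f :: "'a \<Rightarrow> 'b"
  define d where "d n = (INF f\<in>C n. N f)" for n
  have N0: "N f \<ge> 0" for f unfolding N_def by simp
  have ne: "C n \<noteq> {}" for n using bdd[of n] by auto
  have bb: "bdd_below (N ` C n)" for n by (rule bdd_belowI2[of _ 0]) (rule N0)
  have anti: "n \<le> m \<Longrightarrow> C m \<subseteq> C n" for n m using dec by (rule lift_Suc_antimono_le)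
  have dle: "f \<in> C n \<Longrightarrow> d n \<le> N f" for f n unfolding d_def by (rule cINF_lower[OF bb])
  have dB: "d n \<le> B" for n using bdd[of n] dle[of _ n] unfolding N_def by (meson order_trans)
  have incd: "incseq d" unfolding incseq_def d_def
    using anti ne bb by (auto intro!: cINF_superset_mono)
  obtain l where l: "d \<longlonglongrightarrow> l" "\<And>n. d n \<le> l"
    using incseq_convergent[OF incd, of B] dB by blast
  have "\<exists>f\<in>C n. N f < d n + (1/2)^n" for n
    using cInf_lessD[of "N ` C n" "d n + (1/2)^n"] ne[of n] unfolding d_def by auto
  then obtain z where z: "\<And>n. z n \<in> C n" "\<And>n. N (z n) < d n + (1/2)^n" by metis
  define h where "h n = (1/2::real)^n" for n :: nat
  define \<eta> where "\<eta> n = 2 * (l - d n) + 4 * h n" for n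
  have close: "N (\<lambda>y. z n y - z m y) \<le> \<eta> n" if "n \<le> m" for n m
  proof -
    have "z m \<in> C n" using z(1)[of m] anti[OF that] by auto
    then have "N (\<lambda>y. (1/2) *\<^sub>R (z n y + z m y)) \<ge> d n"
      by (intro dle mid z)
    moreover have "N (\<lambda>y. z n y - z m y) = 2 * N (z n) + 2 * N (z m) - 4 * N (\<lambda>y. (1/2) *\<^sub>R (z n y + z m y))"
      unfolding N_def by (intro integral_parallelogram sq[of _ n] sq[of _ m] z)
    moreover have "h m \<le> h n" unfolding h_def using that by (intro power_decreasing) auto
    ultimately show ?thesis using z(2)[of n, folded h_def] z(2)[of m, folded h_def] l(2)[of m]
      unfolding \<eta>_def by argo
  qed
  have eta0: "\<eta> \<longlonglongrightarrow> 2 * (l - l) + 4 * 0" unfolding \<eta>_def h_def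
    by (intro tendsto_intros l) auto
  have "\<exists>k\<ge>n. \<eta> k \<le> (1/4)^n" for n
  proof -
    have "eventually (\<lambda>k. \<eta> k < (1/4)^n) sequentially"
      using eta0 by (intro order_tendstoD(2)[of _ 0]) auto
    then obtain k0 where "\<And>k. k \<ge> k0 \<Longrightarrow> \<eta> k < (1/4)^n" unfolding eventually_sequentially by blast
    then show ?thesis by (intro exI[of _ "max n k0"]) (simp add: less_imp_le)
  qed
  then obtain k0 where k0: "\<And>n. k0 n \<ge> n" "\<And>n. \<eta> (k0 n) \<le> (1/4)^n" by metis
  define k where "k n = Max (k0 ` {..n})" for n
  have kk0: "k0 n \<le> k n" for n unfolding k_def by (intro Max_ge) auto
  have kn: "n \<le> k n" for n using kk0[of n] k0(1)[of n] by simp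
  have kmono: "n \<le> m \<Longrightarrow> k n \<le> k m" for n m unfolding k_def by (intro Max_mono) auto
  have etamono: "\<eta> m \<le> \<eta> n" if "n \<le> m" for n m
  proof -
    have "h m \<le> h n" unfolding h_def using that by (intro power_decreasing) auto
    then show ?thesis using incseqD[OF incd that] unfolding \<eta>_def by argo
  qed
  have fast: "(\<integral>y. (norm (z (k n) y - z (k m) y))\<^sup>2 \<partial>M) \<le> (1/4)^n" if "n \<le> m" for n m
    using close[OF kmono[OF that]] etamono[OF kk0[of n]] k0(2)[of n] unfolding N_def by linarith
  obtain X where X: "sqint M X" "AE y in M. (\<lambda>n. z (k n) y) \<longlonglongrightarrow> X y"
     "\<And>n. (\<integral>y. (norm (z (k n) y - X y))\<^sup>2 \<partial>M) \<le> (1/4)^n"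
    using L2_fast_Cauchy_limit[OF fin sq[OF z(1)] fast] by blast
  have "N (z (k n)) \<le> N f + (1/2)^n" if "\<forall>k. f \<in> C k" for n f
  proof -
    have "d (k n) \<le> N f" using that by (auto intro: dle)
    moreover have "(1/2::real)^(k n) \<le> (1/2)^n" using kn by (intro power_decreasing) auto
    ultimately show ?thesis using z(2)[of "k n"] by linarith
  qed
  moreover have "z (k n) \<in> C n" for n using z(1)[of "k n"] anti[OF kn[of n]] by auto
  ultimately show ?thesis using X unfolding N_def by (intro exI[of _ "\<lambda>n. z (k n)"] exI[of _ X]) blast
qed

lemma L2_dense_if_orthogonal_trivial:
  fixes V :: "('a \<Rightarrow> real) set"
  assumes fin: "finite_measure M" and sq: "\<And>v. v \<in> V \<Longrightarrow> sqint M v"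
    and zero: "(\<lambda>y. 0) \<in> V"
    and lin: "\<And>v w c. v \<in> V \<Longrightarrow> w \<in> V \<Longrightarrow> (\<lambda>y. v y + c * w y) \<in> V"
    and triv: "\<And>w. sqint M w \<Longrightarrow> (\<And>v. v \<in> V \<Longrightarrow> (\<integral>y. w y * v y \<partial>M) = 0) \<Longrightarrow> AE y in M. w y = 0"
    and psi: "sqint M \<psi>" and "e > 0"
  shows "\<exists>v\<in>V. (\<integral>y. (\<psi> y - v y)\<^sup>2 \<partial>M) < e"
proof -
  define C where "C (n::nat) = (\<lambda>v y. \<psi> y - v y) ` V" for n
  have mem: "(\<lambda>y. \<psi> y - v y) \<in> C n" if "v \<in> V" for v n using that unfolding C_def by auto
  have sqC: "f \<in> C n \<Longrightarrow> sqint M f" for f n unfolding C_def using sq psi by (auto intro: sqint_diff)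
  have "\<exists>x X. (\<forall>n. x n \<in> C n) \<and> sqint M X \<and> (AE y in M. (\<lambda>n. x n y) \<longlonglongrightarrow> X y) \<and>
     (\<forall>n. (\<integral>y. (norm (x n y - X y))\<^sup>2 \<partial>M) \<le> (1/4)^n) \<and>
     (\<forall>n f. (\<forall>k. f \<in> C k) \<longrightarrow> (\<integral>y. (norm (x n y))\<^sup>2 \<partial>M) \<le> (\<integral>y. (norm (f y))\<^sup>2 \<partial>M) + (1/2)^n)"
  proof (rule convex_chain_limit[OF fin sqC])
    fix n f g assume "f \<in> C n" "g \<in> C n"
    then obtain v w where v: "v \<in> V" "f = (\<lambda>y. \<psi> y - v y)" and w: "w \<in> V" "g = (\<lambda>y. \<psi> y - w y)"
      unfolding C_def by auto
    have "(\<lambda>y. (0 + (1/2) * v y) + (1/2) * w y) \<in> V"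
      by (intro lin[of "\<lambda>y. 0 + (1/2) * v y"] lin[of "\<lambda>y. 0"] zero v w)
    from mem[OF this, of n] show "(\<lambda>y. (1/2) *\<^sub>R (f y + g y)) \<in> C n"
      unfolding v(2) w(2) by (simp add: field_simps)
  next
    show "\<exists>f\<in>C n. (\<integral>y. (norm (f y))\<^sup>2 \<partial>M) \<le> (\<integral>y. (norm (\<psi> y))\<^sup>2 \<partial>M)" for n
      using mem[OF zero, of n] by (intro bexI[of _ \<psi>]) simp_all
  qed (auto simp: C_def)
  then obtain x X where x: "\<And>n. x n \<in> C n" and X: "sqint M X"
     and cl: "\<And>n. (\<integral>y. (x n y - X y)\<^sup>2 \<partial>M) \<le> (1/4)^n"
     and mn: "\<And>n f. f \<in> C 0 \<Longrightarrow> (\<integral>y. (x n y)\<^sup>2 \<partial>M) \<le> (\<integral>y. (f y)\<^sup>2 \<partial>M) + (1/2)^n"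
    unfolding C_def by auto
  have orth: "(\<integral>y. X y * v y \<partial>M) = 0" if v: "v \<in> V" for v
  proof -
    let ?b = "\<integral>y. X y * v y \<partial>M" and ?c = "\<integral>y. (v y)\<^sup>2 \<partial>M"
    have le: "(\<integral>y. (x n y - X y) * v y \<partial>M)\<^sup>2 \<le> (1/4)^n * ?c" for n
      using order_trans[OF Cauchy_Schwarz_integral[OF sqint_diff[OF sqC[OF x[of n]] X] sq[OF v]]
        mult_right_mono[OF cl[of n]]] by simp
    have "(\<lambda>n. (1/4)^n * ?c) \<longlonglongrightarrow> 0 * ?c" by (intro tendsto_mult tendsto_const LIMSEQ_power_zero) auto
    then have "(\<lambda>n. (1/4)^n * ?c) \<longlonglongrightarrow> 0" by simp
    from tendsto_0_squeeze[OF zero_le_power2 le this]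
    have "(\<lambda>n. (\<integral>y. (x n y - X y) * v y \<partial>M)\<^sup>2) \<longlonglongrightarrow> 0" .
    from tendsto_real_sqrt[OF this] have lim0: "(\<lambda>n. \<integral>y. (x n y - X y) * v y \<partial>M) \<longlonglongrightarrow> 0"
      by (simp add: tendsto_rabs_zero_iff)
    have q: "0 \<le> - 2 * t * ?b + t\<^sup>2 * ?c" for t
    proof -
      have ge: "0 \<le> (1/2)^n - 2 * t * (\<integral>y. x n y * v y \<partial>M) + t\<^sup>2 * ?c" for n
      proof -
        obtain w where w: "w \<in> V" "x n = (\<lambda>y. \<psi> y - w y)" using x[of n] unfolding C_def by auto
        have "(\<lambda>y. x n y - t * v y) \<in> C 0"
          using mem[OF lin[OF w(1) v], of t 0] unfolding w(2) by (simp add: algebra_simps)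
        from mn[OF this, of n]
        have "(\<integral>y. (x n y)\<^sup>2 \<partial>M) \<le> (\<integral>y. (x n y - t * v y)\<^sup>2 \<partial>M) + (1/2)^n" .
        also have "(\<integral>y. (x n y - t * v y)\<^sup>2 \<partial>M) = (\<integral>y. (x n y)\<^sup>2 - 2 * t * (x n y * v y) + t\<^sup>2 * (v y)\<^sup>2 \<partial>M)"
          by (rule Bochner_Integration.integral_cong) (auto simp: power2_eq_square algebra_simps)
        also have "\<dots> = (\<integral>y. (x n y)\<^sup>2 \<partial>M) - 2 * t * (\<integral>y. x n y * v y \<partial>M) + t\<^sup>2 * ?c"
          using sqint_mult[OF sqC[OF x[of n]] sq[OF v]] sqC[OF x[of n]] sq[OF v] by (simp add: sqint_def)
        finally show ?thesis by simp
      qed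
      have eq: "(\<integral>y. x n y * v y \<partial>M) = (\<integral>y. (x n y - X y) * v y \<partial>M) + ?b" for n
        using sqint_mult[OF sqint_diff[OF sqC[OF x[of n]] X] sq[OF v]] sqint_mult[OF X sq[OF v]]
        by (subst Bochner_Integration.integral_add[symmetric]) (auto simp: algebra_simps)
      have "(\<lambda>n. (1/2)^n - 2 * t * (\<integral>y. x n y * v y \<partial>M) + t\<^sup>2 * ?c) \<longlonglongrightarrow> 0 - 2 * t * (0 + ?b) + t\<^sup>2 * ?c"
        unfolding eq by (intro tendsto_intros lim0) auto
      from LIMSEQ_le_const[OF this, of 0] ge show ?thesis by auto
    qed
    show ?thesis
    proof (rule ccontr)
      assume b: "?b \<noteq> 0"
      have c: "?c \<ge> 0" by simp
      define t where "t = ?b / (?c + 1)"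
      have "- 2 * t * ?b + t\<^sup>2 * ?c \<le> - 2 * t * ?b + t\<^sup>2 * (?c + 1)" by (simp add: mult_left_mono)
      also have "\<dots> = - (?b\<^sup>2 / (?c + 1))"
      proof -
        have "?c + 1 \<noteq> 0" using c by linarith
        then have "t * (?c + 1) = ?b" by (simp add: t_def)
        then have "- 2 * t * ?b + t\<^sup>2 * (?c + 1) = - (t * ?b)" by (simp add: power2_eq_square)
        then show ?thesis by (simp add: t_def power2_eq_square)
      qed
      also have "\<dots> < 0"
      proof -
        have "?b\<^sup>2 > 0" "?c + 1 > 0" using b c by (simp, linarith)
        then have "?b\<^sup>2 / (?c + 1) > 0" by (rule divide_pos_pos)
        then show ?thesis by simp
      qed
      finally show False using q[of t] by simp
    qed
  qed
  have X0: "AE y in M. X y = 0" by (rule triv[OF X orth])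
  obtain n where n: "(1/4::real)^n < e" using \<open>e > 0\<close> real_arch_pow_inv[of e "1/4"] by auto
  obtain w where w: "w \<in> V" "x n = (\<lambda>y. \<psi> y - w y)" using x[of n] unfolding C_def by auto
  have "(\<integral>y. (\<psi> y - w y)\<^sup>2 \<partial>M) = (\<integral>y. (x n y - X y)\<^sup>2 \<partial>M)"
    using X0 sqC[OF x[of n]] X w by (intro integral_cong_AE) (auto simp: sqint_def)
  then show ?thesis using w(1) cl[of n] n by (intro bexI[of _ w]) auto
qed

section \<open>Completeness of the cosine system\<close>

lemma AE_zero_if_box_integrals_zero:
  fixes w :: "'a::euclidean_space \<Rightarrow> real"
  assumes w: "integrable lborel w" and bx: "\<And>a b. (\<integral>y. indicator (box a b) y * w y \<partial>lborel) = 0"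
  shows "AE y in lborel. w y = 0"
proof -
  have [measurable]: "w \<in> borel_measurable borel" using w by (auto dest: borel_measurable_integrable)
  have wm: "integrable lborel (\<lambda>y. - w y)" using w by simp
  have half: "(\<integral>\<^sup>+y. ennreal (v y) * indicator (box a b) y \<partial>lborel) = ennreal (\<integral>y. indicator (box a b) y * max 0 (v y) \<partial>lborel)"
    if "integrable lborel v" for a b and v :: "'a \<Rightarrow> real"
  proof -
    have [measurable]: "v \<in> borel_measurable borel" using that by (auto dest: borel_measurable_integrable)
    have "(\<integral>\<^sup>+y. ennreal (v y) * indicator (box a b) y \<partial>lborel) = (\<integral>\<^sup>+y. ennreal (indicator (box a b) y * max 0 (v y)) \<partial>lborel)"
      by (intro nn_integral_cong) (auto simp: indicator_def ennreal_neg max_def)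
    also have "\<dots> = ennreal (\<integral>y. indicator (box a b) y * max 0 (v y) \<partial>lborel)"
      by (intro nn_integral_eq_integral Bochner_Integration.integrable_bound[OF that]) (auto simp: indicator_def)
    finally show ?thesis .
  qed
  have int: "integrable lborel (\<lambda>y. indicator (box a b) y * max 0 (v y))" if "integrable lborel v" for a b and v :: "'a \<Rightarrow> real"
  proof -
    have [measurable]: "v \<in> borel_measurable borel" using that by (auto dest: borel_measurable_integrable)
    show ?thesis by (rule Bochner_Integration.integrable_bound[OF that]) (auto simp: indicator_def)
  qed
  have eq: "(\<integral>y. indicator (box a b) y * max 0 (w y) \<partial>lborel) = (\<integral>y. indicator (box a b) y * max 0 (- w y) \<partial>lborel)" for a b
  proof -
    have "(\<integral>y. indicator (box a b) y * max 0 (w y) \<partial>lborel) - (\<integral>y. indicator (box a b) y * max 0 (- w y) \<partial>lborel)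
      = (\<integral>y. indicator (box a b) y * w y \<partial>lborel)"
      by (subst Bochner_Integration.integral_diff[symmetric, OF int[OF w] int[OF wm]])
         (rule Bochner_Integration.integral_cong, auto simp: indicator_def max_def)
    then show ?thesis using bx by simp
  qed
  have "density lborel (\<lambda>y. ennreal (w y)) = density lborel (\<lambda>y. ennreal (- w y))"
  proof (rule measure_eqI_generator_eq)
    let ?E = "range (\<lambda>(a, b). box a b::'a set)"
    let ?A = "\<lambda>n::nat. box (- (real n *\<^sub>R One)) (real n *\<^sub>R One) :: 'a set"
    show "Int_stable ?E" by (auto simp: Int_stable_def box_Int_box)
    show "?E \<subseteq> Pow UNIV" "sets (density lborel (\<lambda>y. ennreal (w y))) = sigma_sets UNIV ?E"
       "sets (density lborel (\<lambda>y. ennreal (- w y))) = sigma_sets UNIV ?E"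
      by (simp_all add: borel_eq_box)
    show "range ?A \<subseteq> ?E" "(\<Union>i. ?A i) = UNIV" unfolding UN_box_eq_UNIV by auto
    show "emeasure (density lborel (\<lambda>y. ennreal (w y))) (?A i) \<noteq> \<infinity>" for i
      by (simp add: emeasure_density half[OF w])
    show "emeasure (density lborel (\<lambda>y. ennreal (w y))) X = emeasure (density lborel (\<lambda>y. ennreal (- w y))) X" if "X \<in> ?E" for X
      using that by (auto simp: emeasure_density half[OF w] half[OF wm] eq)
  qed
  then have "AE y in lborel. ennreal (w y) = ennreal (- w y)"
    by (intro sigma_finite_measure.density_unique[OF sigma_finite_lborel]) auto
  then show ?thesis
  proof eventually_elim
    case (elim y)
    then show ?case
      by (metis ennreal_eq_0_iff ennreal_neg less_eq_real_def linorder_linear neg_0_le_iff_le neg_le_0_iff_le order_antisym)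
  qed
qed

lemma DERIV_pos_part_sq: "((\<lambda>s::real. (max 0 s)\<^sup>2) has_real_derivative 2 * max 0 s) (at s)"
proof -
  consider "s > 0" | "s < 0" | "s = 0" by linarith
  then show ?thesis
  proof cases
    case 1
    have "((\<lambda>s::real. s\<^sup>2) has_real_derivative 2 * s) (at s)" by (auto intro!: derivative_eq_intros)
    then have "((\<lambda>s::real. (max 0 s)\<^sup>2) has_real_derivative 2 * s) (at s)"
      by (rule has_field_derivative_transform_within_open[where S="{0<..}"]) (use 1 in auto)
    then show ?thesis using 1 by simp
  next
    case 2
    have "((\<lambda>s::real. 0) has_real_derivative 0) (at s)" by simp
    then have "((\<lambda>s::real. (max 0 s)\<^sup>2) has_real_derivative 0) (at s)"
      by (rule has_field_derivative_transform_within_open[where S="{..<0}"]) (use 2 in auto)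
    then show ?thesis using 2 by simp
  next
    case 3
    have "((\<lambda>h::real. (max 0 h)\<^sup>2 / h) \<longlongrightarrow> 0) (at 0)"
    proof (rule Lim_null_comparison)
      show "\<forall>\<^sub>F h in at (0::real). norm ((max 0 h)\<^sup>2 / h) \<le> \<bar>h\<bar>"
        by (rule always_eventually) (auto simp: max_def power2_eq_square)
      show "((\<lambda>h::real. \<bar>h\<bar>) \<longlongrightarrow> 0) (at 0)" by (intro tendsto_rabs_zero tendsto_ident_at)
    qed
    then show ?thesis using 3 by (simp add: DERIV_def)
  qed
qed

lemma smooth_interval_bump:
  fixes l r :: real assumes "l < r"
  shows "\<exists>b b' :: nat \<Rightarrow> real \<Rightarrow> real. (\<forall>n s. (b n has_real_derivative b' n s) (at s)) \<and>
    (\<forall>n. continuous_on UNIV (b' n)) \<and> (\<forall>n s. 0 \<le> b n s \<and> b n s \<le> 1) \<and>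
    (\<forall>n s. s \<notin> {l<..<r} \<longrightarrow> b n s = 0 \<and> b' n s = 0) \<and>
    (\<forall>s. (\<lambda>n. b n s) \<longlonglongrightarrow> indicator {l<..<r} s)"
proof -
  define q where "q s = (max 0 ((s - l) * (r - s)))\<^sup>2" for s
  define q' where "q' s = 2 * max 0 ((s - l) * (r - s)) * (r + l - 2 * s)" for s
  have dq: "(q has_real_derivative q' s) (at s)" for s
  proof -
    have i: "((\<lambda>s. (s - l) * (r - s)) has_real_derivative (r + l - 2 * s)) (at s)"
      by (auto intro!: derivative_eq_intros)
    show ?thesis unfolding q_def[abs_def] q'_def
      using DERIV_chain[OF DERIV_pos_part_sq i] by (simp add: o_def)
  qed
  have q0: "q s \<ge> 0" for s unfolding q_def by simp
  have cq: "continuous_on UNIV q'" "continuous_on UNIV q" unfolding q'_def q_def by (intro continuous_intros)+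
  have out: "q s = 0 \<and> q' s = 0" if "s \<notin> {l<..<r}" for s
  proof -
    have "(s - l) * (r - s) \<le> 0" using that assms by (auto simp: mult_le_0_iff)
    then show ?thesis by (simp add: q_def q'_def max_def)
  qed
  have ins: "q s > 0" if "s \<in> {l<..<r}" for s using that by (simp add: q_def)
  define b where "b n s = real n * q s / (1 + real n * q s)" for n s
  define b' where "b' n s = real n * q' s / (1 + real n * q s)\<^sup>2" for n s
  have pos: "1 + real n * q s > 0" for n s using q0[of s] by (simp add: add_pos_nonneg)
  show ?thesis
  proof (rule exI[of _ b], rule exI[of _ b'], intro conjI allI impI)
    fix n s
    show "(b n has_real_derivative b' n s) (at s)"
      unfolding b_def[abs_def] b'_def using pos[of n s]
      by (auto intro!: derivative_eq_intros dq simp: power2_eq_square algebra_simps)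
    show "0 \<le> b n s" "b n s \<le> 1" unfolding b_def using pos[of n s] q0[of s] by auto
  next
    fix n show "continuous_on UNIV (b' n)" unfolding b'_def using pos
      by (intro continuous_intros cq) (auto simp: less_imp_neq[symmetric])
  next
    fix n s assume "s \<notin> {l<..<r}"
    from out[OF this] show "b n s = 0" "b' n s = 0" by (auto simp: b_def b'_def)
  next
    fix s show "(\<lambda>n. b n s) \<longlonglongrightarrow> indicator {l<..<r} s"
    proof (cases "s \<in> {l<..<r}")
      case True
      have "(\<lambda>n. 1 - inverse (1 + real n * q s)) \<longlonglongrightarrow> 1 - 0"
      proof (intro tendsto_diff tendsto_const tendsto_inverse_0_at_top)
        show "filterlim (\<lambda>n. 1 + real n * q s) at_top sequentially"
          by (intro filterlim_tendsto_add_at_top[OF tendsto_const]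
              filterlim_at_top_mult_tendsto_pos[OF tendsto_const ins[OF True]] filterlim_real_sequentially)
      qed
      moreover have "b n s = 1 - inverse (1 + real n * q s)" for n
        unfolding b_def using pos[of n s] by (simp add: field_simps)
      ultimately show ?thesis using True by simp
    next
      case False
      then show ?thesis using out[OF False] by (simp add: b_def)
    qed
  qed
qed

lemma integral_continuous_cos_zero:
  fixes W \<theta> :: "'a \<Rightarrow> real"
  assumes W: "integrable M W" and [measurable]: "\<theta> \<in> borel_measurable M"
    and orth: "\<And>k::nat. (\<integral>y. W y * cos (real k * \<theta> y) \<partial>M) = 0"
    and g: "continuous_on {-1..1} g" and gm: "g \<in> borel_measurable borel"
  shows "(\<integral>y. W y * g (cos (\<theta> y)) \<partial>M) = 0"
proof -
  note [measurable] = gm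
  have [measurable]: "W \<in> borel_measurable M" using W by auto
  have intb: "integrable M (\<lambda>y. W y * h y)" if "h \<in> borel_measurable M" "\<And>y. \<bar>h y\<bar> \<le> B" for h B
  proof (rule Bochner_Integration.integrable_bound[where f="\<lambda>y. B * W y"])
    have "B \<ge> 0" using that(2) by (meson abs_ge_zero order_trans)
    then show "AE y in M. norm (W y * h y) \<le> norm (B * W y)"
      using that(2) by (intro AE_I2) (simp add: abs_mult mult.commute[of B] mult_left_mono)
  qed (use W that in auto)
  have pw: "\<bar>cos (\<theta> y) ^ i * cos (real k * \<theta> y)\<bar> \<le> 1" for i k y
    by (simp add: abs_mult power_abs power_le_one mult_le_one)
  have pows: "(\<integral>y. W y * (cos (\<theta> y) ^ i * cos (real k * \<theta> y)) \<partial>M) = 0" for i k :: nat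
  proof (induction i arbitrary: k)
    case 0 then show ?case using orth by simp
  next
    case (Suc i)
    show ?case
    proof (cases k)
      case 0 then show ?thesis using Suc[of 1] by (simp add: mult.commute)
    next
      case k: (Suc j)
      have "W y * (cos (\<theta> y) ^ Suc i * cos (real k * \<theta> y)) =
        (1/2) * (W y * (cos (\<theta> y) ^ i * cos (real (Suc k) * \<theta> y))) + (1/2) * (W y * (cos (\<theta> y) ^ i * cos (real j * \<theta> y)))" for y
      proof -
        have "cos (real (Suc k) * \<theta> y) + cos (real j * \<theta> y) = 2 * cos (\<theta> y) * cos (real k * \<theta> y)"
        proof -
          have "real (Suc k) * \<theta> y = real k * \<theta> y + \<theta> y" "real j * \<theta> y = real k * \<theta> y - \<theta> y"
            unfolding k by (simp_all add: algebra_simps)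
          then show ?thesis by (simp only: cos_add cos_diff) simp
        qed
        then have "(1/2) * (W y * cos (\<theta> y) ^ i) * (cos (real (Suc k) * \<theta> y) + cos (real j * \<theta> y))
          = (W y * cos (\<theta> y) ^ i) * (cos (\<theta> y) * cos (real k * \<theta> y))" by simp
        then show ?thesis by (simp only: distrib_left mult.assoc power_Suc2)
      qed
      then have "(\<integral>y. W y * (cos (\<theta> y) ^ Suc i * cos (real k * \<theta> y)) \<partial>M)
        = (\<integral>y. (1/2) * (W y * (cos (\<theta> y) ^ i * cos (real (Suc k) * \<theta> y))) + (1/2) * (W y * (cos (\<theta> y) ^ i * cos (real j * \<theta> y))) \<partial>M)"
        by presburger
      also have "\<dots> = (1/2) * (\<integral>y. W y * (cos (\<theta> y) ^ i * cos (real (Suc k) * \<theta> y)) \<partial>M) + (1/2) * (\<integral>y. W y * (cos (\<theta> y) ^ i * cos (real j * \<theta> y)) \<partial>M)"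
      proof -
        have i: "integrable M (\<lambda>y. (1/2) * (W y * (cos (\<theta> y) ^ i * cos (real l * \<theta> y))))" for l
          using pw by (intro integrable_mult_right intb[where B=1]) auto
        show ?thesis by (subst Bochner_Integration.integral_add[OF i i]) simp
      qed
      finally show ?thesis using Suc[of "Suc k"] Suc[of j] by (simp only: mult_zero_right add_0)
    qed
  qed
  have cosin: "cos (\<theta> y) \<in> {-1..1}" for y by auto
  define I where "I = (\<integral>y. \<bar>W y\<bar> \<partial>M)"
  have I0: "I \<ge> 0" unfolding I_def by simp
  have "\<bar>\<integral>y. W y * g (cos (\<theta> y)) \<partial>M\<bar> \<le> e" if "e > 0" for e
  proof -
    obtain p where p: "real_polynomial_function p" "\<And>x. x \<in> {-1..1} \<Longrightarrow> \<bar>g x - p x\<bar> < e / (I + 1)"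
      using Stone_Weierstrass_real_polynomial_function[OF compact_Icc g, of "e / (I + 1)"] \<open>e > 0\<close> I0 by auto
    obtain a n where an: "p = (\<lambda>x. \<Sum>i\<le>n. a i * x ^ i)" using p(1) unfolding real_polynomial_function_iff_sum by blast
    have [measurable]: "p \<in> borel_measurable borel" unfolding an by measurable
    have "(\<integral>y. W y * p (cos (\<theta> y)) \<partial>M) = (\<integral>y. (\<Sum>i\<le>n. a i * (W y * cos (\<theta> y) ^ i)) \<partial>M)"
      unfolding an by (intro Bochner_Integration.integral_cong) (auto simp: sum_distrib_left ac_simps)
    also have "\<dots> = (\<Sum>i\<le>n. a i * (\<integral>y. W y * cos (\<theta> y) ^ i \<partial>M))"
      by (subst Bochner_Integration.integral_sum) (auto intro!: intb[where B=1] integrable_mult_right simp: power_abs power_le_one)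
    also have "\<dots> = 0" using pows[of _ 0] by simp
    finally have p0: "(\<integral>y. W y * p (cos (\<theta> y)) \<partial>M) = 0" .
    have "compact (g ` {-1..1})" using g by (intro compact_continuous_image) auto
    then obtain Bg where Bg: "\<And>s. s \<in> {-1..1} \<Longrightarrow> \<bar>g s\<bar> \<le> Bg"
      using compact_imp_bounded[of "g ` {-1..1}"] unfolding bounded_iff by force
    have ig: "integrable M (\<lambda>y. W y * g (cos (\<theta> y)))" using Bg cosin by (intro intb[where B=Bg]) auto
    have id: "integrable M (\<lambda>y. W y * (g (cos (\<theta> y)) - p (cos (\<theta> y))))"
      using p(2) cosin by (intro intb[where B="e / (I + 1)"]) (auto simp: less_imp_le)
    have ip: "integrable M (\<lambda>y. W y * p (cos (\<theta> y)))"
      using Bochner_Integration.integrable_diff[OF ig id] by (simp add: algebra_simps)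
    have "(\<integral>y. W y * g (cos (\<theta> y)) \<partial>M) = (\<integral>y. W y * (g (cos (\<theta> y)) - p (cos (\<theta> y))) \<partial>M)"
      using Bochner_Integration.integral_diff[OF ig ip] p0 by (simp add: algebra_simps)
    also have "\<bar>\<dots>\<bar> \<le> (\<integral>y. \<bar>W y * (g (cos (\<theta> y)) - p (cos (\<theta> y)))\<bar> \<partial>M)" by (rule integral_abs_bound)
    also have "\<dots> \<le> (\<integral>y. \<bar>W y\<bar> * (e / (I + 1)) \<partial>M)"
    proof (rule integral_mono)
      show "integrable M (\<lambda>y. \<bar>W y * (g (cos (\<theta> y)) - p (cos (\<theta> y)))\<bar>)" using id by (rule integrable_abs)
      show "\<bar>W y * (g (cos (\<theta> y)) - p (cos (\<theta> y)))\<bar> \<le> \<bar>W y\<bar> * (e / (I + 1))" for y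
        unfolding abs_mult using p(2)[OF cosin[of y]] by (intro mult_left_mono) auto
    qed (use W in auto)
    also have "\<dots> = I * (e / (I + 1))" unfolding I_def by simp
    also have "\<dots> \<le> e" using I0 \<open>e > 0\<close> by (simp add: field_simps)
    finally show ?thesis .
  qed
  then have "\<bar>\<integral>y. W y * g (cos (\<theta> y)) \<partial>M\<bar> \<le> 0" by (rule field_le_epsilon[of _ 0, simplified])
  then show ?thesis by simp
qed

lemma borel_measurable_fst_comp[measurable (raw)]:
  fixes f :: "'c \<Rightarrow> 'a::second_countable_topology \<times> 'b::second_countable_topology"
  assumes "f \<in> borel_measurable M" shows "(\<lambda>y. fst (f y)) \<in> borel_measurable M"
  by (rule measurable_compose[OF assms]) (auto intro!: borel_measurable_continuous_onI continuous_intros)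

lemma borel_measurable_snd_comp[measurable (raw)]:
  fixes f :: "'c \<Rightarrow> 'a::second_countable_topology \<times> 'b::second_countable_topology"
  assumes "f \<in> borel_measurable M" shows "(\<lambda>y. snd (f y)) \<in> borel_measurable M"
  by (rule measurable_compose[OF assms]) (auto intro!: borel_measurable_continuous_onI continuous_intros)

lemma cos_gt_iff_in_interval:
  fixes x l r :: real
  assumes "0 < x" "x < 24" "0 \<le> l" "l < r" "r \<le> 24"
  shows "cos (pi/12 * (x - (l + r)/2)) > cos (pi/12 * ((r - l)/2)) \<longleftrightarrow> x \<in> {l<..<r}"
proof -
  define d where "d = \<bar>x - (l + r)/2\<bar>"
  define \<rho> where "\<rho> = (r - l)/2"
  have r: "0 < \<rho>" "\<rho> \<le> 12" and d: "0 \<le> d" "d < 24 - \<rho>" using assms by (auto simp: d_def \<rho>_def abs_less_iff field_simps)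
  have iff: "x \<in> {l<..<r} \<longleftrightarrow> d < \<rho>" using assms by (auto simp: d_def \<rho>_def abs_less_iff field_simps)
  have "cos (pi/12 * (x - (l + r)/2)) = cos (\<bar>pi/12 * (x - (l + r)/2)\<bar>)" by (rule cos_abs_real[symmetric])
  also have "\<dots> = cos (pi/12 * d)" by (simp add: d_def abs_mult)
  finally have c: "cos (pi/12 * (x - (l + r)/2)) = cos (pi/12 * d)" .
  have k: "pi/12 * s \<le> pi" if "s \<le> 12" for s :: real using that pi_gt_zero by (simp add: field_simps)
  have k0: "0 \<le> pi/12 * s" if "s \<ge> 0" for s :: real using that by simp
  have "cos (pi/12 * d) > cos (pi/12 * \<rho>) \<longleftrightarrow> d < \<rho>"
  proof
    assume "d < \<rho>"
    then show "cos (pi/12 * d) > cos (pi/12 * \<rho>)"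
      using r d by (intro cos_monotone_0_pi k k0) auto
  next
    assume gt: "cos (pi/12 * d) > cos (pi/12 * \<rho>)"
    show "d < \<rho>"
    proof (rule ccontr)
      assume "\<not> d < \<rho>"
      then have dr: "\<rho> \<le> d" by simp
      show False
      proof (cases "d \<le> 12")
        case True
        then have "cos (pi/12 * d) \<le> cos (pi/12 * \<rho>)"
          using dr r d by (intro cos_monotone_0_pi_le k k0) auto
        then show False using gt by simp
      next
        case False
        have "cos (pi/12 * d) = cos (2 * pi - pi/12 * d)" by simp
        also have "2 * pi - pi/12 * d = pi/12 * (24 - d)" by (simp add: field_simps)
        also have "cos (pi/12 * (24 - d)) \<le> cos (pi/12 * \<rho>)"
          using False r d by (intro cos_monotone_0_pi_le k k0) auto
        finally show False using gt by simp
      qed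
    qed
  qed
  then show ?thesis using c iff by (simp add: \<rho>_def)
qed

lemma tendsto_ramp_indicator:
  "(\<lambda>n. min 1 (real n * max 0 s)) \<longlonglongrightarrow> (if s > 0 then 1 else 0)"
proof (cases "s > 0")
  case True
  have "eventually (\<lambda>n. min 1 (real n * max 0 s) = 1) sequentially"
    using eventually_ge_at_top[of "nat \<lceil>1/s\<rceil>"]
  proof eventually_elim
    case (elim n)
    then have "1/s \<le> real n" by linarith
    then have "1 \<le> real n * s" using True by (simp add: field_simps)
    then show ?case using True by simp
  qed
  then show ?thesis using True by (simp add: tendsto_eventually)
qed simp

lemma product_cos_orthogonal_imp_zero:
  fixes w :: "real \<times> real \<times> real \<Rightarrow> real"
  assumes w: "integrable lborel w" and supp: "\<And>y. y \<notin> QQ A T \<Longrightarrow> w y = 0"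
    and orth: "\<And>b b' c c' k m. (\<And>s. (b has_real_derivative b' s) (at s)) \<Longrightarrow> continuous_on UNIV b'
       \<Longrightarrow> (\<And>s. s \<ge> A \<Longrightarrow> b s = 0 \<and> b' s = 0) \<Longrightarrow> (\<And>s. (c has_real_derivative c' s) (at s))
       \<Longrightarrow> continuous_on UNIV c' \<Longrightarrow> (\<And>s. s \<ge> T \<Longrightarrow> c s = 0 \<and> c' s = 0)
       \<Longrightarrow> (\<integral>y. w y * (b (fst y) * c (fst (snd y)) * cos (real k * (pi/12 * (snd (snd y) - m)))) \<partial>lborel) = 0"
  shows "AE y in lborel. w y = 0"
proof (rule AE_zero_if_box_integrals_zero[OF w])
  have [measurable]: "w \<in> borel_measurable borel" using w by (auto dest: borel_measurable_integrable)
  fix lo hi :: "real \<times> real \<times> real"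
  obtain a1 a2 a3 where lo: "lo = (a1, a2, a3)" by (cases lo) auto
  obtain b1 b2 b3 where hi: "hi = (b1, b2, b3)" by (cases hi) auto
  define l1 l2 l3 r1 r2 r3 where lr: "l1 = max a1 0" "l2 = max a2 0" "l3 = max a3 0"
    "r1 = min b1 A" "r2 = min b2 T" "r3 = min b3 24"
  have bx: "(a, t, x) \<in> box lo hi \<longleftrightarrow> a1 < a \<and> a < b1 \<and> a2 < t \<and> t < b2 \<and> a3 < x \<and> x < b3" for a t x
    unfolding lo hi by (auto simp: mem_box Basis_prod_def)
  have ind: "indicator (box lo hi) y * w y =
     w y * (indicator {l1<..<r1} (fst y) * indicator {l2<..<r2} (fst (snd y)) * indicator {l3<..<r3} (snd (snd y)))" for y
  proof (cases "y \<in> QQ A T")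
    case True
    then show ?thesis by (cases y) (auto simp: QQ_def lr indicator_def bx)
  next
    case False
    then show ?thesis by (simp add: supp)
  qed
  show "(\<integral>y. indicator (box lo hi) y * w y \<partial>lborel) = 0"
  proof (cases "l1 < r1 \<and> l2 < r2 \<and> l3 < r3")
    case False
    then have "indicator (box lo hi) y * w y = 0" for y unfolding ind by (auto simp: indicator_def)
    then show ?thesis by (simp only: Bochner_Integration.integral_zero)
  next
    case True
    obtain b b' :: "nat \<Rightarrow> real \<Rightarrow> real" where b: "\<And>n s. (b n has_real_derivative b' n s) (at s)" "\<And>n. continuous_on UNIV (b' n)"
       "\<And>n s. 0 \<le> b n s \<and> b n s \<le> 1" "\<And>n s. s \<notin> {l1<..<r1} \<Longrightarrow> b n s = 0 \<and> b' n s = 0"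
       "\<And>s. (\<lambda>n. b n s) \<longlonglongrightarrow> indicator {l1<..<r1} s"
      using smooth_interval_bump[of l1 r1] True by blast
    obtain c c' :: "nat \<Rightarrow> real \<Rightarrow> real" where c: "\<And>n s. (c n has_real_derivative c' n s) (at s)" "\<And>n. continuous_on UNIV (c' n)"
       "\<And>n s. 0 \<le> c n s \<and> c n s \<le> 1" "\<And>n s. s \<notin> {l2<..<r2} \<Longrightarrow> c n s = 0 \<and> c' n s = 0"
       "\<And>s. (\<lambda>n. c n s) \<longlonglongrightarrow> indicator {l2<..<r2} s"
      using smooth_interval_bump[of l2 r2] True by blast
    have [measurable]: "b n \<in> borel_measurable borel" "c n \<in> borel_measurable borel" for n
      by (rule borel_measurable_continuous_onI, rule DERIV_continuous_on, rule has_field_derivative_at_within, rule b,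
          rule borel_measurable_continuous_onI, rule DERIV_continuous_on, rule has_field_derivative_at_within, rule c)
    define m where "m = (l3 + r3)/2"
    define \<gamma> where "\<gamma> = cos (pi/12 * ((r3 - l3)/2))"
    define g where "g n s = min 1 (real n * max 0 (s - \<gamma>))" for n s
    define \<theta> where "\<theta> y = pi/12 * (snd (snd y) - m)" for y :: "real \<times> real \<times> real"
    have [measurable]: "\<theta> \<in> borel_measurable borel" unfolding \<theta>_def by measurable
    have [measurable]: "g n \<in> borel_measurable borel" for n unfolding g_def by measurable
    have g01: "0 \<le> g n s \<and> g n s \<le> 1" for n s by (auto simp: g_def)
    have zero: "(\<integral>y. w y * (b n (fst y) * c n (fst (snd y)) * g n (cos (\<theta> y))) \<partial>lborel) = 0" for n
    proof -
      have "(\<integral>y. (w y * (b n (fst y) * c n (fst (snd y)))) * g n (cos (\<theta> y)) \<partial>lborel) = 0"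
      proof (rule integral_continuous_cos_zero)
        show "integrable lborel (\<lambda>y. w y * (b n (fst y) * c n (fst (snd y))))"
        proof (rule Bochner_Integration.integrable_bound[OF w])
          show "AE y in lborel. norm (w y * (b n (fst y) * c n (fst (snd y)))) \<le> norm (w y)"
            using b(3) c(3) by (intro AE_I2) (auto simp: abs_mult intro!: mult_left_le mult_le_one)
        qed measurable
        show "(\<integral>y. w y * (b n (fst y) * c n (fst (snd y))) * cos (real k * \<theta> y) \<partial>lborel) = 0" for k
          using orth[OF b(1)[of n] b(2)[of n] _ c(1)[of n] c(2)[of n], of k m] b(4)[of _ n] c(4)[of _ n]
          by (simp add: \<theta>_def mult.assoc lr)
        show "continuous_on {- 1..1} (g n)" unfolding g_def by (intro continuous_intros)
      qed auto
      then show ?thesis by (simp add: mult.assoc)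
    qed
    have "(\<lambda>n. \<integral>y. w y * (b n (fst y) * c n (fst (snd y)) * g n (cos (\<theta> y))) \<partial>lborel) \<longlonglongrightarrow>
      (\<integral>y. indicator (box lo hi) y * w y \<partial>lborel)"
    proof (rule integral_dominated_convergence[where w="\<lambda>y. \<bar>w y\<bar>"])
      show "AE y in lborel. (\<lambda>n. w y * (b n (fst y) * c n (fst (snd y)) * g n (cos (\<theta> y)))) \<longlonglongrightarrow> indicator (box lo hi) y * w y"
      proof (rule AE_I2)
        fix y :: "real \<times> real \<times> real"
        show "(\<lambda>n. w y * (b n (fst y) * c n (fst (snd y)) * g n (cos (\<theta> y)))) \<longlonglongrightarrow> indicator (box lo hi) y * w y"
        proof (cases "y \<in> QQ A T")
          case False then show ?thesis by (simp add: supp)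
        next
          case yq: True
          define x where "x = snd (snd y)"
          have x: "0 < x" "x < 24" using yq by (auto simp: QQ_def x_def)
          have "(cos (\<theta> y) - \<gamma> > 0) = (x \<in> {l3<..<r3})"
            using cos_gt_iff_in_interval[OF x, of l3 r3] True by (simp add: lr \<theta>_def \<gamma>_def m_def x_def)
          then have ei: "(if cos (\<theta> y) - \<gamma> > 0 then 1 else 0) = indicat_real {l3<..<r3} x"
            by (simp add: indicator_def)
          have "(\<lambda>n. g n (cos (\<theta> y))) \<longlonglongrightarrow> indicator {l3<..<r3} x"
            using tendsto_ramp_indicator[of "cos (\<theta> y) - \<gamma>"] unfolding g_def ei .
          then show ?thesis unfolding ind x_def by (intro tendsto_intros b c)
        qed
      qed
      show "AE y in lborel. norm (w y * (b n (fst y) * c n (fst (snd y)) * g n (cos (\<theta> y)))) \<le> \<bar>w y\<bar>" for n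
        using b(3) c(3) g01 by (intro AE_I2) (auto simp: abs_mult intro!: mult_left_le mult_le_one)
    qed (use w in auto)
    then show ?thesis unfolding zero by (simp add: LIMSEQ_const_iff)
  qed
qed

section \<open>Test functions and energy estimates\<close>

definition ctest :: "real \<Rightarrow> real \<Rightarrow> real \<Rightarrow> (real \<times> real \<times> real \<Rightarrow> real)
   \<Rightarrow> (real \<times> real \<times> real \<Rightarrow> real) \<Rightarrow> (real \<times> real \<times> real \<Rightarrow> real)
   \<Rightarrow> (real \<times> real \<times> real \<Rightarrow> real) \<Rightarrow> bool" where
  "ctest A ad T \<phi> \<phi>a \<phi>t \<phi>xx \<longleftrightarrow> test_fun ad T \<phi> \<phi>a \<phi>t \<phi>xx \<and>
     (\<forall>a t x. a \<ge> A \<longrightarrow> \<phi> (a, t, x) = 0 \<and> \<phi>a (a, t, x) = 0 \<and> \<phi>t (a, t, x) = 0 \<and> \<phi>xx (a, t, x) = 0)"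

lemma test_fun_x_deriv:
  "test_fun ad T \<phi> \<phi>a \<phi>t \<phi>xx \<Longrightarrow>
   \<exists>\<phi>x. (\<forall>a t x. ((\<lambda>z. \<phi> (a, t, z)) has_real_derivative \<phi>x (a, t, x)) (at x)) \<and>
        (\<forall>a t x. ((\<lambda>z. \<phi>x (a, t, z)) has_real_derivative \<phi>xx (a, t, x)) (at x))"
  unfolding test_fun_def by (elim conjE)

lemma test_fun_vanish:
  "test_fun ad T \<phi> \<phi>a \<phi>t \<phi>xx \<Longrightarrow> \<exists>\<epsilon>>0. \<forall>a t x. a \<ge> ad - \<epsilon> \<longrightarrow> \<phi> (a, t, x) = 0"
  unfolding test_fun_def by (elim conjE)

lemma test_funD:
  assumes "test_fun ad T \<phi> \<phi>a \<phi>t \<phi>xx"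
  shows "continuous_on UNIV \<phi>" "continuous_on UNIV \<phi>a" "continuous_on UNIV \<phi>t" "continuous_on UNIV \<phi>xx"
    "((\<lambda>b. \<phi> (b, t, x)) has_real_derivative \<phi>a (a, t, x)) (at a)"
    "((\<lambda>s. \<phi> (a, s, x)) has_real_derivative \<phi>t (a, t, x)) (at t)"
    "\<phi> (a, t, x + 24) = \<phi> (a, t, x)" "\<phi> (a, T, x) = 0"
  using assms by (simp_all add: test_fun_def)

lemma test_fun_lincomb:
  assumes 1: "test_fun ad T \<phi> \<phi>a \<phi>t \<phi>xx" and 2: "test_fun ad T \<psi> \<psi>a \<psi>t \<psi>xx"
  shows "test_fun ad T (\<lambda>y. \<phi> y + c * \<psi> y) (\<lambda>y. \<phi>a y + c * \<psi>a y) (\<lambda>y. \<phi>t y + c * \<psi>t y) (\<lambda>y. \<phi>xx y + c * \<psi>xx y)"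
proof -
  obtain \<phi>x where p: "\<forall>a t x. ((\<lambda>z. \<phi> (a, t, z)) has_real_derivative \<phi>x (a, t, x)) (at x)"
     "\<forall>a t x. ((\<lambda>z. \<phi>x (a, t, z)) has_real_derivative \<phi>xx (a, t, x)) (at x)"
    using test_fun_x_deriv[OF 1] by (elim exE conjE) (rule that)
  obtain \<psi>x where q: "\<forall>a t x. ((\<lambda>z. \<psi> (a, t, z)) has_real_derivative \<psi>x (a, t, x)) (at x)"
     "\<forall>a t x. ((\<lambda>z. \<psi>x (a, t, z)) has_real_derivative \<psi>xx (a, t, x)) (at x)"
    using test_fun_x_deriv[OF 2] by (elim exE conjE) (rule that)
  obtain e1 where e1: "e1 > 0" "\<forall>a t x. a \<ge> ad - e1 \<longrightarrow> \<phi> (a, t, x) = 0" using test_fun_vanish[OF 1] by (elim exE conjE) (rule that)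
  obtain e2 where e2: "e2 > 0" "\<forall>a t x. a \<ge> ad - e2 \<longrightarrow> \<psi> (a, t, x) = 0" using test_fun_vanish[OF 2] by (elim exE conjE) (rule that)
  have cmul: "((\<lambda>z. f z + c * g z) has_real_derivative f' + c * g') (at x)"
    if "(f has_real_derivative f') (at x)" "(g has_real_derivative g') (at x)" for f g f' g' x
    using that by (auto intro!: derivative_eq_intros)
  note d1 = test_funD[OF 1] and d2 = test_funD[OF 2]
  show ?thesis unfolding test_fun_def
  proof (intro conjI allI)
    show "\<exists>\<epsilon>>0. \<forall>a t x. ad - \<epsilon> \<le> a \<longrightarrow> \<phi> (a, t, x) + c * \<psi> (a, t, x) = 0"
      using e1 e2 by (intro exI[of _ "min e1 e2"]) auto
    show "\<exists>\<phi>'x. (\<forall>a t x. ((\<lambda>z. \<phi> (a, t, z) + c * \<psi> (a, t, z)) has_real_derivative \<phi>'x (a, t, x)) (at x)) \<and>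
          (\<forall>a t x. ((\<lambda>z. \<phi>'x (a, t, z)) has_real_derivative \<phi>xx (a, t, x) + c * \<psi>xx (a, t, x)) (at x))"
      by (rule exI[of _ "\<lambda>y. \<phi>x y + c * \<psi>x y"]) (simp add: cmul p q)
    show "((\<lambda>b. \<phi> (b, t, x) + c * \<psi> (b, t, x)) has_real_derivative \<phi>a (a, t, x) + c * \<psi>a (a, t, x)) (at a)" for a t x
      by (rule cmul[OF d1(5) d2(5)])
    show "((\<lambda>s. \<phi> (a, s, x) + c * \<psi> (a, s, x)) has_real_derivative \<phi>t (a, t, x) + c * \<psi>t (a, t, x)) (at t)" for a t x
      by (rule cmul[OF d1(6) d2(6)])
    show "\<phi> (a, t, x + 24) + c * \<psi> (a, t, x + 24) = \<phi> (a, t, x) + c * \<psi> (a, t, x)"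
      "\<phi> (a, T, x) + c * \<psi> (a, T, x) = 0" for a t x by (simp_all add: d1(7,8) d2(7,8))
  qed (intro continuous_on_add continuous_on_mult_left d1(1-4) d2(1-4))+
qed

lemma test_fun_zero: "test_fun ad T (\<lambda>y. 0) (\<lambda>y. 0) (\<lambda>y. 0) (\<lambda>y. 0)"
proof -
  have "\<exists>\<epsilon>>0::real. True" by (rule exI[of _ 1]) simp
  moreover have "\<exists>\<phi>x :: real \<times> real \<times> real \<Rightarrow> real. (\<forall>a t x. ((\<lambda>z. 0) has_real_derivative \<phi>x (a, t, x)) (at x)) \<and>
             (\<forall>a t x. ((\<lambda>z. \<phi>x (a, t, z)) has_real_derivative 0) (at x))"
    by (rule exI[of _ "\<lambda>y. 0"]) simp
  ultimately show ?thesis unfolding test_fun_def by simp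
qed

lemma ctest_lincomb:
  assumes "ctest A ad T \<phi> \<phi>a \<phi>t \<phi>xx" "ctest A ad T \<psi> \<psi>a \<psi>t \<psi>xx"
  shows "ctest A ad T (\<lambda>y. \<phi> y + c * \<psi> y) (\<lambda>y. \<phi>a y + c * \<psi>a y) (\<lambda>y. \<phi>t y + c * \<psi>t y) (\<lambda>y. \<phi>xx y + c * \<psi>xx y)"
  unfolding ctest_def
proof (rule conjI)
  show "test_fun ad T (\<lambda>y. \<phi> y + c * \<psi> y) (\<lambda>y. \<phi>a y + c * \<psi>a y) (\<lambda>y. \<phi>t y + c * \<psi>t y) (\<lambda>y. \<phi>xx y + c * \<psi>xx y)"
    using assms unfolding ctest_def by (intro test_fun_lincomb) (elim conjE, assumption)+
qed (use assms in \<open>simp add: ctest_def\<close>)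

lemma ctest_zero: "ctest A ad T (\<lambda>y. 0) (\<lambda>y. 0) (\<lambda>y. 0) (\<lambda>y. 0)"
  by (simp add: ctest_def test_fun_zero)

lemma ctest_uminus:
  assumes "ctest A ad T \<phi> \<phi>a \<phi>t \<phi>xx"
  shows "ctest A ad T (\<lambda>y. - \<phi> y) (\<lambda>y. - \<phi>a y) (\<lambda>y. - \<phi>t y) (\<lambda>y. - \<phi>xx y)"
  using ctest_lincomb[OF ctest_zero assms, of "-1"] by simp

lemma ctest_solve:
  assumes "A < ad" "T > 0"
    and b: "\<And>s. (b has_real_derivative b' s) (at s)" "continuous_on UNIV b'" "\<And>s. s \<ge> A \<Longrightarrow> b s = 0 \<and> b' s = 0"
    and c: "\<And>s. (c has_real_derivative c' s) (at s)" "continuous_on UNIV c'" "\<And>s. s \<ge> T \<Longrightarrow> c s = 0 \<and> c' s = 0"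
  shows "\<exists>\<phi> \<phi>a \<phi>t \<phi>xx. ctest A ad T \<phi> \<phi>a \<phi>t \<phi>xx \<and> (\<forall>a t x. t \<ge> 0 \<longrightarrow>
     - \<phi>a (a, t, x) - \<phi>t (a, t, x) - \<delta> * \<phi>xx (a, t, x) + lam * \<phi> (a, t, x)
      = b a * c t * cos (real k * (pi/12 * (x - m))))"
proof -
  define \<omega> where "\<omega> = real k * (pi/12)"
  define \<Lambda> where "\<Lambda> = lam + \<delta> * \<omega>\<^sup>2"
  have cb: "continuous_on UNIV b" "continuous_on UNIV c"
    by (rule DERIV_continuous_on, rule has_field_derivative_at_within, rule b,
        rule DERIV_continuous_on, rule has_field_derivative_at_within, rule c)
  have sh: "continuous_on S (\<lambda>z. p (g z + h z))"
    if "continuous_on UNIV p" "continuous_on S g" "continuous_on S h" for p g h :: "_ \<Rightarrow> real" and S :: "'z::topological_space set"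
    by (rule continuous_on_compose2[OF that(1) continuous_on_add[OF that(2,3)]]) simp
  note sp = continuous_on_fst[OF continuous_on_id] continuous_on_snd[OF continuous_on_id]
    continuous_on_fst[OF continuous_on_snd[OF continuous_on_id]] continuous_on_fst[OF continuous_on_fst[OF continuous_on_id]]
    continuous_on_fst[OF continuous_on_snd[OF continuous_on_fst[OF continuous_on_id]]] continuous_on_const continuous_on_id
  note ex = continuous_on_exp[OF continuous_on_mult_left]
  define F where "F p q a t = integral (cbox 0 T) (\<lambda>s. exp (- \<Lambda> * s) * (p (a + s) * q (t + s)))" for p q :: "real \<Rightarrow> real" and a t
  have contF: "continuous_on UNIV (\<lambda>y :: real \<times> real \<times> real. F p q (fst y) (fst (snd y)))"
    if "continuous_on UNIV p" "continuous_on UNIV q" for p q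
  proof -
    have "continuous_on (UNIV \<times> cbox 0 T) (\<lambda>(y :: real \<times> real \<times> real, s). exp (- \<Lambda> * s) * (p (fst y + s) * q (fst (snd y) + s)))"
      unfolding split_beta by (rule continuous_on_mult[OF ex continuous_on_mult[OF sh[OF that(1)] sh[OF that(2)]]]) (rule sp)+
    from integral_continuous_on_param[OF this] show ?thesis unfolding F_def .
  qed
  have intF: "(\<lambda>s. exp (- \<Lambda> * s) * (p (a + s) * q (t + s))) integrable_on cbox 0 T"
    if "continuous_on UNIV p" "continuous_on UNIV q" for p q a t
    by (rule integrable_continuous[OF continuous_on_mult[OF ex continuous_on_mult[OF sh[OF that(1)] sh[OF that(2)]]]]) (rule sp)+
  have dFa: "((\<lambda>a. F b c a t) has_real_derivative F b' c a t) (at a)" for a t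
    unfolding F_def
  proof (rule leibniz_rule_field_derivative[where U=UNIV])
    show "((\<lambda>a. exp (- \<Lambda> * s) * (b (a + s) * c (t + s))) has_real_derivative exp (- \<Lambda> * s) * (b' (a + s) * c (t + s))) (at a)" for a s
      by (rule DERIV_cmult[OF DERIV_cmult_right[OF DERIV_shift[THEN iffD1, OF b(1)]]])
    show "continuous_on (UNIV \<times> cbox 0 T) (\<lambda>(a, s). exp (- \<Lambda> * s) * (b' (a + s) * c (t + s)))"
      unfolding split_beta by (rule continuous_on_mult[OF ex continuous_on_mult[OF sh[OF b(2)] sh[OF cb(2)]]]) (rule sp)+
  qed (use intF cb in auto)
  have dFt: "((\<lambda>t. F b c a t) has_real_derivative F b c' a t) (at t)" for a t
    unfolding F_def
  proof (rule leibniz_rule_field_derivative[where U=UNIV])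
    show "((\<lambda>t. exp (- \<Lambda> * s) * (b (a + s) * c (t + s))) has_real_derivative exp (- \<Lambda> * s) * (b (a + s) * c' (t + s))) (at t)" for t s
      by (rule DERIV_cmult[OF DERIV_cmult[OF DERIV_shift[THEN iffD1, OF c(1)]]])
    show "continuous_on (UNIV \<times> cbox 0 T) (\<lambda>(t, s). exp (- \<Lambda> * s) * (b (a + s) * c' (t + s)))"
      unfolding split_beta by (rule continuous_on_mult[OF ex continuous_on_mult[OF sh[OF cb(1)] sh[OF c(2)]]]) (rule sp)+
  qed (use intF cb in auto)
  have eqF: "- F b' c a t - F b c' a t + \<Lambda> * F b c a t = b a * c t" if "t \<ge> 0" for a t
  proof -
    have m1: "((\<lambda>s. - \<Lambda> * (exp (- \<Lambda> * s) * (b (a + s) * c (t + s))) + exp (- \<Lambda> * s) * (b' (a + s) * c (t + s))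
        + exp (- \<Lambda> * s) * (b (a + s) * c' (t + s))) has_integral
       exp (- \<Lambda> * T) * (b (a + T) * c (t + T)) - exp (- \<Lambda> * 0) * (b (a + 0) * c (t + 0))) {0..T}"
    proof (rule fundamental_theorem_of_calculus)
      fix s
      have "((\<lambda>s. exp (- \<Lambda> * s) * (b (a + s) * c (t + s))) has_real_derivative
         - \<Lambda> * (exp (- \<Lambda> * s) * (b (a + s) * c (t + s))) + exp (- \<Lambda> * s) * (b' (a + s) * c (t + s))
        + exp (- \<Lambda> * s) * (b (a + s) * c' (t + s))) (at s)"
      proof -
        have "((\<lambda>s. b (a + s)) has_real_derivative b' (a + s)) (at s)" "((\<lambda>s. c (t + s)) has_real_derivative c' (t + s)) (at s)"
          using b(1)[of "a + s"] c(1)[of "t + s"] DERIV_shift[of b "b' (a + s)" s a] DERIV_shift[of c "c' (t + s)" s t]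
          by (simp_all add: add.commute)
        note bc = DERIV_mult[OF this]
        have "((\<lambda>s. exp (- \<Lambda> * s)) has_real_derivative - \<Lambda> * exp (- \<Lambda> * s)) (at s)"
          by (auto intro!: derivative_eq_intros)
        from DERIV_mult[OF this bc] show ?thesis by (simp add: algebra_simps)
      qed
      then show "((\<lambda>s. exp (- \<Lambda> * s) * (b (a + s) * c (t + s))) has_vector_derivative
         - \<Lambda> * (exp (- \<Lambda> * s) * (b (a + s) * c (t + s))) + exp (- \<Lambda> * s) * (b' (a + s) * c (t + s))
        + exp (- \<Lambda> * s) * (b (a + s) * c' (t + s))) (at s within {0..T})"
        by (simp add: has_real_derivative_iff_has_vector_derivative[symmetric] has_field_derivative_at_within)
    qed (use \<open>T > 0\<close> in auto)
    have m2: "((\<lambda>s. - \<Lambda> * (exp (- \<Lambda> * s) * (b (a + s) * c (t + s))) + exp (- \<Lambda> * s) * (b' (a + s) * c (t + s))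
        + exp (- \<Lambda> * s) * (b (a + s) * c' (t + s))) has_integral - \<Lambda> * F b c a t + F b' c a t + F b c' a t) {0..T}"
    proof -
      have i: "((\<lambda>s. exp (- \<Lambda> * s) * (p (a + s) * q (t + s))) has_integral F p q a t) {0..T}"
        if "continuous_on UNIV p" "continuous_on UNIV q" for p q
        using integrable_integral[OF intF[OF that]] unfolding F_def by (simp add: cbox_interval)
      show ?thesis
        by (rule has_integral_add[OF has_integral_add[OF has_integral_mult_right[OF i[OF cb]] i[OF b(2) cb(2)]] i[OF cb(1) c(2)]])
    qed
    have "- \<Lambda> * F b c a t + F b' c a t + F b c' a t = exp (- \<Lambda> * T) * (b (a + T) * c (t + T)) - exp (- \<Lambda> * 0) * (b (a + 0) * c (t + 0))"
      by (rule has_integral_unique[OF m2 m1])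
    moreover have "c (t + T) = 0" using c(3)[of "t + T"] that by simp
    ultimately show ?thesis by simp
  qed
  have F0: "F p q a t = 0" if "\<And>s. s \<in> {0..T} \<Longrightarrow> p (a + s) * q (t + s) = 0" for p q a t
  proof -
    have "F p q a t = integral (cbox 0 T) (\<lambda>s. 0)" unfolding F_def by (rule integral_cong) (use that in auto)
    then show ?thesis by simp
  qed
  define \<kappa> where "\<kappa> x = cos (\<omega> * (x - m))" for x
  have kap: "cos (real k * (pi/12 * (x - m))) = \<kappa> x" for x by (simp add: \<kappa>_def \<omega>_def mult.assoc)
  have per: "\<kappa> (x + 24) = \<kappa> x" for x
  proof -
    have "\<omega> * (x + 24 - m) = \<omega> * (x - m) + 2 * pi * real k" by (simp add: \<omega>_def field_simps)
    moreover have "cos (2 * pi * real k) = 1" "sin (2 * pi * real k) = 0"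
      using cos_2npi[of k] sin_2npi[of k] by (simp_all add: ac_simps)
    ultimately show ?thesis unfolding \<kappa>_def by (simp add: cos_add)
  qed
  have dk: "(\<kappa> has_real_derivative - (\<omega> * sin (\<omega> * (x - m)))) (at x)"
    "((\<lambda>x. - (\<omega> * sin (\<omega> * (x - m)))) has_real_derivative - (\<omega>\<^sup>2 * \<kappa> x)) (at x)" for x
    unfolding \<kappa>_def[abs_def] by (auto intro!: derivative_eq_intros simp: power2_eq_square)
  have ck: "continuous_on UNIV (\<lambda>y :: real \<times> real \<times> real. \<kappa> (snd (snd y)))" unfolding \<kappa>_def by (intro continuous_intros)
  define p where "p = (\<lambda>y :: real \<times> real \<times> real. F b c (fst y) (fst (snd y)) * \<kappa> (snd (snd y)))"
  define pa where "pa = (\<lambda>y :: real \<times> real \<times> real. F b' c (fst y) (fst (snd y)) * \<kappa> (snd (snd y)))"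
  define pt where "pt = (\<lambda>y :: real \<times> real \<times> real. F b c' (fst y) (fst (snd y)) * \<kappa> (snd (snd y)))"
  define px where "px = (\<lambda>y :: real \<times> real \<times> real. F b c (fst y) (fst (snd y)) * - (\<omega> * sin (\<omega> * (snd (snd y) - m))))"
  define pxx where "pxx = (\<lambda>y :: real \<times> real \<times> real. F b c (fst y) (fst (snd y)) * - (\<omega>\<^sup>2 * \<kappa> (snd (snd y))))"
  have ev: "p (a, t, x) = F b c a t * \<kappa> x" "pa (a, t, x) = F b' c a t * \<kappa> x" "pt (a, t, x) = F b c' a t * \<kappa> x"
    "px (a, t, x) = F b c a t * - (\<omega> * sin (\<omega> * (x - m)))" "pxx (a, t, x) = F b c a t * - (\<omega>\<^sup>2 * \<kappa> x)" for a t x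
    by (simp_all add: p_def pa_def pt_def px_def pxx_def)
  have bA: "a \<ge> A \<Longrightarrow> F b c a t = 0 \<and> F b' c a t = 0 \<and> F b c' a t = 0" for a t
    using b(3) by (intro conjI F0) auto
  have cont: "continuous_on UNIV p" "continuous_on UNIV pa" "continuous_on UNIV pt" "continuous_on UNIV pxx"
    unfolding p_def pa_def pt_def pxx_def by (intro continuous_intros contF cb b c ck)+
  have xd: "\<exists>\<phi>x. (\<forall>a t x. ((\<lambda>z. p (a, t, z)) has_real_derivative \<phi>x (a, t, x)) (at x)) \<and>
           (\<forall>a t x. ((\<lambda>z. \<phi>x (a, t, z)) has_real_derivative pxx (a, t, x)) (at x))"
    unfolding ev by (rule exI[of _ px], unfold ev, intro conjI allI DERIV_cmult dk)
  have van: "\<exists>\<epsilon>>0. \<forall>a t x. ad - \<epsilon> \<le> a \<longrightarrow> p (a, t, x) = 0"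
    unfolding ev using \<open>A < ad\<close> bA by (intro exI[of _ "ad - A"]) auto
  have pT: "p (a, T, x) = 0" for a x unfolding ev using c(3) F0[of b a c T] by simp
  have da: "((\<lambda>s. p (s, t, x)) has_real_derivative pa (a, t, x)) (at a)" for a t x
    unfolding ev by (rule DERIV_cmult_right[OF dFa])
  have dt: "((\<lambda>s. p (a, s, x)) has_real_derivative pt (a, t, x)) (at t)" for a t x
    unfolding ev by (rule DERIV_cmult_right[OF dFt])
  have "test_fun ad T p pa pt pxx" unfolding test_fun_def
    by (intro conjI allI cont xd van pT da dt) (simp add: ev per)
  then have ct: "ctest A ad T p pa pt pxx" unfolding ctest_def using bA by (simp add: ev)
  have eq: "- pa (a, t, x) - pt (a, t, x) - \<delta> * pxx (a, t, x) + lam * p (a, t, x)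
      = b a * c t * cos (real k * (pi/12 * (x - m)))" if "t \<ge> 0" for a t x
  proof -
    have "- pa (a, t, x) - pt (a, t, x) - \<delta> * pxx (a, t, x) + lam * p (a, t, x)
      = (- F b' c a t - F b c' a t + \<Lambda> * F b c a t) * \<kappa> x" unfolding ev by (simp add: \<Lambda>_def algebra_simps)
    then show ?thesis unfolding eqF[OF that] kap .
  qed
  show ?thesis
    by (rule exI[of _ p], rule exI[of _ pa], rule exI[of _ pt], rule exI[of _ pxx]) (intro conjI ct allI impI, erule eq)
qed

abbreviation leb :: "'a::euclidean_space set \<Rightarrow> 'a measure" where "leb S \<equiv> restrict_space lborel S"

lemma integral_leb_eq:
  fixes f :: "'a::euclidean_space \<Rightarrow> real"
  shows "S \<in> sets borel \<Longrightarrow> integral\<^sup>L (leb S) f = (LINT y:S|lborel. f y)"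
  by (simp add: integral_restrict_space set_lebesgue_integral_def)

lemma integrable_leb_iff:
  fixes f :: "'a::euclidean_space \<Rightarrow> real"
  shows "S \<in> sets borel \<Longrightarrow> integrable (leb S) f \<longleftrightarrow> set_integrable lborel S f"
  by (simp add: integrable_restrict_space set_integrable_def)

lemma AE_leb_iff: "S \<in> sets borel \<Longrightarrow> (AE y in leb S. P y) \<longleftrightarrow> (AE y in lborel. y \<in> S \<longrightarrow> P y)"
  by (simp add: AE_restrict_space_iff)

lemma finite_measure_leb:
  assumes "bounded S" "S \<in> sets borel" shows "finite_measure (leb S)"
proof
  have "emeasure lborel S < \<infinity>" using assms(1) by (rule emeasure_bounded_finite)
  then show "emeasure (leb S) (space (leb S)) \<noteq> \<infinity>"
    using assms by (simp add: emeasure_restrict_space space_restrict_space)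
qed

lemma measurable_leb[measurable (raw)]: "f \<in> borel_measurable borel \<Longrightarrow> f \<in> borel_measurable (leb S)"
  by (rule measurable_restrict_space1) simp

lemma sqint_leb_continuous:
  fixes f :: "'a::euclidean_space \<Rightarrow> real"
  assumes "continuous_on UNIV f" "bounded S" "S \<in> sets borel"
  shows "sqint (leb S) f" "integrable (leb S) f"
proof -
  interpret finite_measure "leb S" by (rule finite_measure_leb[OF assms(2,3)])
  have "compact (f ` closure S)"
    using assms by (intro compact_continuous_image) (auto intro: continuous_on_subset simp: compact_closure)
  then obtain B where B: "\<And>y. y \<in> closure S \<Longrightarrow> \<bar>f y\<bar> \<le> B"
    using compact_imp_bounded[of "f ` closure S"] unfolding bounded_iff by force
  have [measurable]: "f \<in> borel_measurable borel" using assms(1) by (rule borel_measurable_continuous_onI)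
  have b: "\<bar>f y\<bar> \<le> B" if "y \<in> space (leb S)" for y
    using B[of y] closure_subset[of S] that by (auto simp: space_restrict_space)
  show "sqint (leb S) f"
  proof (rule sqintI[where g="\<lambda>_. B\<^sup>2"])
    show "AE y in leb S. (norm (f y))\<^sup>2 \<le> B\<^sup>2"
      using power_mono[OF b abs_ge_zero, of _ 2] by (intro AE_I2) simp
  qed auto
  then show "integrable (leb S) f" by (intro sqint_integrable finite_measure_leb assms)
qed

lemma integral_leb_box:
  fixes f :: "'a::euclidean_space \<Rightarrow> real"
  assumes "continuous_on UNIV f"
  shows "integral\<^sup>L (leb (box l u)) f = integral (cbox l u) f"
proof -
  have "integrable (leb (box l u)) f" by (rule sqint_leb_continuous[OF assms]) auto
  then have "set_integrable lborel (box l u) f" by (simp add: integrable_leb_iff)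
  from set_borel_integral_eq_integral(2)[OF this] show ?thesis
    by (simp add: integral_leb_eq integral_open_interval)
qed

lemma QQ_box: "QQ A T = box (0, 0, 0) (A, T, 24)"
  by (auto simp: QQ_def mem_box Basis_prod_def)

lemma rect_box: "{0<..<a} \<times> {0<..<b} = box (0::real, 0::real) (a, b)"
  by (auto simp: mem_box Basis_prod_def)

lemma periodic_negpart_second_deriv:
  fixes \<psi> \<psi>' \<psi>'' :: "real \<Rightarrow> real"
  assumes d1: "\<And>x. (\<psi> has_real_derivative \<psi>' x) (at x)" and d2: "\<And>x. (\<psi>' has_real_derivative \<psi>'' x) (at x)"
    and c2: "continuous_on UNIV \<psi>''" and per: "\<And>x. \<psi> (x + L) = \<psi> x" and "L \<ge> 0"
  shows "0 \<le> integral {0..L} (\<lambda>x. max 0 (- \<psi> x) * \<psi>'' x)"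
proof -
  have c0: "continuous_on UNIV \<psi>" "continuous_on UNIV \<psi>'"
    by (rule DERIV_continuous_on, rule has_field_derivative_at_within, rule d1,
        rule DERIV_continuous_on, rule has_field_derivative_at_within, rule d2)
  define N where "N x = max 0 (- \<psi> x)" for x
  have cN: "continuous_on UNIV N" unfolding N_def by (intro continuous_intros c0)
  have dN: "((\<lambda>x. (N x)\<^sup>2) has_real_derivative - (2 * N x * \<psi>' x)) (at x)" for x
    using DERIV_chain2[OF DERIV_pos_part_sq DERIV_minus[OF d1[of x]]] unfolding N_def by simp
  have per': "\<psi>' L = \<psi>' 0"
  proof -
    have "((\<lambda>x. \<psi> (x + L)) has_real_derivative \<psi>' (0 + L)) (at 0)"
      using d1[of "0 + L"] by (rule DERIV_shift[THEN iffD1])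
    then have "(\<psi> has_real_derivative \<psi>' L) (at 0)" unfolding per by simp
    then show ?thesis using d1[of 0] DERIV_unique by blast
  qed
  define C where "C = integral {0..L} (\<lambda>x. \<bar>\<psi>'' x\<bar>)"
  have C0: "C \<ge> 0" unfolding C_def by (intro integral_nonneg integrable_continuous_interval continuous_intros continuous_on_subset[OF c2]) auto
  have ge: "- (e * C) \<le> integral {0..L} (\<lambda>x. N x * \<psi>'' x)" if "e > 0" for e
  proof -
    define h where "h x = sqrt (e\<^sup>2 + (N x)\<^sup>2) - e" for x
    have pos: "e\<^sup>2 + (N x)\<^sup>2 > 0" for x using \<open>e > 0\<close> by (simp add: add_pos_nonneg)
    define h' where "h' x = - (N x * \<psi>' x / sqrt (e\<^sup>2 + (N x)\<^sup>2))" for x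
    have dh: "(h has_real_derivative h' x) (at x)" for x
    proof -
      have "((\<lambda>x. e\<^sup>2 + (N x)\<^sup>2) has_real_derivative 0 + - (2 * N x * \<psi>' x)) (at x)"
        by (intro DERIV_add DERIV_const dN)
      then have "((\<lambda>x. sqrt (e\<^sup>2 + (N x)\<^sup>2)) has_real_derivative inverse (sqrt (e\<^sup>2 + (N x)\<^sup>2)) / 2 * (0 + - (2 * N x * \<psi>' x))) (at x)"
        by (rule DERIV_chain2[of sqrt _ "\<lambda>x. e\<^sup>2 + (N x)\<^sup>2", OF DERIV_real_sqrt[OF pos[of x]]])
      then have "((\<lambda>x. sqrt (e\<^sup>2 + (N x)\<^sup>2) - e) has_real_derivative inverse (sqrt (e\<^sup>2 + (N x)\<^sup>2)) / 2 * (0 + - (2 * N x * \<psi>' x)) - 0) (at x)"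
        by (intro DERIV_diff DERIV_const)
      then show ?thesis unfolding h_def[abs_def] h'_def by (simp add: field_simps)
    qed
    have ch: "continuous_on UNIV h"
      unfolding h_def by (intro continuous_on_diff continuous_on_real_sqrt continuous_on_add continuous_on_power cN continuous_on_const)
    have "sqrt (e\<^sup>2 + (N x)\<^sup>2) \<noteq> 0" for x using pos[of x] real_sqrt_gt_zero[of "e\<^sup>2 + (N x)\<^sup>2"] by linarith
    then have ch': "continuous_on UNIV h'"
      unfolding h'_def by (intro continuous_on_minus continuous_on_divide continuous_on_mult continuous_on_real_sqrt
         continuous_on_add continuous_on_power cN c0 continuous_on_const) simp
    note ch = ch ch'
    have "((\<lambda>x. h' x * \<psi>' x + \<psi>'' x * h x) has_integral h L * \<psi>' L - h 0 * \<psi>' 0) {0..L}"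
    proof (rule fundamental_theorem_of_calculus)
      show "((\<lambda>x. h x * \<psi>' x) has_vector_derivative h' x * \<psi>' x + \<psi>'' x * h x) (at x within {0..L})" for x
        using DERIV_mult[OF dh[of x] d2[of x]]
        by (simp add: has_real_derivative_iff_has_vector_derivative[symmetric] has_field_derivative_at_within)
    qed fact
    moreover have "h L = h 0" using per[of 0] by (simp add: h_def N_def)
    ultimately have z: "integral {0..L} (\<lambda>x. h' x * \<psi>' x + \<psi>'' x * h x) = 0" using per' by (simp add: integral_unique)
    have ii: "(\<lambda>x. f x) integrable_on {0..L}" if "continuous_on UNIV f" for f :: "real \<Rightarrow> real"
      by (rule integrable_continuous_interval[OF continuous_on_subset[OF that]]) simp
    have "integral {0..L} (\<lambda>x. h' x * \<psi>' x) + integral {0..L} (\<lambda>x. \<psi>'' x * h x) = 0"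
      using z by (subst integral_add[symmetric]) (auto intro!: ii continuous_intros ch c0 c2)
    moreover have "integral {0..L} (\<lambda>x. h' x * \<psi>' x) \<le> integral {0..L} (\<lambda>x. 0)"
    proof (rule integral_le)
      fix x
      have "0 \<le> N x * (\<psi>' x)\<^sup>2 / sqrt (e\<^sup>2 + (N x)\<^sup>2)" by (simp add: N_def)
      then show "h' x * \<psi>' x \<le> 0" by (simp add: h'_def power2_eq_square)
    qed (auto intro!: ii continuous_intros ch c0)
    ultimately have "0 \<le> integral {0..L} (\<lambda>x. \<psi>'' x * h x)" by simp
    also have "\<dots> \<le> integral {0..L} (\<lambda>x. N x * \<psi>'' x + e * \<bar>\<psi>'' x\<bar>)"
    proof (rule integral_le)
      fix x
      have N0: "N x \<ge> 0" by (simp add: N_def)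
      have "\<bar>h x - N x\<bar> \<le> e"
      proof -
        have "N x \<le> sqrt (e\<^sup>2 + (N x)\<^sup>2)" using N0 by (intro real_le_rsqrt) auto
        moreover have "sqrt (e\<^sup>2 + (N x)\<^sup>2) \<le> e + N x" using sqrt_sum_squares_le_sum[of e "N x"] N0 \<open>e > 0\<close> by simp
        ultimately show ?thesis by (simp add: h_def)
      qed
      then have "\<bar>h x - N x\<bar> * \<bar>\<psi>'' x\<bar> \<le> e * \<bar>\<psi>'' x\<bar>" by (rule mult_right_mono) simp
      then have "\<psi>'' x * (h x - N x) \<le> e * \<bar>\<psi>'' x\<bar>" using abs_le_iff[of "\<psi>'' x * (h x - N x)"] by (simp add: abs_mult mult.commute)
      then show "\<psi>'' x * h x \<le> N x * \<psi>'' x + e * \<bar>\<psi>'' x\<bar>" by (simp add: algebra_simps)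
    qed (auto intro!: ii continuous_intros ch c0 c2 cN)
    also have "\<dots> = integral {0..L} (\<lambda>x. N x * \<psi>'' x) + e * C"
      unfolding C_def by (subst integral_add) (auto intro!: ii continuous_intros c2 cN)
    finally show ?thesis by simp
  qed
  have "0 \<le> integral {0..L} (\<lambda>x. N x * \<psi>'' x)"
  proof (rule field_le_epsilon)
    fix e :: real assume "e > 0"
    have "e / (C + 1) * C \<le> e" using C0 \<open>e > 0\<close> by (simp add: field_simps)
    then show "0 \<le> integral {0..L} (\<lambda>x. N x * \<psi>'' x) + e" using ge[of "e / (C + 1)"] C0 \<open>e > 0\<close> by simp
  qed
  then show ?thesis by (simp add: N_def)
qed

lemma integral_nonneg_total:
  fixes f :: "'a::euclidean_space \<Rightarrow> real"
  assumes "\<And>x. x \<in> S \<Longrightarrow> 0 \<le> f x" shows "0 \<le> integral S f"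
  by (cases "f integrable_on S") (simp_all add: integral_nonneg assms not_integrable_integral)

lemma test_fun_negpart_energy:
  assumes test: "test_fun ad T \<phi> \<phi>a \<phi>t \<phi>xx" and vanish: "\<And>t x. \<phi> (A, t, x) = 0"
    and pos: "A > 0" "T > 0" "\<delta> \<ge> 0"
  defines "N \<equiv> \<lambda>y. max 0 (- \<phi> y)"
  shows "(\<integral>z. (N (0, z))\<^sup>2 \<partial>leb ({0<..<T} \<times> {0<..<24})) + (\<integral>z. (N (fst z, 0, snd z))\<^sup>2 \<partial>leb ({0<..<A} \<times> {0<..<24}))
       + 2 * lam * (\<integral>y. (N y)\<^sup>2 \<partial>leb (QQ A T))
     \<le> 2 * (\<integral>y. N y * (\<phi>a y + \<phi>t y + \<delta> * \<phi>xx y - lam * \<phi> y) \<partial>leb (QQ A T))"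
proof -
  note d = test_funD[OF test]
  obtain \<phi>x where px: "\<forall>a t x. ((\<lambda>z. \<phi> (a, t, z)) has_real_derivative \<phi>x (a, t, x)) (at x)"
     "\<forall>a t x. ((\<lambda>z. \<phi>x (a, t, z)) has_real_derivative \<phi>xx (a, t, x)) (at x)"
    using test_fun_x_deriv[OF test] by (elim exE conjE) (rule that)
  have cN: "continuous_on UNIV N" unfolding N_def by (intro continuous_intros d)
  let ?D = "cbox (0, 0, 0) (A, T, 24) :: (real \<times> real \<times> real) set"
  have comp: "continuous_on S (\<lambda>z. f (g z))" if "continuous_on UNIV f" "continuous_on S g" for f :: "real \<times> real \<times> real \<Rightarrow> real" and g :: "'b::topological_space \<Rightarrow> _" and S
    by (rule continuous_on_compose2[OF that]) simp
  have dNa: "((\<lambda>a. (N (a, z))\<^sup>2) has_real_derivative - (2 * N (a, z) * \<phi>a (a, z))) (at a)" for a z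
    using DERIV_chain2[OF DERIV_pos_part_sq DERIV_minus[OF d(5)[of "fst z" "snd z" a]]] unfolding N_def by simp
  have dNt: "((\<lambda>t. (N (a, t, x))\<^sup>2) has_real_derivative - (2 * N (a, t, x) * \<phi>t (a, t, x))) (at t)" for a t x
    using DERIV_chain2[OF DERIV_pos_part_sq DERIV_minus[OF d(6)[of a x t]]] unfolding N_def by simp
  have ftc: "integral (cbox 0 r) f = F r - F 0" if "\<And>s. (F has_real_derivative f s) (at s)" "r \<ge> 0" for F f :: "real \<Rightarrow> real" and r
  proof -
    have "(f has_integral F r - F 0) {0..r}"
      by (rule fundamental_theorem_of_calculus[OF that(2)])
         (simp add: has_real_derivative_iff_has_vector_derivative[symmetric] has_field_derivative_at_within that(1))
    then show ?thesis by (simp add: cbox_interval integral_unique)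
  qed
  have Na: "integral ?D (\<lambda>y. - (2 * N y * \<phi>a y)) = - integral (cbox (0, 0) (T, 24)) (\<lambda>z. (N (0, z))\<^sup>2)"
  proof -
    have c: "continuous_on UNIV (\<lambda>y. - (2 * N y * \<phi>a y))" by (intro continuous_intros cN d)
    have "integral ?D (\<lambda>y. - (2 * N y * \<phi>a y)) = integral (cbox 0 A) (\<lambda>a. integral (cbox (0,0) (T,24)) (\<lambda>z. - (2 * N (a, z) * \<phi>a (a, z))))"
      using integral_prod_continuous[of 0 "(0,0)" A "(T,24)" "\<lambda>y. - (2 * N y * \<phi>a y)"] continuous_on_subset[OF c] by simp
    also have "\<dots> = integral (cbox (0,0) (T,24)) (\<lambda>z. integral (cbox 0 A) (\<lambda>a. - (2 * N (a, z) * \<phi>a (a, z))))"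
      by (rule integral_swap_continuous) (unfold split_beta, rule comp[OF c], intro continuous_intros)
    also have "\<dots> = integral (cbox (0,0) (T,24)) (\<lambda>z. - (N (0, z))\<^sup>2)"
    proof (rule integral_cong)
      fix z :: "real \<times> real"
      have "N (A, z) = 0" using vanish[of "fst z" "snd z"] by (simp add: N_def)
      then show "integral (cbox 0 A) (\<lambda>a. - (2 * N (a, z) * \<phi>a (a, z))) = - (N (0, z))\<^sup>2"
        using ftc[OF dNa[of z], of A] pos by simp
    qed
    finally show ?thesis by simp
  qed
  have Nt: "integral ?D (\<lambda>y. - (2 * N y * \<phi>t y)) = - integral (cbox (0, 0) (A, 24)) (\<lambda>z. (N (fst z, 0, snd z))\<^sup>2)"
  proof -
    have c: "continuous_on UNIV (\<lambda>y. - (2 * N y * \<phi>t y))" by (intro continuous_intros cN d)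
    have "integral ?D (\<lambda>y. - (2 * N y * \<phi>t y)) = integral (cbox 0 A) (\<lambda>a. integral (cbox (0,0) (T,24)) (\<lambda>z. - (2 * N (a, z) * \<phi>t (a, z))))"
      using integral_prod_continuous[of 0 "(0,0)" A "(T,24)" "\<lambda>y. - (2 * N y * \<phi>t y)"] continuous_on_subset[OF c] by simp
    also have "\<dots> = integral (cbox 0 A) (\<lambda>a. integral (cbox 0 24) (\<lambda>x. - (N (a, 0, x))\<^sup>2))"
    proof (rule integral_cong)
      fix a
      have ca: "continuous_on UNIV (\<lambda>z. - (2 * N (a, z) * \<phi>t (a, z)))" by (rule comp[OF c]) (intro continuous_intros)
      have "integral (cbox (0,0) (T,24)) (\<lambda>z. - (2 * N (a, z) * \<phi>t (a, z))) = integral (cbox 0 T) (\<lambda>t. integral (cbox 0 24) (\<lambda>x. - (2 * N (a, t, x) * \<phi>t (a, t, x))))"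
        using integral_prod_continuous[of 0 0 T 24 "\<lambda>z. - (2 * N (a, z) * \<phi>t (a, z))"] continuous_on_subset[OF ca] by simp
      also have "\<dots> = integral (cbox 0 24) (\<lambda>x. integral (cbox 0 T) (\<lambda>t. - (2 * N (a, t, x) * \<phi>t (a, t, x))))"
        by (rule integral_swap_continuous) (unfold split_beta, rule comp[OF c], intro continuous_intros)
      also have "\<dots> = integral (cbox 0 24) (\<lambda>x. - (N (a, 0, x))\<^sup>2)"
      proof (rule integral_cong)
        fix x
        have "N (a, T, x) = 0" using d(8)[of a x] by (simp add: N_def)
        then show "integral (cbox 0 T) (\<lambda>t. - (2 * N (a, t, x) * \<phi>t (a, t, x))) = - (N (a, 0, x))\<^sup>2"
          using ftc[OF dNt[of a x], of T] pos by simp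
      qed
      finally show "integral (cbox (0,0) (T,24)) (\<lambda>z. - (2 * N (a, z) * \<phi>t (a, z))) = integral (cbox 0 24) (\<lambda>x. - (N (a, 0, x))\<^sup>2)" .
    qed
    also have "\<dots> = integral (cbox (0, 0) (A, 24)) (\<lambda>z. - (N (fst z, 0, snd z))\<^sup>2)"
    proof -
      have "continuous_on UNIV (\<lambda>z. - (N (fst z, 0, snd z))\<^sup>2)" by (intro continuous_intros comp[OF cN])
      then show ?thesis
        using integral_prod_continuous[of 0 0 A 24 "\<lambda>z. - (N (fst z, 0, snd z))\<^sup>2", OF continuous_on_subset] by simp
    qed
    finally show ?thesis by simp
  qed
  have Nx: "0 \<le> integral ?D (\<lambda>y. N y * \<phi>xx y)"
  proof -
    have c: "continuous_on UNIV (\<lambda>y. N y * \<phi>xx y)" by (intro continuous_intros cN d)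
    have "0 \<le> integral (cbox (0,0) (T,24)) (\<lambda>z. N (a, z) * \<phi>xx (a, z))" for a
    proof -
      have ca: "continuous_on UNIV (\<lambda>z. N (a, z) * \<phi>xx (a, z))" by (rule comp[OF c]) (intro continuous_intros)
      have eq: "integral (cbox (0,0) (T,24)) (\<lambda>z. N (a, z) * \<phi>xx (a, z)) = integral (cbox 0 T) (\<lambda>t. integral (cbox 0 24) (\<lambda>x. N (a, t, x) * \<phi>xx (a, t, x)))"
        using integral_prod_continuous[of 0 0 T 24 "\<lambda>z. N (a, z) * \<phi>xx (a, z)"] continuous_on_subset[OF ca] by simp
      have "0 \<le> integral (cbox 0 24) (\<lambda>x. N (a, t, x) * \<phi>xx (a, t, x))" for t
        using periodic_negpart_second_deriv[of "\<lambda>x. \<phi> (a, t, x)" "\<lambda>x. \<phi>x (a, t, x)" "\<lambda>x. \<phi>xx (a, t, x)" 24]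
          px d(7) comp[OF d(4), of UNIV "\<lambda>x. (a, t, x)"]
        by (simp add: N_def cbox_interval continuous_on_Pair)
      then show ?thesis unfolding eq by (rule integral_nonneg_total)
    qed
    then have "0 \<le> integral (cbox 0 A) (\<lambda>a. integral (cbox (0,0) (T,24)) (\<lambda>z. N (a, z) * \<phi>xx (a, z)))"
      by (rule integral_nonneg_total)
    also have "\<dots> = integral ?D (\<lambda>y. N y * \<phi>xx y)"
      using integral_prod_continuous[of 0 "(0,0)" A "(T,24)" "\<lambda>y. N y * \<phi>xx y"] continuous_on_subset[OF c] by simp
    finally show ?thesis .
  qed
  have pw: "2 * (N y * (\<phi>a y + \<phi>t y + \<delta> * \<phi>xx y - lam * \<phi> y))
     = - (- (2 * N y * \<phi>a y)) - (- (2 * N y * \<phi>t y)) + 2 * \<delta> * (N y * \<phi>xx y) + 2 * lam * (N y)\<^sup>2" for y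
    by (auto simp: N_def max_def power2_eq_square algebra_simps)
  have io: "f integrable_on ?D" if "continuous_on UNIV f" for f :: "real \<times> real \<times> real \<Rightarrow> real"
    by (rule integrable_continuous[OF continuous_on_subset[OF that]]) simp
  have "2 * integral ?D (\<lambda>y. N y * (\<phi>a y + \<phi>t y + \<delta> * \<phi>xx y - lam * \<phi> y))
     = integral ?D (\<lambda>y. - (- (2 * N y * \<phi>a y)) - (- (2 * N y * \<phi>t y)) + 2 * \<delta> * (N y * \<phi>xx y) + 2 * lam * (N y)\<^sup>2)"
    unfolding pw[symmetric] by simp
  also have "\<dots> = - integral ?D (\<lambda>y. - (2 * N y * \<phi>a y)) - integral ?D (\<lambda>y. - (2 * N y * \<phi>t y))
     + 2 * \<delta> * integral ?D (\<lambda>y. N y * \<phi>xx y) + 2 * lam * integral ?D (\<lambda>y. (N y)\<^sup>2)"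
  proof -
    have "(\<lambda>y. - (2 * N y * \<phi>a y)) integrable_on ?D" "(\<lambda>y. - (2 * N y * \<phi>t y)) integrable_on ?D"
       "(\<lambda>y. N y * \<phi>xx y) integrable_on ?D" "(\<lambda>y. (N y)\<^sup>2) integrable_on ?D"
      by (intro io continuous_intros cN d)+
    note h = this[THEN integrable_integral]
    show ?thesis
      by (rule integral_unique[OF has_integral_add[OF has_integral_add[OF has_integral_diff[OF has_integral_neg[OF h(1)] h(2)]
         has_integral_mult_right[OF h(3)]] has_integral_mult_right[OF h(4)]]])
  qed
  finally have main: "2 * integral ?D (\<lambda>y. N y * (\<phi>a y + \<phi>t y + \<delta> * \<phi>xx y - lam * \<phi> y))
     = integral (cbox (0, 0) (T, 24)) (\<lambda>z. (N (0, z))\<^sup>2) + integral (cbox (0, 0) (A, 24)) (\<lambda>z. (N (fst z, 0, snd z))\<^sup>2)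
     + 2 * \<delta> * integral ?D (\<lambda>y. N y * \<phi>xx y) + 2 * lam * integral ?D (\<lambda>y. (N y)\<^sup>2)"
    unfolding Na Nt by simp
  have "2 * \<delta> * integral ?D (\<lambda>y. N y * \<phi>xx y) \<ge> 0" using Nx pos by simp
  moreover have "(\<integral>z. (N (0, z))\<^sup>2 \<partial>leb ({0<..<T} \<times> {0<..<24})) = integral (cbox (0, 0) (T, 24)) (\<lambda>z. (N (0, z))\<^sup>2)"
    unfolding rect_box by (rule integral_leb_box) (intro continuous_intros comp[OF cN])
  moreover have "(\<integral>z. (N (fst z, 0, snd z))\<^sup>2 \<partial>leb ({0<..<A} \<times> {0<..<24})) = integral (cbox (0, 0) (A, 24)) (\<lambda>z. (N (fst z, 0, snd z))\<^sup>2)"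
    unfolding rect_box by (rule integral_leb_box) (intro continuous_intros comp[OF cN])
  moreover have "(\<integral>y. (N y)\<^sup>2 \<partial>leb (QQ A T)) = integral ?D (\<lambda>y. (N y)\<^sup>2)"
    unfolding QQ_box by (rule integral_leb_box) (intro continuous_intros cN)
  moreover have "(\<integral>y. N y * (\<phi>a y + \<phi>t y + \<delta> * \<phi>xx y - lam * \<phi> y) \<partial>leb (QQ A T)) = integral ?D (\<lambda>y. N y * (\<phi>a y + \<phi>t y + \<delta> * \<phi>xx y - lam * \<phi> y))"
    unfolding QQ_box by (rule integral_leb_box) (intro continuous_intros cN d)
  ultimately show ?thesis using main by simp
qed

section \<open>The dual operator\<close>

definition kern :: "real \<Rightarrow> real \<Rightarrow> real \<Rightarrow> real" where
  "kern \<eta> x s = indicator {x - \<eta><..<x + \<eta>} s * KK x s"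

text \<open>The adjoint of the renewal condition: a test function at age \<open>0\<close> is integrated against the kernel over the birth position \<open>x\<close>.\<close>

definition KT :: "real \<Rightarrow> (real \<times> real \<times> real \<Rightarrow> real) \<Rightarrow> real \<times> real \<times> real \<Rightarrow> real" where
  "KT \<eta> \<phi> y = (\<integral>x. kern \<eta> x (snd (snd y)) * \<phi> (0, fst (snd y), x) \<partial>leb {0<..<24})"

lemma kern_bounds: "0 \<le> kern \<eta> x s" "kern \<eta> x s \<le> 1"
proof -
  have "z * exp (- z) \<le> 1" if "z \<ge> 0" for z :: real
  proof -
    have "z \<le> exp z" using exp_ge_add_one_self[of z] by linarith
    then show ?thesis by (simp add: exp_minus field_simps)
  qed
  from this[of "(x - s)\<^sup>2"] have "0 \<le> KK x s \<and> KK x s \<le> 1" by (simp add: KK_def)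
  then show "0 \<le> kern \<eta> x s" "kern \<eta> x s \<le> 1" by (auto simp: kern_def indicator_def)
qed

lemma kern_measurable[measurable]: "(\<lambda>z. kern \<eta> (fst z) (snd z)) \<in> borel_measurable borel"
proof -
  have "(\<lambda>z::real \<times> real. kern \<eta> (fst z) (snd z)) = (\<lambda>z. if fst z - \<eta> < snd z \<and> snd z < fst z + \<eta> \<and> 0 < snd z \<and> snd z < 24
     then (fst z - snd z)\<^sup>2 * exp (- ((fst z - snd z)\<^sup>2)) else 0)"
    by (auto simp: kern_def KK_def indicator_def)
  then show ?thesis by simp
qed

lemma borel_measurable_kern[measurable (raw)]:
  assumes "f \<in> borel_measurable M" "g \<in> borel_measurable M"
  shows "(\<lambda>z. kern \<eta> (f z) (g z)) \<in> borel_measurable M"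
  using measurable_compose[OF borel_measurable_Pair[OF assms] kern_measurable] by simp

interpretation leb24: finite_measure "leb {0<..<24::real}"
  by (rule finite_measure_leb) auto

lemma measure_leb24: "measure (leb {0<..<24::real}) (space (leb {0<..<24::real})) = 24"
  by (simp add: measure_restrict_space space_restrict_space)

lemma KT_measurable[measurable]:
  assumes "\<phi> \<in> borel_measurable borel" shows "KT \<eta> \<phi> \<in> borel_measurable borel"
proof -
  note [measurable] = assms
  have s: "sets (borel \<Otimes>\<^sub>M leb {0<..<24}) = sets ((borel :: (real \<times> real \<times> real) measure) \<Otimes>\<^sub>M restrict_space borel {0<..<24::real})"
    by (rule sets_pair_measure_cong) (auto simp: sets_restrict_space)
  have [measurable]: "(\<lambda>z. snd z) \<in> borel_measurable (borel \<Otimes>\<^sub>M leb {0<..<24::real})"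
    by (rule measurable_compose[OF measurable_snd]) (rule measurable_leb, simp)
  have "(\<lambda>z :: (real \<times> real \<times> real) \<times> real. kern \<eta> (snd z) (snd (snd (fst z))) * \<phi> (0, fst (snd (fst z)), snd z))
     \<in> borel_measurable (borel \<Otimes>\<^sub>M leb {0<..<24})"
    by measurable
  then show ?thesis unfolding KT_def[abs_def]
    by (intro leb24.borel_measurable_lebesgue_integral) (simp add: split_beta)
qed

lemma KT_integrable:
  assumes "continuous_on UNIV \<phi>"
  shows "integrable (leb {0<..<24}) (\<lambda>x. kern \<eta> x s * \<phi> (0, t, x))" "sqint (leb {0<..<24}) (\<lambda>x. \<phi> (0, t, x))"
proof -
  have "continuous_on UNIV (\<lambda>x. \<phi> (0, t, x))"
    by (rule continuous_on_compose2[OF assms]) (auto intro!: continuous_intros)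
  then show *: "sqint (leb {0<..<24}) (\<lambda>x. \<phi> (0, t, x))" by (rule sqint_leb_continuous) auto
  have "sqint (leb {0<..<24}) (\<lambda>x. kern \<eta> x s * \<phi> (0, t, x))"
    by (rule sqint_bounded_mult[OF *, where C=1]) (use kern_bounds in \<open>auto simp: abs_le_iff intro!: AE_I2 order_trans[OF _ kern_bounds(1)]\<close>)
  then show "integrable (leb {0<..<24}) (\<lambda>x. kern \<eta> x s * \<phi> (0, t, x))"
    by (rule sqint_integrable[OF leb24.finite_measure_axioms])
qed

lemma KT_mono:
  assumes "continuous_on UNIV \<phi>" "continuous_on UNIV \<psi>" "\<And>y. \<phi> y \<le> \<psi> y"
  shows "KT \<eta> \<phi> y \<le> KT \<eta> \<psi> y"
  unfolding KT_def using assms(3) kern_bounds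
  by (intro integral_mono KT_integrable assms(1,2)) (auto intro: mult_left_mono)

lemma KT_lincomb:
  assumes "continuous_on UNIV \<phi>" "continuous_on UNIV \<psi>"
  shows "KT \<eta> (\<lambda>y. \<phi> y + c * \<psi> y) y = KT \<eta> \<phi> y + c * KT \<eta> \<psi> y"
proof -
  have "KT \<eta> (\<lambda>y. \<phi> y + c * \<psi> y) y = (\<integral>x. kern \<eta> x (snd (snd y)) * \<phi> (0, fst (snd y), x)
      + c * (kern \<eta> x (snd (snd y)) * \<psi> (0, fst (snd y), x)) \<partial>leb {0<..<24})"
    unfolding KT_def by (simp add: algebra_simps)
  also have "\<dots> = KT \<eta> \<phi> y + c * KT \<eta> \<psi> y"
    unfolding KT_def using KT_integrable[OF assms(1)] KT_integrable[OF assms(2)] by simp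
  finally show ?thesis .
qed

lemma KT_uminus: "KT \<eta> (\<lambda>y. - \<phi> y) y = - KT \<eta> \<phi> y"
  unfolding KT_def by simp

lemma KT_sq_le:
  assumes "continuous_on UNIV \<phi>"
  shows "(KT \<eta> \<phi> y)\<^sup>2 \<le> 24 * (\<integral>x. (\<phi> (0, fst (snd y), x))\<^sup>2 \<partial>leb {0<..<24})"
proof -
  have k: "sqint (leb {0<..<24}) (\<lambda>x. kern \<eta> x s)" for s
  proof (rule sqintI[where g="\<lambda>_. 1"])
    show "AE x in leb {0<..<24}. (norm (kern \<eta> x s))\<^sup>2 \<le> 1"
      using kern_bounds[of \<eta> _ s] by (intro AE_I2) (simp add: power_le_one)
  qed auto
  have "(\<integral>x. (kern \<eta> x (snd (snd y)))\<^sup>2 \<partial>leb {0<..<24}) \<le> (\<integral>x. 1 \<partial>leb {0<..<24::real})"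
    using k[of "snd (snd y)"] kern_bounds[of \<eta> _ "snd (snd y)"]
    by (intro integral_mono) (auto simp: sqint_def power_le_one)
  also have "\<dots> = 24" using measure_leb24 by simp
  finally have "(\<integral>x. (kern \<eta> x (snd (snd y)))\<^sup>2 \<partial>leb {0<..<24}) * (\<integral>x. (\<phi> (0, fst (snd y), x))\<^sup>2 \<partial>leb {0<..<24})
     \<le> 24 * (\<integral>x. (\<phi> (0, fst (snd y), x))\<^sup>2 \<partial>leb {0<..<24})"
    by (rule mult_right_mono) simp
  with Cauchy_Schwarz_integral[OF k[of "snd (snd y)"] KT_integrable(2)[OF assms, of "fst (snd y)"]]
  show ?thesis unfolding KT_def by linarith
qed

lemma integral_slice_const:
  fixes G :: "real \<Rightarrow> real" and A T :: real
  assumes "continuous_on UNIV G" "A > 0" "T > 0"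
  shows "(\<integral>y. G (fst (snd y)) \<partial>leb (QQ A T)) = 24 * A * integral (cbox 0 T) G"
proof -
  have c: "continuous_on UNIV (\<lambda>y::real \<times> real \<times> real. G (fst (snd y)))" "continuous_on UNIV (\<lambda>z::real \<times> real. G (fst z))"
    by (rule continuous_on_compose2[OF assms(1)]; auto intro!: continuous_intros)+
  have "(\<integral>y. G (fst (snd y)) \<partial>leb (QQ A T)) = integral (cbox (0,0,0) (A,T,24)) (\<lambda>y :: real \<times> real \<times> real. G (fst (snd y)))"
    unfolding QQ_box by (rule integral_leb_box[OF c(1)])
  also have "\<dots> = integral (cbox 0 A) (\<lambda>a. integral (cbox (0,0) (T,24)) (\<lambda>z::real \<times> real. G (fst z)))"
    using integral_prod_continuous[of 0 "(0,0)" A "(T,24)", OF continuous_on_subset[OF c(1)]] by simp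
  also have "\<dots> = A * integral (cbox (0,0) (T,24)) (\<lambda>z::real \<times> real. G (fst z))"
    using assms(2) by simp
  also have "integral (cbox (0,0) (T,24)) (\<lambda>z::real \<times> real. G (fst z)) = integral (cbox 0 T) (\<lambda>t. integral (cbox 0 24) (\<lambda>x::real. G t))"
    using integral_prod_continuous[of 0 0 T 24, OF continuous_on_subset[OF c(2)]] by simp
  also have "\<dots> = 24 * integral (cbox 0 T) G" by simp
  finally show ?thesis by simp
qed

lemma KT_L2_bound:
  assumes c: "continuous_on UNIV \<phi>" and [measurable]: "\<gamma> \<in> borel_measurable borel"
    and g: "AE y in leb (QQ A T). \<bar>\<gamma> (fst y)\<bar> \<le> b" and pos: "A > 0" "T > 0"
  shows "sqint (leb (QQ A T)) (\<lambda>y. \<gamma> (fst y) * KT \<eta> \<phi> y)"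
    "(\<integral>y. (\<gamma> (fst y) * KT \<eta> \<phi> y)\<^sup>2 \<partial>leb (QQ A T)) \<le> 576 * b\<^sup>2 * A * (\<integral>z. (\<phi> (0, z))\<^sup>2 \<partial>leb ({0<..<T} \<times> {0<..<24}))"
proof -
  note [measurable] = borel_measurable_continuous_onI[OF c]
  define G where "G t = integral (cbox 0 24) (\<lambda>x. (\<phi> (0, t, x))\<^sup>2)" for t
  have cz: "continuous_on UNIV (\<lambda>z. (\<phi> (0, z))\<^sup>2)"
    by (intro continuous_on_power continuous_on_compose2[OF c]) (auto intro!: continuous_intros)
  have cG: "continuous_on UNIV G" unfolding G_def
    by (rule integral_continuous_on_param) (unfold split_beta, rule continuous_on_compose2[OF cz], auto intro!: continuous_intros)
  have Gx: "(\<integral>x. (\<phi> (0, t, x))\<^sup>2 \<partial>leb {0<..<24}) = G t" for t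
    using integral_leb_box[of "\<lambda>x. (\<phi> (0, t, x))\<^sup>2" 0 24] continuous_on_compose2[OF cz, of UNIV "\<lambda>x. (t, x)"]
    by (simp add: G_def box_real continuous_on_Pair)
  have Gt: "integral (cbox 0 T) G = (\<integral>z. (\<phi> (0, z))\<^sup>2 \<partial>leb ({0<..<T} \<times> {0<..<24}))"
    using integral_prod_continuous[of 0 0 T 24 "\<lambda>z. (\<phi> (0, z))\<^sup>2", OF continuous_on_subset[OF cz]]
    by (simp add: rect_box integral_leb_box[OF cz] G_def[abs_def])
  have cG': "continuous_on UNIV (\<lambda>y::real \<times> real \<times> real. G (fst (snd y)))"
    by (rule continuous_on_compose2[OF cG]) (auto intro!: continuous_intros)
  have iG: "integrable (leb (QQ A T)) (\<lambda>y. 24 * b\<^sup>2 * G (fst (snd y)))"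
    by (intro integrable_mult_right sqint_leb_continuous(2)[OF cG']) (auto simp: QQ_box)
  have le: "AE y in leb (QQ A T). (\<gamma> (fst y) * KT \<eta> \<phi> y)\<^sup>2 \<le> 24 * b\<^sup>2 * G (fst (snd y))"
    using g
  proof eventually_elim
    case (elim y)
    have "(\<gamma> (fst y))\<^sup>2 \<le> b\<^sup>2" using power_mono[OF elim abs_ge_zero, of 2] by simp
    then have "(\<gamma> (fst y))\<^sup>2 * (KT \<eta> \<phi> y)\<^sup>2 \<le> b\<^sup>2 * (24 * G (fst (snd y)))"
      using KT_sq_le[OF c, of \<eta> y] unfolding Gx by (intro mult_mono) auto
    then show ?case by (simp add: power_mult_distrib)
  qed
  show sq: "sqint (leb (QQ A T)) (\<lambda>y. \<gamma> (fst y) * KT \<eta> \<phi> y)"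
    by (rule sqintI[OF _ iG]) (use le in auto)
  have "(\<integral>y. (\<gamma> (fst y) * KT \<eta> \<phi> y)\<^sup>2 \<partial>leb (QQ A T)) \<le> (\<integral>y. 24 * b\<^sup>2 * G (fst (snd y)) \<partial>leb (QQ A T))"
    by (rule integral_mono_AE[OF sqint_integrable_square[OF sq] iG le])
  also have "\<dots> = 24 * b\<^sup>2 * (24 * A * integral (cbox 0 T) G)"
    using integral_slice_const[OF cG pos] by simp
  finally show "(\<integral>y. (\<gamma> (fst y) * KT \<eta> \<phi> y)\<^sup>2 \<partial>leb (QQ A T)) \<le> 576 * b\<^sup>2 * A * (\<integral>z. (\<phi> (0, z))\<^sup>2 \<partial>leb ({0<..<T} \<times> {0<..<24}))"
    unfolding Gt by (simp add: algebra_simps)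
qed

lemma QQ_sets[simp, measurable]: "QQ A T \<in> sets borel" by (simp add: QQ_box)

lemma finite_measure_QQ: "finite_measure (leb (QQ A T))"
  by (rule finite_measure_leb) (auto simp: QQ_box)

lemma max0_sq_le: "(max 0 s)\<^sup>2 \<le> (s::real)\<^sup>2" "(max 0 (- s))\<^sup>2 \<le> s\<^sup>2"
  by (auto simp: max_def)

text \<open>The size of \<open>lam\<close> makes the control and renewal terms \<open>P\<close> a perturbation of relative norm at most \<open>1/2\<close>; the factor \<open>1152 = 2 * 24\<^sup>2\<close> comes from integrating the kernel twice over \<open>(0,24)\<close>.\<close>

locale dual_problem =
  fixes A ad T \<delta> \<eta> b Cu lam :: real and u :: "real \<times> real \<times> real \<Rightarrow> real" and \<gamma> :: "real \<Rightarrow> real"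
  assumes pos: "0 < A" "A < ad" "0 < T" "0 < \<delta>"
    and u_meas[measurable]: "u \<in> borel_measurable borel"
    and u_bd: "AE y in leb (QQ A T). - Cu \<le> u y \<and> u y \<le> 0"
    and g_meas[measurable]: "\<gamma> \<in> borel_measurable borel"
    and g_bd: "AE y in leb (QQ A T). 0 \<le> \<gamma> (fst y) \<and> \<gamma> (fst y) \<le> b"
    and Cu: "Cu \<ge> 0"
    and lam: "lam \<ge> 8 * (1152 * b\<^sup>2 * A + 1) + 4 * Cu"
begin

abbreviation "M \<equiv> leb (QQ A T)"

definition L0 where "L0 \<phi> \<phi>a \<phi>t \<phi>xx y = - \<phi>a y - \<phi>t y - \<delta> * \<phi>xx y + lam * \<phi> y"
  for \<phi> \<phi>a \<phi>t \<phi>xx :: "real \<times> real \<times> real \<Rightarrow> real" and y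

definition P where "P \<phi> y = - u y * \<phi> y - \<gamma> (fst y) * KT \<eta> \<phi> y"
  for \<phi> :: "real \<times> real \<times> real \<Rightarrow> real" and y

abbreviation "L \<phi> \<phi>a \<phi>t \<phi>xx y \<equiv> L0 \<phi> \<phi>a \<phi>t \<phi>xx y + P \<phi> y"

definition S0 where "S0 \<phi> = (\<integral>z. (\<phi> (0, z))\<^sup>2 \<partial>leb ({0<..<T} \<times> {0<..<24}))"
  for \<phi> :: "real \<times> real \<times> real \<Rightarrow> real"

definition S1 where "S1 \<phi> = (\<integral>z. (\<phi> (fst z, 0, snd z))\<^sup>2 \<partial>leb ({0<..<A} \<times> {0<..<24}))"
  for \<phi> :: "real \<times> real \<times> real \<Rightarrow> real"

lemma lam_pos: "lam \<ge> 8" "lam > 0"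
proof -
  have "8 * (1152 * b\<^sup>2 * A + 1) \<ge> 8" using pos by simp
  then show "lam \<ge> 8" using lam Cu by linarith
  then show "lam > 0" by simp
qed

lemma sq_cont: "continuous_on UNIV \<phi> \<Longrightarrow> sqint M \<phi>" for \<phi> :: "real \<times> real \<times> real \<Rightarrow> real"
  by (rule sqint_leb_continuous) (auto simp: QQ_box)

lemma g_abs: "AE y in M. \<bar>\<gamma> (fst y)\<bar> \<le> b"
  using g_bd by eventually_elim simp

lemma sq_P: assumes "continuous_on UNIV \<phi>" shows "sqint M (P \<phi>)"
proof -
  have "sqint M (\<lambda>y. u y * \<phi> y)"
    by (rule sqint_bounded_mult[OF sq_cont[OF assms], where C=Cu]) (use u_bd in \<open>auto elim: eventually_mono\<close>)
  from sqint_diff[OF sqint_cmult[OF this, of "-1"] KT_L2_bound(1)[OF assms g_meas g_abs pos(1,3), where \<eta>=\<eta>]]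
  show ?thesis unfolding P_def by simp
qed

lemma cont_L0: assumes "ctest A ad T \<phi> \<phi>a \<phi>t \<phi>xx" shows "continuous_on UNIV (L0 \<phi> \<phi>a \<phi>t \<phi>xx)"
  using assms unfolding ctest_def L0_def by (auto intro!: continuous_intros simp: test_funD)

lemma sq_L0: "ctest A ad T \<phi> \<phi>a \<phi>t \<phi>xx \<Longrightarrow> sqint M (L0 \<phi> \<phi>a \<phi>t \<phi>xx)"
  by (intro sq_cont cont_L0)

lemma ctest_cont: "ctest A ad T \<phi> \<phi>a \<phi>t \<phi>xx \<Longrightarrow> continuous_on UNIV \<phi>"
  unfolding ctest_def by (auto simp: test_funD)

lemma sq_L: "ctest A ad T \<phi> \<phi>a \<phi>t \<phi>xx \<Longrightarrow> sqint M (\<lambda>y. L \<phi> \<phi>a \<phi>t \<phi>xx y)"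
  by (intro sqint_add sq_L0 sq_P ctest_cont)

lemma L0_lincomb: "L0 (\<lambda>y. \<phi> y + c * \<psi> y) (\<lambda>y. \<phi>a y + c * \<psi>a y) (\<lambda>y. \<phi>t y + c * \<psi>t y) (\<lambda>y. \<phi>xx y + c * \<psi>xx y) y
   = L0 \<phi> \<phi>a \<phi>t \<phi>xx y + c * L0 \<psi> \<psi>a \<psi>t \<psi>xx y"
  by (simp add: L0_def algebra_simps)

lemma P_lincomb: "continuous_on UNIV \<phi> \<Longrightarrow> continuous_on UNIV \<psi> \<Longrightarrow> P (\<lambda>y. \<phi> y + c * \<psi> y) y = P \<phi> y + c * P \<psi> y"
  by (simp add: P_def KT_lincomb algebra_simps)

lemma L0_zero: "L0 (\<lambda>y. 0) (\<lambda>y. 0) (\<lambda>y. 0) (\<lambda>y. 0) y = 0" by (simp add: L0_def)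

lemma P_zero: "P (\<lambda>y. 0) y = 0" by (simp add: P_def KT_def)

lemma L0_uminus: "L0 (\<lambda>y. - \<phi> y) (\<lambda>y. - \<phi>a y) (\<lambda>y. - \<phi>t y) (\<lambda>y. - \<phi>xx y) y = - L0 \<phi> \<phi>a \<phi>t \<phi>xx y"
  by (simp add: L0_def)

lemma P_uminus: "P (\<lambda>y. - \<phi> y) y = - P \<phi> y"
  by (simp add: P_def KT_uminus)

lemma energy:
  assumes ct: "ctest A ad T \<phi> \<phi>a \<phi>t \<phi>xx"
  shows "S0 (\<lambda>y. max 0 (- \<phi> y)) + S1 (\<lambda>y. max 0 (- \<phi> y)) + 2 * lam * (\<integral>y. (max 0 (- \<phi> y))\<^sup>2 \<partial>M)
    \<le> 2 * (\<integral>y. max 0 (- \<phi> y) * - L0 \<phi> \<phi>a \<phi>t \<phi>xx y \<partial>M)"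
proof -
  have t: "test_fun ad T \<phi> \<phi>a \<phi>t \<phi>xx" and v: "\<phi> (A, t, x) = 0" for t x using ct by (auto simp: ctest_def)
  have "(\<lambda>y. max 0 (- \<phi> y) * - L0 \<phi> \<phi>a \<phi>t \<phi>xx y) = (\<lambda>y. max 0 (- \<phi> y) * (\<phi>a y + \<phi>t y + \<delta> * \<phi>xx y - lam * \<phi> y))"
    by (simp add: L0_def fun_eq_iff algebra_simps)
  then show ?thesis
    using test_fun_negpart_energy[OF t v pos(1,3) less_imp_le[OF pos(4)], of lam] by (simp add: S0_def S1_def)
qed

lemma split_sq: "(\<phi> y)\<^sup>2 = (max 0 (- \<phi> y))\<^sup>2 + (max 0 (- (- \<phi> y)))\<^sup>2" for \<phi> :: "'z \<Rightarrow> real"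
  by (auto simp: max_def)

lemma S_split:
  assumes "continuous_on UNIV \<phi>"
  shows "S0 \<phi> = S0 (\<lambda>y. max 0 (- \<phi> y)) + S0 (\<lambda>y. max 0 (- (- \<phi> y)))"
    "(\<integral>y. (\<phi> y)\<^sup>2 \<partial>M) = (\<integral>y. (max 0 (- \<phi> y))\<^sup>2 \<partial>M) + (\<integral>y. (max 0 (- (- \<phi> y)))\<^sup>2 \<partial>M)"
proof -
  have c: "continuous_on UNIV (\<lambda>y. max 0 (- \<phi> y))" "continuous_on UNIV (\<lambda>y. max 0 (- (- \<phi> y)))"
    by (intro continuous_intros assms)+
  have sq: "sqint (leb ({0<..<T} \<times> {0<..<24})) (\<lambda>z. f (0, z))" if "continuous_on UNIV f" for f :: "real \<times> real \<times> real \<Rightarrow> real"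
    by (rule sqint_leb_continuous, rule continuous_on_compose2[OF that]) (auto simp: rect_box intro!: continuous_intros)
  show "S0 \<phi> = S0 (\<lambda>y. max 0 (- \<phi> y)) + S0 (\<lambda>y. max 0 (- (- \<phi> y)))"
    unfolding S0_def using sqint_integrable_square[OF sq[OF c(1)]] sqint_integrable_square[OF sq[OF c(2)]]
    by (subst split_sq) (rule Bochner_Integration.integral_add)
  show "(\<integral>y. (\<phi> y)\<^sup>2 \<partial>M) = (\<integral>y. (max 0 (- \<phi> y))\<^sup>2 \<partial>M) + (\<integral>y. (max 0 (- (- \<phi> y)))\<^sup>2 \<partial>M)"
    using sqint_integrable_square[OF sq_cont[OF c(1)]] sqint_integrable_square[OF sq_cont[OF c(2)]]
    by (subst split_sq) (rule Bochner_Integration.integral_add)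
qed

lemma S1_nonneg: "S1 \<phi> \<ge> 0" and S0_nonneg: "S0 \<phi> \<ge> 0" by (simp_all add: S1_def S0_def)

lemma L0_estimate:
  assumes ct: "ctest A ad T \<phi> \<phi>a \<phi>t \<phi>xx"
  shows "lam * S0 \<phi> + lam\<^sup>2 * (\<integral>y. (\<phi> y)\<^sup>2 \<partial>M) \<le> (\<integral>y. (L0 \<phi> \<phi>a \<phi>t \<phi>xx y)\<^sup>2 \<partial>M)"
proof -
  let ?l = "L0 \<phi> \<phi>a \<phi>t \<phi>xx"
  note c = ctest_cont[OF ct]
  have cm: "continuous_on UNIV (\<lambda>y. max 0 (- \<phi> y))" "continuous_on UNIV (\<lambda>y. max 0 (- (- \<phi> y)))"
    by (intro continuous_intros c)+
  have im: "integrable M (\<lambda>y. max 0 (- \<phi> y) * - ?l y)" "integrable M (\<lambda>y. max 0 (- (- \<phi> y)) * - (- ?l y))"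
    by (intro sqint_mult sq_cont cm continuous_intros cont_L0[OF ct])+
  have ip: "integrable M (\<lambda>y. \<phi> y * ?l y)" by (intro sqint_mult sq_cont c cont_L0[OF ct])
  have e2: "S0 (\<lambda>y. max 0 (- (- \<phi> y))) + S1 (\<lambda>y. max 0 (- (- \<phi> y))) + 2 * lam * (\<integral>y. (max 0 (- (- \<phi> y)))\<^sup>2 \<partial>M)
    \<le> 2 * (\<integral>y. max 0 (- (- \<phi> y)) * - (- ?l y) \<partial>M)"
    using energy[OF ctest_uminus[OF ct]] unfolding L0_uminus .
  have "(\<integral>y. max 0 (- \<phi> y) * - ?l y \<partial>M) + (\<integral>y. max 0 (- (- \<phi> y)) * - (- ?l y) \<partial>M) = (\<integral>y. \<phi> y * ?l y \<partial>M)"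
    unfolding Bochner_Integration.integral_add[OF im, symmetric]
    by (rule Bochner_Integration.integral_cong) (auto simp: max_def)
  moreover have "2 * (\<integral>y. \<phi> y * ?l y \<partial>M) \<le> lam * (\<integral>y. (\<phi> y)\<^sup>2 \<partial>M) + (\<integral>y. (?l y)\<^sup>2 \<partial>M) / lam"
  proof -
    have "(\<integral>y. 2 * (\<phi> y * ?l y) \<partial>M) \<le> (\<integral>y. lam * (\<phi> y)\<^sup>2 + (?l y)\<^sup>2 / lam \<partial>M)"
    proof (rule integral_mono)
      show "2 * (\<phi> y * ?l y) \<le> lam * (\<phi> y)\<^sup>2 + (?l y)\<^sup>2 / lam" for y
      proof -
        have "0 \<le> (lam * \<phi> y - ?l y)\<^sup>2 / lam" using lam_pos by simp
        also have "\<dots> = lam * (\<phi> y)\<^sup>2 + (?l y)\<^sup>2 / lam - 2 * (\<phi> y * ?l y)"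
          using lam_pos(2) by (simp add: power2_eq_square field_simps)
        finally show ?thesis by simp
      qed
    qed (use ip sqint_integrable_square[OF sq_cont[OF c]] sqint_integrable_square[OF sq_L0[OF ct]] in auto)
    then show ?thesis using sqint_integrable_square[OF sq_cont[OF c]] sqint_integrable_square[OF sq_L0[OF ct]] by simp
  qed
  ultimately have "S0 \<phi> + lam * (\<integral>y. (\<phi> y)\<^sup>2 \<partial>M) \<le> (\<integral>y. (?l y)\<^sup>2 \<partial>M) / lam"
    using energy[OF ct] e2 S_split[OF c] S1_nonneg[of "\<lambda>y. max 0 (- \<phi> y)"] S1_nonneg[of "\<lambda>y. max 0 (- (- \<phi> y))"]
    by (simp add: algebra_simps)
  then show ?thesis using lam_pos(2) by (simp add: pos_le_divide_eq algebra_simps power2_eq_square)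
qed

lemma P_small:
  assumes ct: "ctest A ad T \<phi> \<phi>a \<phi>t \<phi>xx"
  shows "4 * (\<integral>y. (P \<phi> y)\<^sup>2 \<partial>M) \<le> (\<integral>y. (L0 \<phi> \<phi>a \<phi>t \<phi>xx y)\<^sup>2 \<partial>M)"
proof -
  note c = ctest_cont[OF ct]
  note kb = KT_L2_bound[OF c g_meas g_abs pos(1,3), where \<eta>=\<eta>]
  define F where "F = (\<integral>y. (\<phi> y)\<^sup>2 \<partial>M)"
  have F0: "F \<ge> 0" by (simp add: F_def)
  have "(\<integral>y. (P \<phi> y)\<^sup>2 \<partial>M) \<le> (\<integral>y. 2 * Cu\<^sup>2 * (\<phi> y)\<^sup>2 + 2 * (\<gamma> (fst y) * KT \<eta> \<phi> y)\<^sup>2 \<partial>M)"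
  proof (rule integral_mono_AE)
    show "AE y in M. (P \<phi> y)\<^sup>2 \<le> 2 * Cu\<^sup>2 * (\<phi> y)\<^sup>2 + 2 * (\<gamma> (fst y) * KT \<eta> \<phi> y)\<^sup>2"
      using u_bd
    proof eventually_elim
      case (elim y)
      have "(u y)\<^sup>2 \<le> Cu\<^sup>2" using elim Cu by (simp add: abs_le_square_iff[symmetric])
      then have "(u y)\<^sup>2 * (\<phi> y)\<^sup>2 \<le> Cu\<^sup>2 * (\<phi> y)\<^sup>2" by (rule mult_right_mono) simp
      moreover have "(P \<phi> y)\<^sup>2 \<le> 2 * (- u y * \<phi> y)\<^sup>2 + 2 * (- (\<gamma> (fst y) * KT \<eta> \<phi> y))\<^sup>2"
        using norm_add_sq_le[of "- u y * \<phi> y" "- (\<gamma> (fst y) * KT \<eta> \<phi> y)"] by (simp add: P_def)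
      ultimately show ?case by (simp add: power_mult_distrib)
    qed
  qed (use sqint_integrable_square[OF sq_P[OF c]] sqint_integrable_square[OF sq_cont[OF c]] sqint_integrable_square[OF kb(1)] in auto)
  also have "\<dots> = 2 * Cu\<^sup>2 * F + 2 * (\<integral>y. (\<gamma> (fst y) * KT \<eta> \<phi> y)\<^sup>2 \<partial>M)"
    using sqint_integrable_square[OF sq_cont[OF c]] sqint_integrable_square[OF kb(1)] by (simp add: F_def)
  also have "\<dots> \<le> 2 * Cu\<^sup>2 * F + 2 * (576 * b\<^sup>2 * A * S0 \<phi>)"
    using kb(2) unfolding S0_def by linarith
  finally have "4 * (\<integral>y. (P \<phi> y)\<^sup>2 \<partial>M) \<le> 8 * Cu\<^sup>2 * F + (4608 * b\<^sup>2 * A) * S0 \<phi>" by simp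
  also have "\<dots> \<le> lam\<^sup>2 * F + lam * S0 \<phi>"
  proof (intro add_mono mult_right_mono F0 S0_nonneg)
    have b0: "b\<^sup>2 * A \<ge> 0" using pos by simp
    have "4 * Cu \<le> lam" using lam b0 by simp
    then have "(4 * Cu)\<^sup>2 \<le> lam\<^sup>2" using Cu by (intro power_mono) auto
    then have "16 * Cu\<^sup>2 \<le> lam\<^sup>2" by (simp add: power_mult_distrib)
    then show "8 * Cu\<^sup>2 \<le> lam\<^sup>2" using zero_le_power2[of Cu] by linarith
    show "4608 * b\<^sup>2 * A \<le> lam" using lam Cu b0 by (simp add: algebra_simps)
  qed
  also have "\<dots> \<le> (\<integral>y. (L0 \<phi> \<phi>a \<phi>t \<phi>xx y)\<^sup>2 \<partial>M)" using L0_estimate[OF ct] by (simp add: F_def)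
  finally show ?thesis .
qed

lemma negpart_estimate:
  assumes ct: "ctest A ad T \<phi> \<phi>a \<phi>t \<phi>xx"
  defines "N \<equiv> \<lambda>y. max 0 (- \<phi> y)"
  shows "S0 N / 2 + S1 N + (\<integral>y. (N y)\<^sup>2 \<partial>M) \<le> (\<integral>y. (max 0 (- L \<phi> \<phi>a \<phi>t \<phi>xx y))\<^sup>2 \<partial>M)"
proof -
  note c = ctest_cont[OF ct]
  have cN: "continuous_on UNIV N" unfolding N_def by (intro continuous_intros c)
  note kb = KT_L2_bound[OF cN g_meas g_abs pos(1,3), where \<eta>=\<eta>]
  define C where "C = 1152 * b\<^sup>2 * A + 1"
  have C1: "C \<ge> 1" unfolding C_def using pos by simp
  define m where "m y = max 0 (- L \<phi> \<phi>a \<phi>t \<phi>xx y)" for y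
  have sqm: "sqint M m"
  proof (rule sqintI[OF _ sqint_integrable_square[OF sq_L[OF ct]]])
    have "(\<lambda>y. L \<phi> \<phi>a \<phi>t \<phi>xx y) \<in> borel_measurable M" using sq_L[OF ct] by (simp add: sqint_def)
    then show "m \<in> borel_measurable M" unfolding m_def by (intro borel_measurable_max borel_measurable_uminus) auto
    show "AE y in M. (norm (m y))\<^sup>2 \<le> (L \<phi> \<phi>a \<phi>t \<phi>xx y)\<^sup>2"
      unfolding m_def real_norm_def power2_abs by (intro AE_I2 max0_sq_le)
  qed
  have "2 * (\<integral>y. N y * - L0 \<phi> \<phi>a \<phi>t \<phi>xx y \<partial>M) = (\<integral>y. 2 * (N y * - L0 \<phi> \<phi>a \<phi>t \<phi>xx y) \<partial>M)" by simp
  also have "\<dots> \<le> (\<integral>y. (1 + C) * (N y)\<^sup>2 + (m y)\<^sup>2 + (\<gamma> (fst y) * KT \<eta> N y)\<^sup>2 / C \<partial>M)"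
  proof (rule integral_mono_AE)
    show "AE y in M. 2 * (N y * - L0 \<phi> \<phi>a \<phi>t \<phi>xx y) \<le> (1 + C) * (N y)\<^sup>2 + (m y)\<^sup>2 + (\<gamma> (fst y) * KT \<eta> N y)\<^sup>2 / C"
      using u_bd g_bd
    proof eventually_elim
      case (elim y)
      have N0: "N y \<ge> 0" by (simp add: N_def)
      have un: "- u y * \<phi> y * N y \<le> 0"
      proof -
        have "\<phi> y * N y = - (N y)\<^sup>2" by (auto simp: N_def max_def power2_eq_square)
        then have "- u y * \<phi> y * N y = u y * (N y)\<^sup>2" by (simp add: mult.assoc)
        then show ?thesis using elim by (simp add: mult_nonpos_nonneg)
      qed
      have kt: "- KT \<eta> \<phi> y \<le> KT \<eta> N y"
        unfolding KT_uminus[symmetric] by (rule KT_mono) (auto simp: N_def intro!: continuous_intros c)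
      have "- L0 \<phi> \<phi>a \<phi>t \<phi>xx y = - L \<phi> \<phi>a \<phi>t \<phi>xx y + (- u y * \<phi> y - \<gamma> (fst y) * KT \<eta> \<phi> y)"
        by (simp add: P_def)
      then have "N y * - L0 \<phi> \<phi>a \<phi>t \<phi>xx y = N y * (- L \<phi> \<phi>a \<phi>t \<phi>xx y + (- u y * \<phi> y - \<gamma> (fst y) * KT \<eta> \<phi> y))"
        by simp
      then have "N y * - L0 \<phi> \<phi>a \<phi>t \<phi>xx y = N y * - L \<phi> \<phi>a \<phi>t \<phi>xx y + - u y * \<phi> y * N y + N y * (\<gamma> (fst y) * - KT \<eta> \<phi> y)"
        by (simp only: distrib_left right_diff_distrib) (simp add: ac_simps)
      also have "\<dots> \<le> N y * m y + 0 + N y * (\<gamma> (fst y) * KT \<eta> N y)"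
        using N0 elim kt un by (intro add_mono mult_left_mono) (auto simp: m_def)
      finally have "2 * (N y * - L0 \<phi> \<phi>a \<phi>t \<phi>xx y) \<le> 2 * N y * m y + 2 * N y * (\<gamma> (fst y) * KT \<eta> N y)" by simp
      moreover have "2 * N y * m y \<le> (N y)\<^sup>2 + (m y)\<^sup>2" by (rule sum_squares_bound)
      moreover have yg: "2 * N y * k \<le> C * (N y)\<^sup>2 + k\<^sup>2 / C" for k
      proof -
        have "0 \<le> (C * N y - k)\<^sup>2 / C" using C1 by simp
        also have "\<dots> = C * (N y)\<^sup>2 + k\<^sup>2 / C - 2 * N y * k" using C1 by (simp add: power2_eq_square field_simps)
        finally show ?thesis by simp
      qed
      moreover have "(1 + C) * (N y)\<^sup>2 = (N y)\<^sup>2 + C * (N y)\<^sup>2" by (simp add: distrib_right)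
      moreover note yg[of "\<gamma> (fst y) * KT \<eta> N y"]
      ultimately show ?case by linarith
    qed
    show "integrable M (\<lambda>y. 2 * (N y * - L0 \<phi> \<phi>a \<phi>t \<phi>xx y))"
      by (intro integrable_mult_right sqint_mult sq_cont cN continuous_intros cont_L0[OF ct])
  qed (use sqint_integrable_square[OF sq_cont[OF cN]] sqint_integrable_square[OF sqm] sqint_integrable_square[OF kb(1)] in auto)
  also have "\<dots> = (1 + C) * (\<integral>y. (N y)\<^sup>2 \<partial>M) + (\<integral>y. (m y)\<^sup>2 \<partial>M) + (\<integral>y. (\<gamma> (fst y) * KT \<eta> N y)\<^sup>2 \<partial>M) / C"
    using sqint_integrable_square[OF sq_cont[OF cN]] sqint_integrable_square[OF sqm] sqint_integrable_square[OF kb(1)] by simp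
  also have "(\<integral>y. (\<gamma> (fst y) * KT \<eta> N y)\<^sup>2 \<partial>M) / C \<le> S0 N / 2"
  proof -
    have "(\<integral>y. (\<gamma> (fst y) * KT \<eta> N y)\<^sup>2 \<partial>M) \<le> (576 * b\<^sup>2 * A) * S0 N" using kb(2) by (simp add: S0_def)
    also have "\<dots> \<le> C / 2 * S0 N" unfolding C_def by (intro mult_right_mono S0_nonneg) simp
    finally show ?thesis using C1 by (simp add: field_simps)
  qed
  finally have "S0 N + S1 N + 2 * lam * (\<integral>y. (N y)\<^sup>2 \<partial>M) \<le> (1 + C) * (\<integral>y. (N y)\<^sup>2 \<partial>M) + (\<integral>y. (m y)\<^sup>2 \<partial>M) + S0 N / 2"
    using energy[OF ct] unfolding N_def by linarith
  moreover have "(2 + C) * (\<integral>y. (N y)\<^sup>2 \<partial>M) \<le> 2 * lam * (\<integral>y. (N y)\<^sup>2 \<partial>M)"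
  proof (rule mult_right_mono)
    show "2 + C \<le> 2 * lam" using lam[folded C_def] Cu C1 by linarith
  qed simp
  ultimately show ?thesis unfolding m_def by (simp add: algebra_simps)
qed

lemma trace_estimate:
  assumes ct: "ctest A ad T \<phi> \<phi>a \<phi>t \<phi>xx"
  shows "S0 \<phi> \<le> 2 * (\<integral>y. (L \<phi> \<phi>a \<phi>t \<phi>xx y)\<^sup>2 \<partial>M)"
proof -
  let ?l = "\<lambda>y. L \<phi> \<phi>a \<phi>t \<phi>xx y"
  note c = ctest_cont[OF ct]
  have [measurable]: "?l \<in> borel_measurable M" using sq_L[OF ct] by (simp add: sqint_def)
  have i: "integrable M (\<lambda>y. (max 0 (- ?l y))\<^sup>2)" "integrable M (\<lambda>y. (max 0 (- (- ?l y)))\<^sup>2)"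
  proof -
    have "integrable M (\<lambda>y. (max 0 (c * ?l y))\<^sup>2)" if "c = 1 \<or> c = -1" for c
    proof (rule Bochner_Integration.integrable_bound[OF sqint_integrable_square[OF sq_L[OF ct]]])
      show "AE y in M. norm ((max 0 (c * ?l y))\<^sup>2) \<le> norm ((?l y)\<^sup>2)"
        using that max0_sq_le[of "?l _"] by (intro AE_I2) (auto simp: real_norm_def)
    qed measurable
    from this[of "-1"] this[of 1] show "integrable M (\<lambda>y. (max 0 (- ?l y))\<^sup>2)" "integrable M (\<lambda>y. (max 0 (- (- ?l y)))\<^sup>2)"
      by (simp_all add: add.commute)
  qed
  have nn: "(\<integral>y. (f y)\<^sup>2 \<partial>M) \<ge> 0" for f :: "real \<times> real \<times> real \<Rightarrow> real" by simp
  have "S0 (\<lambda>y. max 0 (- \<phi> y)) / 2 \<le> (\<integral>y. (max 0 (- ?l y))\<^sup>2 \<partial>M)"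
    using negpart_estimate[OF ct] S1_nonneg[of "\<lambda>y. max 0 (- \<phi> y)"] nn[of "\<lambda>y. max 0 (- \<phi> y)"] by linarith
  moreover have "S0 (\<lambda>y. max 0 (- (- \<phi> y))) / 2 \<le> (\<integral>y. (max 0 (- (- ?l y)))\<^sup>2 \<partial>M)"
  proof -
    have e: "- L0 \<phi> \<phi>a \<phi>t \<phi>xx y + - P \<phi> y = - ?l y" for y by simp
    show ?thesis
      using negpart_estimate[OF ctest_uminus[OF ct]] S1_nonneg[of "\<lambda>y. max 0 (- (- \<phi> y))"] nn[of "\<lambda>y. max 0 (- (- \<phi> y))"]
      unfolding L0_uminus P_uminus e by linarith
  qed
  moreover have "(\<integral>y. (?l y)\<^sup>2 \<partial>M) = (\<integral>y. (max 0 (- ?l y))\<^sup>2 \<partial>M) + (\<integral>y. (max 0 (- (- ?l y)))\<^sup>2 \<partial>M)"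
    by (subst split_sq) (rule Bochner_Integration.integral_add[OF i])
  ultimately show ?thesis using S_split(1)[OF c] by linarith
qed

end

lemma neg_sqrt_mult_le:
  fixes f h h' x v :: real
  assumes "- v \<le> x" "v\<^sup>2 \<le> f * h'" "h' \<le> h" "f \<ge> 0"
  shows "- sqrt (f * h) \<le> x"
proof -
  have "v\<^sup>2 \<le> f * h" using assms(2) mult_left_mono[OF assms(3,4)] by linarith
  then have "v \<le> sqrt (f * h)" by (rule real_le_rsqrt)
  then show ?thesis using assms(1) by linarith
qed

context dual_problem begin

lemma L0_dense:
  assumes psi: "sqint M \<psi>" and "e > 0"
  shows "\<exists>\<phi> \<phi>a \<phi>t \<phi>xx. ctest A ad T \<phi> \<phi>a \<phi>t \<phi>xx \<and> (\<integral>y. (\<psi> y - L0 \<phi> \<phi>a \<phi>t \<phi>xx y)\<^sup>2 \<partial>M) < e"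
proof -
  define V where "V = {v. \<exists>\<phi> \<phi>a \<phi>t \<phi>xx. ctest A ad T \<phi> \<phi>a \<phi>t \<phi>xx \<and> v = L0 \<phi> \<phi>a \<phi>t \<phi>xx}"
  have "\<exists>v\<in>V. (\<integral>y. (\<psi> y - v y)\<^sup>2 \<partial>M) < e"
  proof (rule L2_dense_if_orthogonal_trivial[OF finite_measure_QQ _ _ _ _ psi \<open>e > 0\<close>])
    show "v \<in> V \<Longrightarrow> sqint M v" for v unfolding V_def by (auto intro: sq_L0)
    show "(\<lambda>y. 0) \<in> V"
    proof -
      have "(\<lambda>y. 0) = L0 (\<lambda>y. 0) (\<lambda>y. 0) (\<lambda>y. 0) (\<lambda>y. 0)" by (rule ext) (simp add: L0_zero)
      then show ?thesis unfolding V_def using ctest_zero by blast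
    qed
    fix v w c assume "v \<in> V" "w \<in> V"
    then obtain \<phi> \<phi>a \<phi>t \<phi>xx \<psi> \<psi>a \<psi>t \<psi>xx where
      1: "ctest A ad T \<phi> \<phi>a \<phi>t \<phi>xx" "v = L0 \<phi> \<phi>a \<phi>t \<phi>xx" and 2: "ctest A ad T \<psi> \<psi>a \<psi>t \<psi>xx" "w = L0 \<psi> \<psi>a \<psi>t \<psi>xx"
      unfolding V_def by auto
    have "(\<lambda>y. v y + c * w y) = L0 (\<lambda>y. \<phi> y + c * \<psi> y) (\<lambda>y. \<phi>a y + c * \<psi>a y) (\<lambda>y. \<phi>t y + c * \<psi>t y) (\<lambda>y. \<phi>xx y + c * \<psi>xx y)"
      unfolding 1(2) 2(2) by (rule ext) (simp add: L0_lincomb)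
    with ctest_lincomb[OF 1(1) 2(1), of c] show "(\<lambda>y. v y + c * w y) \<in> V"
      unfolding V_def mem_Collect_eq by (intro exI conjI)
  next
    fix w assume w: "sqint M w" and orth: "\<And>v. v \<in> V \<Longrightarrow> (\<integral>y. w y * v y \<partial>M) = 0"
    define W where "W y = indicator (QQ A T) y * w y" for y
    have iW: "integrable lborel W"
      using sqint_integrable[OF finite_measure_QQ w] by (simp add: W_def[abs_def] integrable_leb_iff set_integrable_def)
    have "AE y in lborel. W y = 0"
    proof (rule product_cos_orthogonal_imp_zero[OF iW, of A T])
      show "y \<notin> QQ A T \<Longrightarrow> W y = 0" for y by (simp add: W_def)
      fix b b' c c' :: "real \<Rightarrow> real" and k m
      assume bc: "\<And>s. (b has_real_derivative b' s) (at s)" "continuous_on UNIV b'" "\<And>s. s \<ge> A \<Longrightarrow> b s = 0 \<and> b' s = 0"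
        "\<And>s. (c has_real_derivative c' s) (at s)" "continuous_on UNIV c'" "\<And>s. s \<ge> T \<Longrightarrow> c s = 0 \<and> c' s = 0"
      obtain \<phi> \<phi>a \<phi>t \<phi>xx where ct: "ctest A ad T \<phi> \<phi>a \<phi>t \<phi>xx" and
        eq: "\<forall>a t x. t \<ge> 0 \<longrightarrow> - \<phi>a (a, t, x) - \<phi>t (a, t, x) - \<delta> * \<phi>xx (a, t, x) + lam * \<phi> (a, t, x)
            = b a * c t * cos (real k * (pi/12 * (x - m)))"
      proof -
        have "\<exists>\<phi> \<phi>a \<phi>t \<phi>xx. ctest A ad T \<phi> \<phi>a \<phi>t \<phi>xx \<and> (\<forall>a t x. t \<ge> 0 \<longrightarrow> - \<phi>a (a, t, x) - \<phi>t (a, t, x) - \<delta> * \<phi>xx (a, t, x) + lam * \<phi> (a, t, x)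
            = b a * c t * cos (real k * (pi/12 * (x - m))))"
          by (rule ctest_solve[OF pos(2,3)]) (fact bc)+
        then show ?thesis by (elim exE conjE) (rule that)
      qed
      have "L0 \<phi> \<phi>a \<phi>t \<phi>xx \<in> V" unfolding V_def using ct by blast
      from orth[OF this] have "(\<integral>y. w y * L0 \<phi> \<phi>a \<phi>t \<phi>xx y \<partial>M) = 0" .
      moreover have "(\<integral>y. w y * L0 \<phi> \<phi>a \<phi>t \<phi>xx y \<partial>M) = (\<integral>y. W y * (b (fst y) * c (fst (snd y)) * cos (real k * (pi/12 * (snd (snd y) - m)))) \<partial>lborel)"
        unfolding integral_leb_eq[OF QQ_sets] set_lebesgue_integral_def W_def
      proof (rule Bochner_Integration.integral_cong)
        fix y :: "real \<times> real \<times> real"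
        show "indicator (QQ A T) y *\<^sub>R (w y * L0 \<phi> \<phi>a \<phi>t \<phi>xx y)
          = indicator (QQ A T) y * w y * (b (fst y) * c (fst (snd y)) * cos (real k * (pi/12 * (snd (snd y) - m))))"
        proof (cases "y \<in> QQ A T")
          case True
          obtain a t x where y: "y = (a, t, x)" by (cases y) auto
          then have "t \<ge> 0" using True by (simp add: QQ_def)
          then have "L0 \<phi> \<phi>a \<phi>t \<phi>xx y = b (fst y) * c (fst (snd y)) * cos (real k * (pi/12 * (snd (snd y) - m)))"
            unfolding L0_def y by (simp only: eq fst_conv snd_conv)
          then show ?thesis by simp
        qed simp
      qed simp
      ultimately show "(\<integral>y. W y * (b (fst y) * c (fst (snd y)) * cos (real k * (pi/12 * (snd (snd y) - m)))) \<partial>lborel) = 0" by simp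
    qed
    then show "AE y in M. w y = 0" unfolding AE_leb_iff[OF QQ_sets] by eventually_elim (auto simp: W_def indicator_def)
  qed
  then show ?thesis unfolding V_def by auto
qed

lemma L_dense:
  assumes psi: "sqint M \<psi>" and "e > 0"
  shows "\<exists>\<phi> \<phi>a \<phi>t \<phi>xx. ctest A ad T \<phi> \<phi>a \<phi>t \<phi>xx \<and> (\<integral>y. (\<psi> y - L \<phi> \<phi>a \<phi>t \<phi>xx y)\<^sup>2 \<partial>M) < e"
proof -
  define V where "V = {v. \<exists>\<phi> \<phi>a \<phi>t \<phi>xx. ctest A ad T \<phi> \<phi>a \<phi>t \<phi>xx \<and> v = (\<lambda>y. L \<phi> \<phi>a \<phi>t \<phi>xx y)}"
  have "\<exists>v\<in>V. (\<integral>y. (\<psi> y - v y)\<^sup>2 \<partial>M) < e"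
  proof (rule L2_dense_if_orthogonal_trivial[OF finite_measure_QQ _ _ _ _ psi \<open>e > 0\<close>])
    show "v \<in> V \<Longrightarrow> sqint M v" for v unfolding V_def by (auto intro: sq_L)
    show "(\<lambda>y. 0) \<in> V"
    proof -
      have "(\<lambda>y. 0) = (\<lambda>y. L (\<lambda>y. 0) (\<lambda>y. 0) (\<lambda>y. 0) (\<lambda>y. 0) y)" by (rule ext) (simp add: L0_zero P_zero)
      then show ?thesis unfolding V_def using ctest_zero by blast
    qed
    fix v w c assume "v \<in> V" "w \<in> V"
    then obtain \<phi> \<phi>a \<phi>t \<phi>xx \<psi> \<psi>a \<psi>t \<psi>xx where
      1: "ctest A ad T \<phi> \<phi>a \<phi>t \<phi>xx" "v = (\<lambda>y. L \<phi> \<phi>a \<phi>t \<phi>xx y)" and 2: "ctest A ad T \<psi> \<psi>a \<psi>t \<psi>xx" "w = (\<lambda>y. L \<psi> \<psi>a \<psi>t \<psi>xx y)"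
      unfolding V_def by auto
    have "(\<lambda>y. v y + c * w y) = (\<lambda>y. L (\<lambda>y. \<phi> y + c * \<psi> y) (\<lambda>y. \<phi>a y + c * \<psi>a y) (\<lambda>y. \<phi>t y + c * \<psi>t y) (\<lambda>y. \<phi>xx y + c * \<psi>xx y) y)"
      unfolding 1(2) 2(2) by (rule ext) (simp add: L0_lincomb P_lincomb[OF ctest_cont[OF 1(1)] ctest_cont[OF 2(1)]] algebra_simps)
    with ctest_lincomb[OF 1(1) 2(1), of c] show "(\<lambda>y. v y + c * w y) \<in> V"
      unfolding V_def mem_Collect_eq by (intro exI conjI)
  next
    fix w assume w: "sqint M w" and orth: "\<And>v. v \<in> V \<Longrightarrow> (\<integral>y. w y * v y \<partial>M) = 0"
    define W where "W = (\<integral>y. (w y)\<^sup>2 \<partial>M)"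
    have "W \<le> 0 + e" if "e > 0" for e
    proof -
      obtain \<phi> \<phi>a \<phi>t \<phi>xx where ct: "ctest A ad T \<phi> \<phi>a \<phi>t \<phi>xx" and
        D: "(\<integral>y. (w y - L0 \<phi> \<phi>a \<phi>t \<phi>xx y)\<^sup>2 \<partial>M) < e / 2"
        using L0_dense[OF w, of "e/2"] \<open>e > 0\<close> by auto
      let ?l = "L0 \<phi> \<phi>a \<phi>t \<phi>xx" and ?p = "P \<phi>"
      note c = ctest_cont[OF ct]
      have i: "integrable M (\<lambda>y. (w y)\<^sup>2)" "integrable M (\<lambda>y. (?l y)\<^sup>2)" "integrable M (\<lambda>y. (?p y)\<^sup>2)"
         "integrable M (\<lambda>y. w y * ?l y)" "integrable M (\<lambda>y. w y * ?p y)"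
        using sqint_integrable_square[OF w] sqint_integrable_square[OF sq_L0[OF ct]] sqint_integrable_square[OF sq_P[OF c]]
          sqint_mult[OF w sq_L0[OF ct]] sqint_mult[OF w sq_P[OF c]] by auto
      have "(\<lambda>y. L \<phi> \<phi>a \<phi>t \<phi>xx y) \<in> V" unfolding V_def using ct by blast
      from orth[OF this] have "(\<integral>y. w y * L \<phi> \<phi>a \<phi>t \<phi>xx y \<partial>M) = 0" .
      then have z: "(\<integral>y. w y * ?l y \<partial>M) + (\<integral>y. w y * ?p y \<partial>M) = 0"
        using i by (simp add: distrib_left)
      have "(\<integral>y. (w y - ?l y)\<^sup>2 \<partial>M) = (\<integral>y. (w y)\<^sup>2 - 2 * (w y * ?l y) + (?l y)\<^sup>2 \<partial>M)"
        by (rule Bochner_Integration.integral_cong) (auto simp: power2_eq_square algebra_simps)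
      also have "\<dots> = W - 2 * (\<integral>y. w y * ?l y \<partial>M) + (\<integral>y. (?l y)\<^sup>2 \<partial>M)"
        using i by (simp add: W_def)
      finally have dd: "(\<integral>y. (w y - ?l y)\<^sup>2 \<partial>M) = W - 2 * (\<integral>y. w y * ?l y \<partial>M) + (\<integral>y. (?l y)\<^sup>2 \<partial>M)" .

      have pw': "(\<integral>y. w y * ?p y \<partial>M) \<ge> - (W / 4 + (\<integral>y. (?p y)\<^sup>2 \<partial>M))"
      proof -
        have "(\<integral>y. - ((w y)\<^sup>2 / 4 + (?p y)\<^sup>2) \<partial>M) \<le> (\<integral>y. w y * ?p y \<partial>M)"
        proof (rule integral_mono)
          show "- ((w y)\<^sup>2 / 4 + (?p y)\<^sup>2) \<le> w y * ?p y" for y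
            using sum_squares_bound[of "- w y / 2" "?p y"] by (simp add: power_divide)
        qed (use i in auto)
        then show ?thesis using i by (simp add: W_def)
      qed
      have L0n: "0 \<le> (\<integral>y. (?l y)\<^sup>2 \<partial>M)" by simp
      show ?thesis using dd D z pw' P_small[OF ct] L0n by linarith
    qed
    then have "W \<le> 0" by (rule field_le_epsilon)
    then have "W = 0" unfolding W_def by (intro antisym) simp_all
    then show "AE y in M. w y = 0"
      using integral_nonneg_eq_0_iff_AE[OF sqint_integrable_square[OF w]] by (simp add: W_def)
  qed
  then show ?thesis unfolding V_def by auto
qed

text \<open>The functional \<open>err\<close> accounts for the offspring of ages beyond \<open>A\<close>, which the truncated problem does not see.\<close>

lemma dual_positivity:
  assumes r: "sqint M r" and psi: "sqint M \<psi>" "AE y in M. 0 \<le> \<psi> y"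
    and r0: "sqint (leb ({0<..<A} \<times> {0<..<24})) r0" "AE z in leb ({0<..<A} \<times> {0<..<24}). 0 \<le> r0 z"
    and g: "sqint M g" "AE y in M. 0 \<le> g y"
    and kap: "\<kappa> \<ge> 0"
    and eq: "\<And>\<phi> \<phi>a \<phi>t \<phi>xx. ctest A ad T \<phi> \<phi>a \<phi>t \<phi>xx \<Longrightarrow>
       (\<integral>y. r y * L \<phi> \<phi>a \<phi>t \<phi>xx y \<partial>M) = (\<integral>z. r0 z * \<phi> (fst z, 0, snd z) \<partial>leb ({0<..<A} \<times> {0<..<24}))
         + (\<integral>y. g y * \<phi> y \<partial>M) + err \<phi> \<and> (err \<phi>)\<^sup>2 \<le> \<kappa> * S0 \<phi>"
  shows "- sqrt (4 * \<kappa> * (\<integral>y. (\<psi> y)\<^sup>2 \<partial>M)) \<le> (\<integral>y. r y * \<psi> y \<partial>M)"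
proof -
  let ?B = "leb ({0<..<A} \<times> {0<..<24})"
  define R where "R = (\<integral>y. (r y)\<^sup>2 \<partial>M)"
  define R0 where "R0 = (\<integral>z. (r0 z)\<^sup>2 \<partial>?B)"
  define G where "G = (\<integral>y. (g y)\<^sup>2 \<partial>M)"
  define X where "X = (\<integral>y. (\<psi> y)\<^sup>2 \<partial>M)"
  have nn: "R \<ge> 0" "R0 \<ge> 0" "G \<ge> 0" "X \<ge> 0" by (simp_all add: R_def R0_def G_def X_def)
  have step: "- sqrt (R0 * e) - sqrt (G * e) - sqrt (\<kappa> * (4 * X + 4 * e)) - sqrt (R * e) \<le> (\<integral>y. r y * \<psi> y \<partial>M)" if "e > 0" for e
  proof -
    obtain \<phi> \<phi>a \<phi>t \<phi>xx where ct: "ctest A ad T \<phi> \<phi>a \<phi>t \<phi>xx" and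
        D: "(\<integral>y. (\<psi> y - L \<phi> \<phi>a \<phi>t \<phi>xx y)\<^sup>2 \<partial>M) < e"
      using L_dense[OF psi(1) \<open>e > 0\<close>] by (elim exE conjE) (rule that)
    let ?l = "\<lambda>y. L \<phi> \<phi>a \<phi>t \<phi>xx y"
    note c = ctest_cont[OF ct]
    define N where "N y = max 0 (- \<phi> y)" for y
    have cN: "continuous_on UNIV N" unfolding N_def by (intro continuous_intros c)
    have cz: "sqint ?B (\<lambda>z. f (fst z, 0, snd z))" if "continuous_on UNIV f" for f :: "real \<times> real \<times> real \<Rightarrow> real"
      by (rule sqint_leb_continuous, rule continuous_on_compose2[OF that]) (auto simp: rect_box intro!: continuous_intros)
    have sqd: "sqint M (\<lambda>y. \<psi> y - ?l y)" by (intro sqint_diff psi sq_L ct)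
    have [measurable]: "?l \<in> borel_measurable M" using sq_L[OF ct] by (simp add: sqint_def)
    have "(\<integral>y. (max 0 (- ?l y))\<^sup>2 \<partial>M) \<le> (\<integral>y. (\<psi> y - ?l y)\<^sup>2 \<partial>M)"
    proof (rule integral_mono_AE')
      show "AE y in M. (max 0 (- ?l y))\<^sup>2 \<le> (\<psi> y - ?l y)\<^sup>2"
        using psi(2)
      proof eventually_elim
        case (elim y)
        show ?case
        proof (cases "?l y \<ge> 0")
          case False
          then show ?thesis using elim by (auto simp: max_def intro!: power_mono)
        qed auto
      qed
    qed (use sqint_integrable_square[OF sqd] in auto)
    then have small: "S0 N / 2 + S1 N + (\<integral>y. (N y)\<^sup>2 \<partial>M) < e"
      using negpart_estimate[OF ct] D unfolding N_def by linarith
    have N1: "S1 N \<le> e" "(\<integral>y. (N y)\<^sup>2 \<partial>M) \<le> e"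
    proof -
      have "0 \<le> (\<integral>y. (N y)\<^sup>2 \<partial>M)" by simp
      then show "S1 N \<le> e" "(\<integral>y. (N y)\<^sup>2 \<partial>M) \<le> e" using small S0_nonneg[of N] S1_nonneg[of N] by linarith+
    qed
    have i0: "- sqrt (R0 * e) \<le> (\<integral>z. r0 z * \<phi> (fst z, 0, snd z) \<partial>?B)"
    proof (rule neg_sqrt_mult_le[where v="\<integral>z. r0 z * N (fst z, 0, snd z) \<partial>?B" and h'="S1 N"])
      have "(\<integral>z. - (r0 z * N (fst z, 0, snd z)) \<partial>?B) \<le> (\<integral>z. r0 z * \<phi> (fst z, 0, snd z) \<partial>?B)"
      proof (rule integral_mono_AE)
        show "AE z in ?B. - (r0 z * N (fst z, 0, snd z)) \<le> r0 z * \<phi> (fst z, 0, snd z)"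
          using r0(2)
        proof eventually_elim
          case (elim z)
          have "r0 z * - N (fst z, 0, snd z) \<le> r0 z * \<phi> (fst z, 0, snd z)"
            using elim by (intro mult_left_mono) (auto simp: N_def)
          then show ?case by simp
        qed
      qed (use sqint_mult[OF r0(1) cz[OF cN]] sqint_mult[OF r0(1) cz[OF c]] in auto)
      then show "- (\<integral>z. r0 z * N (fst z, 0, snd z) \<partial>?B) \<le> (\<integral>z. r0 z * \<phi> (fst z, 0, snd z) \<partial>?B)" by simp
      show "(\<integral>z. r0 z * N (fst z, 0, snd z) \<partial>?B)\<^sup>2 \<le> R0 * S1 N"
        using Cauchy_Schwarz_integral[OF r0(1) cz[OF cN]] by (simp add: R0_def S1_def)
    qed (use N1 nn in auto)
    have i1: "- sqrt (G * e) \<le> (\<integral>y. g y * \<phi> y \<partial>M)"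
    proof (rule neg_sqrt_mult_le[where v="\<integral>y. g y * N y \<partial>M" and h'="\<integral>y. (N y)\<^sup>2 \<partial>M"])
      have "(\<integral>y. - (g y * N y) \<partial>M) \<le> (\<integral>y. g y * \<phi> y \<partial>M)"
      proof (rule integral_mono_AE)
        show "AE y in M. - (g y * N y) \<le> g y * \<phi> y"
          using g(2)
        proof eventually_elim
          case (elim y)
          have "g y * - N y \<le> g y * \<phi> y" using elim by (intro mult_left_mono) (auto simp: N_def)
          then show ?case by simp
        qed
      qed (use sqint_mult[OF g(1) sq_cont[OF cN]] sqint_mult[OF g(1) sq_cont[OF c]] in auto)
      then show "- (\<integral>y. g y * N y \<partial>M) \<le> (\<integral>y. g y * \<phi> y \<partial>M)" by simp
      show "(\<integral>y. g y * N y \<partial>M)\<^sup>2 \<le> G * (\<integral>y. (N y)\<^sup>2 \<partial>M)"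
        using Cauchy_Schwarz_integral[OF g(1) sq_cont[OF cN]] by (simp add: G_def)
    qed (use N1 nn in auto)
    have i2: "- sqrt (\<kappa> * (4 * X + 4 * e)) \<le> err \<phi>"
    proof (rule neg_sqrt_mult_le[where v="- err \<phi>" and h'="S0 \<phi>"])
      show "(- err \<phi>)\<^sup>2 \<le> \<kappa> * S0 \<phi>" using eq[OF ct] by simp
      have "(\<integral>y. (?l y)\<^sup>2 \<partial>M) \<le> (\<integral>y. 2 * (\<psi> y)\<^sup>2 + 2 * (\<psi> y - ?l y)\<^sup>2 \<partial>M)"
      proof (rule integral_mono)
        show "(?l y)\<^sup>2 \<le> 2 * (\<psi> y)\<^sup>2 + 2 * (\<psi> y - ?l y)\<^sup>2" for y
          using norm_add_sq_le[of "\<psi> y" "- (\<psi> y - ?l y)"] by (simp add: power2_commute)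
      qed (use sqint_integrable_square[OF sqd] sqint_integrable_square[OF psi(1)] sqint_integrable_square[OF sq_L[OF ct]] in auto)
      also have "\<dots> = 2 * X + 2 * (\<integral>y. (\<psi> y - ?l y)\<^sup>2 \<partial>M)"
        using sqint_integrable_square[OF sqd] sqint_integrable_square[OF psi(1)] by (simp add: X_def)
      finally show "S0 \<phi> \<le> 4 * X + 4 * e" using trace_estimate[OF ct] D by linarith
    qed (use kap in auto)
    have i3: "- sqrt (R * e) \<le> (\<integral>y. r y * (\<psi> y - ?l y) \<partial>M)"
    proof (rule neg_sqrt_mult_le[where v="- (\<integral>y. r y * (\<psi> y - ?l y) \<partial>M)" and h'="\<integral>y. (\<psi> y - ?l y)\<^sup>2 \<partial>M"])
      show "(- (\<integral>y. r y * (\<psi> y - ?l y) \<partial>M))\<^sup>2 \<le> R * (\<integral>y. (\<psi> y - ?l y)\<^sup>2 \<partial>M)"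
        using Cauchy_Schwarz_integral[OF r sqd] by (simp add: R_def)
    qed (use D nn in auto)
    have "(\<integral>y. r y * \<psi> y \<partial>M) = (\<integral>y. r y * ?l y \<partial>M) + (\<integral>y. r y * (\<psi> y - ?l y) \<partial>M)"
      using sqint_mult[OF r sq_L[OF ct]] sqint_mult[OF r sqd]
      by (subst Bochner_Integration.integral_add[symmetric]) (simp_all add: algebra_simps)
    then show ?thesis using eq[OF ct] i0 i1 i2 i3 by linarith
  qed
  have "(\<lambda>n. - sqrt (R0 * inverse (real (Suc n))) - sqrt (G * inverse (real (Suc n))) - sqrt (\<kappa> * (4 * X + 4 * inverse (real (Suc n)))) - sqrt (R * inverse (real (Suc n))))
    \<longlonglongrightarrow> - sqrt (R0 * 0) - sqrt (G * 0) - sqrt (\<kappa> * (4 * X + 4 * 0)) - sqrt (R * 0)"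
    by (intro tendsto_intros LIMSEQ_inverse_real_of_nat)
  then have "- sqrt (R0 * 0) - sqrt (G * 0) - sqrt (\<kappa> * (4 * X + 4 * 0)) - sqrt (R * 0) \<le> (\<integral>y. r y * \<psi> y \<partial>M)"
    by (rule LIMSEQ_le_const2) (intro exI[of _ 0] allI impI step, simp)
  then show ?thesis by (simp add: X_def ac_simps)
qed

end

section \<open>Positivity of weak solutions\<close>

lemma AE_lborel_fst:
  assumes "AE a in (lborel :: 'a::euclidean_space measure). P a"
  shows "AE y in (lborel :: ('a \<times> 'b::euclidean_space) measure). P (fst y)"
proof -
  obtain N where N: "{a. \<not> P a} \<subseteq> N" "N \<in> null_sets lborel" using assms by (auto elim!: AE_E3 simp: eventually_ae_filter)
  have "N \<times> UNIV \<in> null_sets (lborel :: ('a \<times> 'b) measure)"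
  proof -
    have [measurable]: "N \<in> sets borel" using N(2) by auto
    have "emeasure (lborel \<Otimes>\<^sub>M (lborel :: 'b measure)) (N \<times> UNIV) = emeasure lborel N * emeasure lborel (UNIV :: 'b set)"
      by (rule lborel.emeasure_pair_measure_Times) auto
    then have "emeasure (lborel :: ('a \<times> 'b) measure) (N \<times> UNIV) = 0" using N(2) by (simp add: lborel_prod null_setsD1)
    moreover have "N \<times> (UNIV :: 'b set) \<in> sets borel" by (auto simp: borel_prod[symmetric])
    ultimately show ?thesis by auto
  qed
  then show ?thesis by (rule AE_I') (use N(1) in auto)
qed

lemma test_fun_mult_exp:
  assumes test: "test_fun ad T \<phi> \<phi>a \<phi>t \<phi>xx" and e: "\<And>s. (e has_real_derivative e' s) (at s)" "continuous_on UNIV e'"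
  shows "test_fun ad T (\<lambda>y. e (fst y) * exp (- lam * fst (snd y)) * \<phi> y)
     (\<lambda>y. exp (- lam * fst (snd y)) * (e' (fst y) * \<phi> y + e (fst y) * \<phi>a y))
     (\<lambda>y. e (fst y) * exp (- lam * fst (snd y)) * (\<phi>t y - lam * \<phi> y))
     (\<lambda>y. e (fst y) * exp (- lam * fst (snd y)) * \<phi>xx y)"
proof -
  note d = test_funD[OF test]
  obtain \<phi>x where p: "\<forall>a t x. ((\<lambda>z. \<phi> (a, t, z)) has_real_derivative \<phi>x (a, t, x)) (at x)"
     "\<forall>a t x. ((\<lambda>z. \<phi>x (a, t, z)) has_real_derivative \<phi>xx (a, t, x)) (at x)"
    using test_fun_x_deriv[OF test] by (elim exE conjE) (rule that)
  obtain e1 where e1: "e1 > 0" "\<forall>a t x. a \<ge> ad - e1 \<longrightarrow> \<phi> (a, t, x) = 0" using test_fun_vanish[OF test] by (elim exE conjE) (rule that)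
  have ce: "continuous_on UNIV e" by (rule DERIV_continuous_on, rule has_field_derivative_at_within, rule e)
  have c1: "continuous_on UNIV (\<lambda>y::real \<times> real \<times> real. e (fst y))" "continuous_on UNIV (\<lambda>y::real \<times> real \<times> real. e' (fst y))"
    by (rule continuous_on_compose2[OF ce] continuous_on_compose2[OF e(2)]; auto intro!: continuous_intros)+
  have c2: "continuous_on UNIV (\<lambda>y::real \<times> real \<times> real. exp (- lam * fst (snd y)))" by (intro continuous_intros)
  show ?thesis unfolding test_fun_def
  proof (intro conjI allI)
    show "\<exists>\<epsilon>>0. \<forall>a t x. ad - \<epsilon> \<le> a \<longrightarrow> e (fst (a, t, x)) * exp (- lam * fst (snd (a, t, x))) * \<phi> (a, t, x) = 0"
      using e1 by (intro exI[of _ e1]) auto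
    show "\<exists>\<phi>'x. (\<forall>a t x. ((\<lambda>z. e (fst (a, t, z)) * exp (- lam * fst (snd (a, t, z))) * \<phi> (a, t, z)) has_real_derivative \<phi>'x (a, t, x)) (at x)) \<and>
          (\<forall>a t x. ((\<lambda>z. \<phi>'x (a, t, z)) has_real_derivative e (fst (a, t, x)) * exp (- lam * fst (snd (a, t, x))) * \<phi>xx (a, t, x)) (at x))"
      using p by (intro exI[of _ "\<lambda>y. e (fst y) * exp (- lam * fst (snd y)) * \<phi>x y"] conjI allI) (simp_all add: DERIV_cmult)
    show "((\<lambda>b. e (fst (b, t, x)) * exp (- lam * fst (snd (b, t, x))) * \<phi> (b, t, x)) has_real_derivative
        exp (- lam * fst (snd (a, t, x))) * (e' (fst (a, t, x)) * \<phi> (a, t, x) + e (fst (a, t, x)) * \<phi>a (a, t, x))) (at a)" for a t x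
    proof -
      have "((\<lambda>b. exp (- lam * t) * (e b * \<phi> (b, t, x))) has_real_derivative
        exp (- lam * t) * (e' a * \<phi> (a, t, x) + \<phi>a (a, t, x) * e a)) (at a)"
        by (rule DERIV_cmult[OF DERIV_mult[OF e(1) d(5)]])
      then show ?thesis by (simp add: ac_simps)
    qed
    show "((\<lambda>s. e (fst (a, s, x)) * exp (- lam * fst (snd (a, s, x))) * \<phi> (a, s, x)) has_real_derivative
        e (fst (a, t, x)) * exp (- lam * fst (snd (a, t, x))) * (\<phi>t (a, t, x) - lam * \<phi> (a, t, x))) (at t)" for a t x
    proof -
      have "((\<lambda>s. exp (- lam * s)) has_real_derivative exp (- lam * t) * - lam) (at t)"
        by (auto intro!: derivative_eq_intros)
      from DERIV_cmult[OF DERIV_mult[OF this d(6)[of a x t]], of "e a"]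
      show ?thesis by (simp add: algebra_simps)
    qed
    show "e (fst (a, t, x + 24)) * exp (- lam * fst (snd (a, t, x + 24))) * \<phi> (a, t, x + 24)
       = e (fst (a, t, x)) * exp (- lam * fst (snd (a, t, x))) * \<phi> (a, t, x)" for a t x by (simp add: d(7))
    show "e (fst (a, T, x)) * exp (- lam * fst (snd (a, T, x))) * \<phi> (a, T, x) = 0" for a x by (simp add: d(8))
  qed (intro continuous_on_mult continuous_on_add continuous_on_diff c1 c2 d(1-4) continuous_on_mult_left)+
qed

definition wsol where
  "wsol ad T \<delta> \<eta> \<mu> \<beta> u w w0 f \<longleftrightarrow> sqint (leb (QQ ad T)) w \<and>
   (\<forall>\<phi> \<phi>a \<phi>t \<phi>xx. test_fun ad T \<phi> \<phi>a \<phi>t \<phi>xx \<longrightarrow>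
      integrable (leb (QQ ad T)) (\<lambda>y. \<mu> (fst y) * w y * \<phi> y) \<and>
      (\<integral>y. w y * (- \<phi>a y - \<phi>t y - \<delta> * \<phi>xx y + \<mu> (fst y) * \<phi> y - u y * \<phi> y - \<beta> (fst y) * KT \<eta> \<phi> y) \<partial>leb (QQ ad T))
      = (\<integral>z. w0 z * \<phi> (fst z, 0, snd z) \<partial>leb ({0<..<ad} \<times> {0<..<24})) + (\<integral>y. f y * \<phi> y \<partial>leb (QQ ad T)))"

lemma wsolD:
  assumes "wsol ad T \<delta> \<eta> \<mu> \<beta> u w w0 f"
  shows "sqint (leb (QQ ad T)) w"
    "test_fun ad T \<phi> \<phi>a \<phi>t \<phi>xx \<Longrightarrow> integrable (leb (QQ ad T)) (\<lambda>y. \<mu> (fst y) * w y * \<phi> y)"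
    "test_fun ad T \<phi> \<phi>a \<phi>t \<phi>xx \<Longrightarrow>
      (\<integral>y. w y * (- \<phi>a y - \<phi>t y - \<delta> * \<phi>xx y + \<mu> (fst y) * \<phi> y - u y * \<phi> y - \<beta> (fst y) * KT \<eta> \<phi> y) \<partial>leb (QQ ad T))
      = (\<integral>z. w0 z * \<phi> (fst z, 0, snd z) \<partial>leb ({0<..<ad} \<times> {0<..<24})) + (\<integral>y. f y * \<phi> y \<partial>leb (QQ ad T))"
  using assms by (simp_all add: wsol_def)

lemma continuous_approx_bounded:
  fixes g :: "real \<Rightarrow> real"
  assumes "g \<in> borel_measurable borel" "AE s in lborel. 0 \<le> g s \<and> g s \<le> C"
  shows "\<exists>h. (\<forall>n. continuous_on UNIV (h n)) \<and> (\<forall>n s. 0 \<le> h n s \<and> h n s \<le> max 0 C) \<and> (AE s in lborel. (\<lambda>n::nat. h n s) \<longlonglongrightarrow> g s)"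
proof -
  have "g measurable_on UNIV"
    by (rule lebesgue_measurable_imp_measurable_on) (use assms(1) in \<open>auto intro: measurable_completion\<close>)
  then obtain N k where N: "negligible N" and k: "\<And>n::nat. continuous_on UNIV (k n)" "\<And>s. s \<notin> N \<Longrightarrow> (\<lambda>n. k n s) \<longlonglongrightarrow> g s"
    unfolding measurable_on_def by auto
  have "AE s in lebesgue. s \<notin> N" using N by (auto simp: negligible_iff_null_sets intro: AE_not_in)
  then have aeN: "AE s in lborel. s \<notin> N" by (simp add: AE_completion_iff)
  have "AE s in lborel. (\<lambda>n. max 0 (min C (k n s))) \<longlonglongrightarrow> g s"
    using aeN assms(2)
  proof eventually_elim
    case (elim s)
    have "(\<lambda>n. max 0 (min C (k n s))) \<longlonglongrightarrow> max 0 (min C (g s))" by (intro tendsto_intros k elim)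
    then show ?case using elim by simp
  qed
  then show ?thesis
    by (intro exI[of _ "\<lambda>n s. max 0 (min C (k n s))"] conjI allI continuous_intros k) auto
qed

lemma antiderivative_integral:
  fixes g :: "real \<Rightarrow> real"
  assumes "continuous_on UNIV g"
  shows "\<exists>G. (\<forall>s. (G has_real_derivative g s) (at s)) \<and>
     (\<forall>a. G a = (\<integral>s. indicator {A<..<a} s * g s \<partial>lborel) - (\<integral>s. indicator {a<..<A} s * g s \<partial>lborel))"
proof -
  have "\<exists>F. \<forall>x. -\<infinity> < ereal x \<longrightarrow> ereal x < \<infinity> \<longrightarrow> (F has_vector_derivative g x) (at x)"
    using assms by (intro einterval_antiderivative) (auto simp: continuous_on_eq_continuous_at)
  then obtain F where F: "\<And>s. (F has_real_derivative g s) (at s)"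
    by (auto simp: has_real_derivative_iff_has_vector_derivative)
  have ftc: "(\<integral>s. indicator {p<..<q} s * g s \<partial>lborel) = F q - F p" if "p \<le> q" for p q
  proof -
    have "(g has_integral F q - F p) {p..q}"
      by (rule fundamental_theorem_of_calculus[OF that])
         (simp add: has_real_derivative_iff_has_vector_derivative[symmetric] has_field_derivative_at_within F)
    moreover have "(\<integral>s. indicator {p<..<q} s * g s \<partial>lborel) = integral {p..q} g"
      using integral_leb_box[OF assms, of p q] by (simp add: integral_leb_eq set_lebesgue_integral_def box_real)
    ultimately show ?thesis by (simp add: integral_unique)
  qed
  have empty: "(\<integral>s. indicator {p<..<q} s * g s \<partial>lborel) = 0" if "q \<le> p" for p q
    using that by simp
  have "F a - F A = (\<integral>s. indicator {A<..<a} s * g s \<partial>lborel) - (\<integral>s. indicator {a<..<A} s * g s \<partial>lborel)" for a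
    using ftc[of A a] ftc[of a A] empty[of a A] empty[of A a] by (cases "a \<le> A") auto
  moreover have "((\<lambda>s. F s - F A) has_real_derivative g s) (at s)" for s
    using DERIV_diff[OF F DERIV_const] by simp
  ultimately show ?thesis by (intro exI[of _ "\<lambda>s. F s - F A"]) simp
qed

lemma rect_sets[simp, measurable]: "{0<..<a} \<times> {0<..<b} \<in> sets (borel :: (real \<times> real) measure)" by (simp add: rect_box)

lemma sqint_leb_subset:
  assumes "sqint (leb S) f" "R \<subseteq> S" "R \<in> sets borel" "S \<in> sets borel" "f \<in> borel_measurable borel"
  shows "sqint (leb R) (f :: 'a::euclidean_space \<Rightarrow> real)"
proof -
  have "set_integrable lborel S (\<lambda>y. (f y)\<^sup>2)" using sqint_integrable_square[OF assms(1)] assms by (simp add: integrable_leb_iff)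
  then have "set_integrable lborel R (\<lambda>y. (f y)\<^sup>2)" by (rule set_integrable_subset) (use assms in auto)
  then show ?thesis using assms by (auto simp: sqint_def integrable_leb_iff)
qed

lemma QQ_fst: "y \<in> QQ A T \<Longrightarrow> 0 < fst y \<and> fst y < A \<and> 0 < fst (snd y)"
  by (auto simp: QQ_def)

lemma integrable_indicator_Ioo[simp]: "integrable lborel (indicator {a<..<A::real} :: real \<Rightarrow> real)"
  using emeasure_bounded_finite[of "{a<..<A}"] by (intro integrable_real_indicator) auto

lemma abs_lincomb_le:
  fixes p q k a b c d D :: real
  assumes "\<bar>p\<bar> \<le> k" "\<bar>q\<bar> \<le> k" "\<bar>d\<bar> \<le> D"
  shows "\<bar>p * (a + b - d) - q * c\<bar> \<le> k * (\<bar>a\<bar> + \<bar>b\<bar> + D + \<bar>c\<bar>)"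
proof -
  have k: "k \<ge> 0" using assms(1) by linarith
  have "\<bar>p * (a + b - d)\<bar> \<le> k * (\<bar>a\<bar> + \<bar>b\<bar> + D)"
    unfolding abs_mult using assms by (intro mult_mono) (auto simp: k)
  moreover have "\<bar>q * c\<bar> \<le> k * \<bar>c\<bar>" unfolding abs_mult using assms(2) by (rule mult_right_mono) simp
  ultimately show ?thesis unfolding distrib_left using abs_triangle_ineq4[of "p * (a + b - d)" "q * c"] by linarith
qed

locale weak_problem =
  fixes ad T \<delta> \<eta> Cb Cu :: real and \<mu> \<beta> :: "real \<Rightarrow> real" and u :: "real \<times> real \<times> real \<Rightarrow> real"
  assumes pos: "0 < ad" "0 < T" "0 < \<delta>"
    and mu_meas[measurable]: "\<mu> \<in> borel_measurable borel"
    and mu_loc: "\<And>c d. 0 < c \<Longrightarrow> d < ad \<Longrightarrow> \<exists>C. AE a in lborel. a \<in> {c..d} \<longrightarrow> \<bar>\<mu> a\<bar> \<le> C"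
    and mu_nn: "AE a in lborel. a \<in> {0<..<ad} \<longrightarrow> 0 \<le> \<mu> a"
    and beta_meas[measurable]: "\<beta> \<in> borel_measurable borel"
    and beta: "AE a in lborel. a \<in> {0<..<ad} \<longrightarrow> 0 \<le> \<beta> a \<and> \<beta> a \<le> Cb"
    and u_meas[measurable]: "u \<in> borel_measurable borel"
    and u: "AE y in leb (QQ ad T). - Cu \<le> u y \<and> u y \<le> 0" and Cu: "Cu \<ge> 0"
begin

definition E where "E A a = exp (- (\<integral>s. indicator {a<..<A} s * \<mu> s \<partial>lborel))" for A a :: real

lemma E_measurable[measurable]: "E A \<in> borel_measurable borel"
proof -
  have "(\<lambda>(a::real, s::real). indicator {a<..<A} s * \<mu> s) = (\<lambda>z. if fst z < snd z \<and> snd z < A then \<mu> (snd z) else 0)"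
    by (auto simp: indicator_def fun_eq_iff)
  moreover have "(\<lambda>z :: real \<times> real. if fst z < snd z \<and> snd z < A then \<mu> (snd z) else 0) \<in> borel_measurable (borel \<Otimes>\<^sub>M lborel)"
    by measurable
  ultimately have "(\<lambda>a. \<integral>s. indicator {a<..<A} s * \<mu> s \<partial>lborel) \<in> borel_measurable borel"
    by (intro lborel.borel_measurable_lebesgue_integral) simp
  then show ?thesis unfolding E_def[abs_def] by measurable
qed

lemma mu_interval_integrable:
  assumes "0 < a" "A < ad" shows "integrable lborel (\<lambda>s. indicator {a<..<A} s * \<mu> s)"
proof -
  obtain C where C: "AE s in lborel. s \<in> {a..A} \<longrightarrow> \<bar>\<mu> s\<bar> \<le> C" using mu_loc[OF assms] by blast
  have "integrable lborel (\<lambda>s. C * indicator {a<..<A} s)" by simp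
  then show ?thesis
    by (rule Bochner_Integration.integrable_bound) (use C in \<open>auto elim!: eventually_mono simp: indicator_def\<close>)
qed

lemma mu_ind_nonneg:
  assumes "0 < a" "A < ad" shows "AE s in lborel. 0 \<le> indicator {a<..<A} s * \<mu> s"
  using mu_nn by eventually_elim (use assms in \<open>auto simp: indicator_def\<close>)

lemma E_bounds: assumes "0 < a" "A < ad" shows "0 < E A a" "E A a \<le> 1"
  using integral_nonneg_AE[OF mu_ind_nonneg[OF assms]] by (auto simp: E_def)

lemma E_mono:
  assumes "0 < a" "a \<le> a'" "A < ad" shows "E A a \<le> E A a'"
proof -
  have "(\<integral>s. indicator {a'<..<A} s * \<mu> s \<partial>lborel) \<le> (\<integral>s. indicator {a<..<A} s * \<mu> s \<partial>lborel)"
  proof (rule integral_mono_AE)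
    show "AE s in lborel. indicator {a'<..<A} s * \<mu> s \<le> indicator {a<..<A} s * \<mu> s"
      using mu_nn by eventually_elim (use assms in \<open>auto simp: indicator_def\<close>)
  qed (use assms in \<open>auto intro!: mu_interval_integrable\<close>)
  then show ?thesis by (simp add: E_def)
qed

lemma fst_AE: "AE a in lborel. Q a \<Longrightarrow> AE y in leb (QQ A T'). Q (fst y)"
  unfolding AE_leb_iff[OF QQ_sets] using AE_lborel_fst[of Q] by (auto elim: eventually_mono)

lemma beta_abs: "AE y in leb (QQ ad T). \<bar>\<beta> (fst y)\<bar> \<le> Cb"
proof -
  have "AE y in leb (QQ ad T). fst y \<in> {0<..<ad} \<longrightarrow> 0 \<le> \<beta> (fst y) \<and> \<beta> (fst y) \<le> Cb" by (rule fst_AE[OF beta])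
  moreover have "AE y in leb (QQ ad T). y \<in> QQ ad T" unfolding AE_leb_iff[OF QQ_sets] by simp
  ultimately show ?thesis by eventually_elim (auto dest: QQ_fst)
qed

text \<open>Since \<open>\<mu>\<close> need not be integrable at \<open>0\<close>, the factor is frozen below age \<open>\<rho>\<close>.\<close>

lemma wsol_integrating_factor_truncated:
  fixes lam :: real
  assumes A: "0 < A" "A < ad" and rho: "0 < \<rho>" and ct: "ctest A ad T \<phi> \<phi>a \<phi>t \<phi>xx"
    and ws: "wsol ad T \<delta> \<eta> \<mu> \<beta> u w w0 f" and wm: "w0 \<in> borel_measurable borel"
    and sw0: "sqint (leb ({0<..<ad} \<times> {0<..<24})) w0" and sf: "sqint (leb (QQ ad T)) f"
  defines "X \<equiv> \<lambda>y. - \<phi>a y - \<phi>t y - \<delta> * \<phi>xx y + lam * \<phi> y - u y * \<phi> y"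
  shows "(\<integral>y. w y * (E A (max (fst y) \<rho>) * exp (- lam * fst (snd y)) * (X y + (\<mu> (fst y) - indicator {\<rho><..<A} (fst y) * \<mu> (fst y)) * \<phi> y)
             - E A \<rho> * exp (- lam * fst (snd y)) * (\<beta> (fst y) * KT \<eta> \<phi> y)) \<partial>leb (QQ ad T))
     = (\<integral>z. w0 z * (E A (max (fst z) \<rho>) * \<phi> (fst z, 0, snd z)) \<partial>leb ({0<..<ad} \<times> {0<..<24}))
       + (\<integral>y. f y * (E A (max (fst y) \<rho>) * exp (- lam * fst (snd y)) * \<phi> y) \<partial>leb (QQ ad T))"
proof -
  let ?M = "leb (QQ ad T)" and ?B = "leb ({0<..<ad} \<times> {0<..<24::real})"
  have test: "test_fun ad T \<phi> \<phi>a \<phi>t \<phi>xx" using ct by (simp add: ctest_def)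
  note d = test_funD[OF test]
  have sw: "sqint ?M w" using ws by (simp add: wsol_def)
  have wme: "w \<in> borel_measurable ?M" using sw by (simp add: sqint_def)
  have [measurable]: "w \<in> borel_measurable ?M" "f \<in> borel_measurable ?M" "w0 \<in> borel_measurable ?B"
    using sw sf sw0 by (auto simp: sqint_def)
  have [measurable]: "\<phi> \<in> borel_measurable borel" "\<phi>a \<in> borel_measurable borel" "\<phi>t \<in> borel_measurable borel" "\<phi>xx \<in> borel_measurable borel"
    by (rule borel_measurable_continuous_onI, rule d)+
  have Xm[measurable]: "X \<in> borel_measurable borel" unfolding X_def by measurable
  obtain C where C: "AE s in lborel. s \<in> {\<rho>..A} \<longrightarrow> \<bar>\<mu> s\<bar> \<le> C" using mu_loc[OF rho A(2)] by blast
  define g where "g s = indicator {\<rho><..<A} s * \<mu> s" for s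
  have gm[measurable]: "g \<in> borel_measurable borel" unfolding g_def by measurable
  define C' where "C' = max 0 C"
  have "AE s in lborel. 0 \<le> g s \<and> g s \<le> C'"
    using C mu_nn by eventually_elim (use rho A in \<open>auto simp: g_def indicator_def C'_def\<close>)
  from continuous_approx_bounded[OF gm this] obtain h where
    h: "\<And>n::nat. continuous_on UNIV (h n)" "\<And>n s. 0 \<le> h n s \<and> h n s \<le> C'" "AE s in lborel. (\<lambda>n. h n s) \<longlonglongrightarrow> g s"
    by (auto simp: C'_def)
  have [measurable]: "h n \<in> borel_measurable borel" for n by (rule borel_measurable_continuous_onI[OF h(1)])
  have "\<forall>n. \<exists>G. (\<forall>s. (G has_real_derivative h n s) (at s)) \<and>
     (\<forall>a. G a = (\<integral>s. indicator {A<..<a} s * h n s \<partial>lborel) - (\<integral>s. indicator {a<..<A} s * h n s \<partial>lborel))"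
    by (intro allI antiderivative_integral h)
  then obtain G where G: "\<And>n s. (G n has_real_derivative h n s) (at s)"
     "\<And>n a. G n a = (\<integral>s. indicator {A<..<a} s * h n s \<partial>lborel) - (\<integral>s. indicator {a<..<A} s * h n s \<partial>lborel)"
    unfolding choice_iff by blast
  define e where "e n a = exp (G n a)" for n a
  have de: "(e n has_real_derivative h n s * e n s) (at s)" for n s
    using DERIV_fun_exp[OF G(1)[of n s]] by (simp add: e_def[abs_def] mult.commute)
  have ce: "continuous_on UNIV (e n)" for n by (rule DERIV_continuous_on, rule has_field_derivative_at_within, rule de)
  have ce': "continuous_on UNIV (\<lambda>s. h n s * e n s)" for n by (intro continuous_on_mult h ce)
  have [measurable]: "e n \<in> borel_measurable borel" for n by (rule borel_measurable_continuous_onI[OF ce])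
  define K where "K = exp (C' * ad)"
  have C'0: "C' \<ge> 0" by (simp add: C'_def)
  have ebd: "\<bar>e n a\<bar> \<le> K" if "0 \<le> a" "a \<le> ad" for n a
  proof -
    have "(\<integral>s. indicator {A<..<a} s * h n s \<partial>lborel) \<le> (\<integral>s. C' * indicator {0<..<ad} s \<partial>lborel)"
    proof (rule integral_mono_AE')
      show "AE s in lborel. indicator {A<..<a} s * h n s \<le> C' * indicator {0<..<ad} s"
        using h(2)[of n] that A C'0 by (intro AE_I2) (auto simp: indicator_def)
    qed (use C'0 in auto)
    also have "\<dots> = C' * ad" using pos by simp
    finally have "(\<integral>s. indicator {A<..<a} s * h n s \<partial>lborel) \<le> C' * ad" .
    moreover have "0 \<le> (\<integral>s. indicator {a<..<A} s * h n s \<partial>lborel)"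
      using h(2)[of n] by (intro integral_nonneg_AE) auto
    ultimately show ?thesis by (simp add: e_def K_def G(2))
  qed
  have elim_e: "(\<lambda>n. e n a) \<longlonglongrightarrow> E A (max a \<rho>)" if "0 \<le> a" "a \<le> ad" for a
  proof -
    have dc: "(\<lambda>n. \<integral>s. indicator {p<..<q} s * h n s \<partial>lborel) \<longlonglongrightarrow> (\<integral>s. indicator {p<..<q} s * g s \<partial>lborel)" for p q
    proof (rule integral_dominated_convergence[where w="\<lambda>s. C' * indicator {p<..<q} s"])
      show "AE s in lborel. (\<lambda>n. indicator {p<..<q} s * h n s) \<longlonglongrightarrow> indicator {p<..<q} s * g s"
        using h(3) by eventually_elim (intro tendsto_intros)
      show "AE s in lborel. norm (indicator {p<..<q} s * h n s) \<le> C' * indicator {p<..<q} s" for n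
        using h(2)[of n] by (intro AE_I2) (auto simp: indicator_def)
    qed auto
    have "(\<lambda>s. indicator {A<..<a} s * g s) = (\<lambda>s. 0)" by (auto simp: g_def indicator_def)
    then have z: "(\<integral>s. indicator {A<..<a} s * g s \<partial>lborel) = 0" by simp
    have m: "(\<lambda>s. indicator {a<..<A} s * g s) = (\<lambda>s. indicator {max a \<rho><..<A} s * \<mu> s)"
      by (auto simp: g_def indicator_def)
    have "(\<lambda>n. exp (G n a)) \<longlonglongrightarrow> exp (0 - (\<integral>s. indicator {max a \<rho><..<A} s * \<mu> s \<partial>lborel))"
      unfolding G(2) using dc[of A a] dc[of a A] unfolding z m by (intro tendsto_intros)
    then show ?thesis by (simp add: e_def E_def)
  qed
  define \<epsilon> where "\<epsilon> y = exp (- lam * fst (snd y))" for y :: "real \<times> real \<times> real"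
  have ce2: "continuous_on UNIV \<epsilon>" unfolding \<epsilon>_def by (intro continuous_intros)
  have [measurable]: "\<epsilon> \<in> borel_measurable borel" by (rule borel_measurable_continuous_onI[OF ce2])
  define K2 where "K2 = exp (\<bar>lam\<bar> * T)"
  have eps: "0 < \<epsilon> y \<and> \<epsilon> y \<le> K2" if "y \<in> QQ ad T" for y
  proof -
    have t: "0 < fst (snd y)" "fst (snd y) < T" using that by (auto simp: QQ_def)
    have "- lam * fst (snd y) \<le> \<bar>lam\<bar> * fst (snd y)" using t by (intro mult_right_mono) auto
    also have "\<dots> \<le> \<bar>lam\<bar> * T" using t by (intro mult_left_mono) auto
    finally show ?thesis by (simp add: \<epsilon>_def K2_def)
  qed
  define Fn where "Fn n y = w y * (e n (fst y) * \<epsilon> y * (X y + (\<mu> (fst y) - h n (fst y)) * \<phi> y) - e n 0 * \<epsilon> y * (\<beta> (fst y) * KT \<eta> \<phi> y))" for n y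
  define F where "F y = w y * (E A (max (fst y) \<rho>) * \<epsilon> y * (X y + (\<mu> (fst y) - g (fst y)) * \<phi> y) - E A \<rho> * \<epsilon> y * (\<beta> (fst y) * KT \<eta> \<phi> y))" for y
  have eqn: "(\<integral>y. Fn n y \<partial>?M) = (\<integral>z. w0 z * (e n (fst z) * \<phi> (fst z, 0, snd z)) \<partial>?B) + (\<integral>y. f y * (e n (fst y) * \<epsilon> y * \<phi> y) \<partial>?M)" for n
  proof -
    have tm: "test_fun ad T (\<lambda>y. e n (fst y) * exp (- lam * fst (snd y)) * \<phi> y)
     (\<lambda>y. exp (- lam * fst (snd y)) * (h n (fst y) * e n (fst y) * \<phi> y + e n (fst y) * \<phi>a y))
     (\<lambda>y. e n (fst y) * exp (- lam * fst (snd y)) * (\<phi>t y - lam * \<phi> y))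
     (\<lambda>y. e n (fst y) * exp (- lam * fst (snd y)) * \<phi>xx y)"
      by (rule test_fun_mult_exp[OF test de ce'])
    have kt: "KT \<eta> (\<lambda>y. e n (fst y) * exp (- lam * fst (snd y)) * \<phi> y) y = e n 0 * \<epsilon> y * KT \<eta> \<phi> y" for y
      unfolding KT_def \<epsilon>_def
      by (subst integral_mult_right_zero[symmetric]) (simp add: ac_simps)
    have "(\<integral>y. Fn n y \<partial>?M) = (\<integral>y. w y * (- (exp (- lam * fst (snd y)) * (h n (fst y) * e n (fst y) * \<phi> y + e n (fst y) * \<phi>a y))
       - e n (fst y) * exp (- lam * fst (snd y)) * (\<phi>t y - lam * \<phi> y) - \<delta> * (e n (fst y) * exp (- lam * fst (snd y)) * \<phi>xx y)
       + \<mu> (fst y) * (e n (fst y) * exp (- lam * fst (snd y)) * \<phi> y) - u y * (e n (fst y) * exp (- lam * fst (snd y)) * \<phi> y)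
       - \<beta> (fst y) * KT \<eta> (\<lambda>y. e n (fst y) * exp (- lam * fst (snd y)) * \<phi> y) y) \<partial>?M)"
      unfolding kt by (rule Bochner_Integration.integral_cong) (simp_all add: Fn_def X_def \<epsilon>_def algebra_simps)
    also have "\<dots> = (\<integral>z. w0 z * (e n (fst z) * \<phi> (fst z, 0, snd z)) \<partial>?B)
       + (\<integral>y. f y * (e n (fst y) * exp (- lam * fst (snd y)) * \<phi> y) \<partial>?M)"
      using wsolD(3)[OF ws tm] by (simp only: fst_conv snd_conv mult_zero_right exp_zero mult_1_right)
    finally show ?thesis by (simp add: \<epsilon>_def)
  qed
  have sX: "sqint ?M X"
  proof -
    have "sqint ?M (\<lambda>y. u y * \<phi> y)"
    proof (rule sqint_bounded_mult[where C=Cu])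
      show "sqint ?M \<phi>" by (rule sqint_leb_continuous[OF d(1)]) (auto simp: QQ_box)
      show "AE y in ?M. \<bar>u y\<bar> \<le> Cu" using u by eventually_elim auto
    qed measurable
    moreover have "sqint ?M (\<lambda>y. - \<phi>a y - \<phi>t y - \<delta> * \<phi>xx y + lam * \<phi> y)"
      by (rule sqint_leb_continuous) (auto simp: QQ_box intro!: continuous_intros d)
    ultimately show ?thesis unfolding X_def by (rule sqint_diff[rotated])
  qed
  have sphi: "sqint ?M \<phi>" by (rule sqint_leb_continuous[OF d(1)]) (auto simp: QQ_box)
  have skt: "sqint ?M (\<lambda>y. \<beta> (fst y) * KT \<eta> \<phi> y)"
    by (rule KT_L2_bound(1)[OF d(1) beta_meas beta_abs pos(1,2)])
  have imu: "integrable ?M (\<lambda>y. \<mu> (fst y) * w y * \<phi> y)" by (rule wsolD(2)[OF ws test])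
  have hQ: "AE y in ?M. (\<lambda>n. h n (fst y)) \<longlonglongrightarrow> g (fst y)" by (rule fst_AE[OF h(3)])
  have inQ: "AE y in ?M. y \<in> QQ ad T" unfolding AE_leb_iff[OF QQ_sets] by simp
  have K0: "K \<ge> 0" "K2 \<ge> 0" by (auto simp: K_def K2_def)
  have lim1: "(\<lambda>n. \<integral>y. Fn n y \<partial>?M) \<longlonglongrightarrow> (\<integral>y. F y \<partial>?M)"
  proof (rule integral_dominated_convergence[where w="\<lambda>y. K * K2 * (\<bar>w y * X y\<bar> + \<bar>\<mu> (fst y) * w y * \<phi> y\<bar> + C' * \<bar>w y * \<phi> y\<bar> + \<bar>w y * (\<beta> (fst y) * KT \<eta> \<phi> y)\<bar>)"])
    show "integrable ?M (\<lambda>y. K * K2 * (\<bar>w y * X y\<bar> + \<bar>\<mu> (fst y) * w y * \<phi> y\<bar> + C' * \<bar>w y * \<phi> y\<bar> + \<bar>w y * (\<beta> (fst y) * KT \<eta> \<phi> y)\<bar>))"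
      using sqint_mult[OF sw sX] sqint_mult[OF sw sphi] sqint_mult[OF sw skt] imu
      by (intro integrable_mult_right Bochner_Integration.integrable_add integrable_abs)
    show "AE y in ?M. (\<lambda>n. Fn n y) \<longlonglongrightarrow> F y"
      using hQ inQ
    proof eventually_elim
      case (elim y)
      have a: "0 \<le> fst y" "fst y \<le> ad" using QQ_fst[OF elim(2)] by auto
      have "(\<lambda>n. e n 0) \<longlonglongrightarrow> E A \<rho>" using elim_e[of 0] rho pos by (simp add: max_def)
      then show ?case unfolding Fn_def F_def by (intro tendsto_intros elim_e a elim(1))
    qed
    show "AE y in ?M. norm (Fn n y) \<le> K * K2 * (\<bar>w y * X y\<bar> + \<bar>\<mu> (fst y) * w y * \<phi> y\<bar> + C' * \<bar>w y * \<phi> y\<bar> + \<bar>w y * (\<beta> (fst y) * KT \<eta> \<phi> y)\<bar>)" for n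
      using inQ
    proof eventually_elim
      case (elim y)
      have a: "0 \<le> fst y" "fst y \<le> ad" using QQ_fst[OF elim] by auto
      have ke: "\<bar>e n s * \<epsilon> y\<bar> \<le> K * K2" if "0 \<le> s" "s \<le> ad" for s
        unfolding abs_mult using ebd[OF that, of n] eps[OF elim] by (intro mult_mono) auto
      have h1: "\<bar>h n (fst y) * (w y * \<phi> y)\<bar> \<le> C' * \<bar>w y * \<phi> y\<bar>"
        unfolding abs_mult[of "h n (fst y)"] using h(2)[of n "fst y"] by (intro mult_right_mono) auto
      have eqF: "Fn n y = (e n (fst y) * \<epsilon> y) * (w y * X y + \<mu> (fst y) * w y * \<phi> y - h n (fst y) * (w y * \<phi> y)) - (e n 0 * \<epsilon> y) * (w y * (\<beta> (fst y) * KT \<eta> \<phi> y))"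
        by (simp add: Fn_def algebra_simps)
      show ?case unfolding real_norm_def eqF
        by (rule abs_lincomb_le[OF ke[OF a] ke[OF order_refl less_imp_le[OF pos(1)]] h1])
    qed
    have kt: "KT \<eta> \<phi> \<in> borel_measurable borel" by (rule KT_measurable) measurable
    have "(\<lambda>y. e n (fst y) * \<epsilon> y * (X y + (\<mu> (fst y) - h n (fst y)) * \<phi> y) - e n 0 * \<epsilon> y * (\<beta> (fst y) * KT \<eta> \<phi> y)) \<in> borel_measurable borel" for n
      using kt by measurable
    from borel_measurable_times[OF wme measurable_leb[OF this]] show "Fn n \<in> borel_measurable ?M" for n
      unfolding Fn_def[abs_def] .
    have "(\<lambda>y. E A (max (fst y) \<rho>) * \<epsilon> y * (X y + (\<mu> (fst y) - g (fst y)) * \<phi> y) - E A \<rho> * \<epsilon> y * (\<beta> (fst y) * KT \<eta> \<phi> y)) \<in> borel_measurable borel"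
      using kt by measurable
    from borel_measurable_times[OF wme measurable_leb[OF this]] show "F \<in> borel_measurable ?M"
      unfolding F_def[abs_def] .
  qed
  have phi0: "sqint ?B (\<lambda>z. \<phi> (fst z, 0, snd z))"
    by (rule sqint_leb_continuous, rule continuous_on_compose2[OF d(1)]) (auto simp: rect_box intro!: continuous_intros)
  have inB: "AE z in ?B. z \<in> {0<..<ad} \<times> {0<..<24}" unfolding AE_leb_iff[OF rect_sets] by simp
  have lim2: "(\<lambda>n. \<integral>z. w0 z * (e n (fst z) * \<phi> (fst z, 0, snd z)) \<partial>?B) \<longlonglongrightarrow> (\<integral>z. w0 z * (E A (max (fst z) \<rho>) * \<phi> (fst z, 0, snd z)) \<partial>?B)"
  proof (rule integral_dominated_convergence[where w="\<lambda>z. K * \<bar>w0 z * \<phi> (fst z, 0, snd z)\<bar>"])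
    show "integrable ?B (\<lambda>z. K * \<bar>w0 z * \<phi> (fst z, 0, snd z)\<bar>)"
      by (intro integrable_mult_right integrable_abs sqint_mult sw0 phi0)
    show "AE z in ?B. (\<lambda>n. w0 z * (e n (fst z) * \<phi> (fst z, 0, snd z))) \<longlonglongrightarrow> w0 z * (E A (max (fst z) \<rho>) * \<phi> (fst z, 0, snd z))"
      using inB by eventually_elim (intro tendsto_intros elim_e; auto)
    show "AE z in ?B. norm (w0 z * (e n (fst z) * \<phi> (fst z, 0, snd z))) \<le> K * \<bar>w0 z * \<phi> (fst z, 0, snd z)\<bar>" for n
      using inB
    proof eventually_elim
      case (elim z)
      have "\<bar>e n (fst z)\<bar> * \<bar>w0 z * \<phi> (fst z, 0, snd z)\<bar> \<le> K * \<bar>w0 z * \<phi> (fst z, 0, snd z)\<bar>"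
        using elim by (intro mult_right_mono ebd) auto
      then show ?case by (simp add: abs_mult ac_simps)
    qed
  qed measurable
  have lim3: "(\<lambda>n. \<integral>y. f y * (e n (fst y) * \<epsilon> y * \<phi> y) \<partial>?M) \<longlonglongrightarrow> (\<integral>y. f y * (E A (max (fst y) \<rho>) * \<epsilon> y * \<phi> y) \<partial>?M)"
  proof (rule integral_dominated_convergence[where w="\<lambda>y. K * K2 * \<bar>f y * \<phi> y\<bar>"])
    show "integrable ?M (\<lambda>y. K * K2 * \<bar>f y * \<phi> y\<bar>)"
      by (intro integrable_mult_right integrable_abs sqint_mult sf sphi)
    show "AE y in ?M. (\<lambda>n. f y * (e n (fst y) * \<epsilon> y * \<phi> y)) \<longlonglongrightarrow> f y * (E A (max (fst y) \<rho>) * \<epsilon> y * \<phi> y)"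
      using inQ by eventually_elim (intro tendsto_intros elim_e; force dest: QQ_fst)
    show "AE y in ?M. norm (f y * (e n (fst y) * \<epsilon> y * \<phi> y)) \<le> K * K2 * \<bar>f y * \<phi> y\<bar>" for n
      using inQ
    proof eventually_elim
      case (elim y)
      have "\<bar>e n (fst y)\<bar> * \<bar>\<epsilon> y\<bar> \<le> K * K2"
        using ebd[of "fst y" n] QQ_fst[OF elim] eps[OF elim] K0 by (intro mult_mono) auto
      then have "(\<bar>e n (fst y)\<bar> * \<bar>\<epsilon> y\<bar>) * \<bar>f y * \<phi> y\<bar> \<le> K * K2 * \<bar>f y * \<phi> y\<bar>" by (rule mult_right_mono) simp
      then show ?case by (simp add: abs_mult ac_simps)
    qed
  qed measurable
  have "(\<integral>y. F y \<partial>?M) = (\<integral>z. w0 z * (E A (max (fst z) \<rho>) * \<phi> (fst z, 0, snd z)) \<partial>?B) + (\<integral>y. f y * (E A (max (fst y) \<rho>) * \<epsilon> y * \<phi> y) \<partial>?M)"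
    by (rule LIMSEQ_unique[OF lim1]) (unfold eqn, rule tendsto_add[OF lim2 lim3])
  then show ?thesis unfolding F_def g_def \<epsilon>_def by simp
qed

end

lemma integral_leb_restrict:
  fixes h :: "'a::euclidean_space \<Rightarrow> real"
  assumes "R \<subseteq> S" "R \<in> sets borel" "S \<in> sets borel" "\<And>y. y \<in> S - R \<Longrightarrow> h y = 0"
  shows "integral\<^sup>L (leb S) h = integral\<^sup>L (leb R) h"
  unfolding integral_leb_eq[OF assms(2)] integral_leb_eq[OF assms(3)] set_lebesgue_integral_def
  by (rule Bochner_Integration.integral_cong) (use assms in \<open>auto simp: indicator_def\<close>)

lemma AE_leb_subset:
  assumes "AE y in leb S. P y" "R \<subseteq> S" "R \<in> sets borel" "S \<in> sets borel"
  shows "AE y in leb R. P y"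
  using assms by (auto simp: AE_leb_iff elim: eventually_mono)

lemma QQ_mono: "A \<le> ad \<Longrightarrow> QQ A T \<subseteq> QQ ad T" by (auto simp: QQ_def)

lemma integral_QQ_restrict:
  fixes h :: "real \<times> real \<times> real \<Rightarrow> real"
  assumes "A \<le> ad" "\<And>y. y \<in> QQ ad T \<Longrightarrow> A \<le> fst y \<Longrightarrow> h y = 0"
  shows "integral\<^sup>L (leb (QQ ad T)) h = integral\<^sup>L (leb (QQ A T)) h"
proof (rule integral_leb_restrict[OF QQ_mono[OF assms(1)] QQ_sets QQ_sets])
  fix y assume "y \<in> QQ ad T - QQ A T"
  then show "h y = 0" by (intro assms(2)) (auto simp: QQ_def)
qed

context weak_problem begin

text \<open>\<open>E0\<close> is the limit of \<open>E A a\<close> as \<open>a\<close> tends to \<open>0\<close>; it is \<open>0\<close> when \<open>\<mu>\<close> is not integrable there.\<close>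

lemma wsol_integrating_factor:
  fixes lam :: real
  assumes A: "0 < A" "A < ad"
    and ws: "wsol ad T \<delta> \<eta> \<mu> \<beta> u w w0 f" and wm: "w0 \<in> borel_measurable borel"
    and sw0: "sqint (leb ({0<..<ad} \<times> {0<..<24})) w0" and sf: "sqint (leb (QQ ad T)) f"
  shows "\<exists>E0. 0 \<le> E0 \<and> (\<forall>a>0. E0 \<le> E A a) \<and> (\<forall>\<phi> \<phi>a \<phi>t \<phi>xx. ctest A ad T \<phi> \<phi>a \<phi>t \<phi>xx \<longrightarrow>
    (\<integral>y. w y * (E A (fst y) * exp (- lam * fst (snd y)) * (- \<phi>a y - \<phi>t y - \<delta> * \<phi>xx y + lam * \<phi> y - u y * \<phi> y)
             - E0 * exp (- lam * fst (snd y)) * (\<beta> (fst y) * KT \<eta> \<phi> y)) \<partial>leb (QQ ad T))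
     = (\<integral>z. w0 z * (E A (fst z) * \<phi> (fst z, 0, snd z)) \<partial>leb ({0<..<ad} \<times> {0<..<24}))
       + (\<integral>y. f y * (E A (fst y) * exp (- lam * fst (snd y)) * \<phi> y) \<partial>leb (QQ ad T)))"
proof -
  let ?M = "leb (QQ ad T)" and ?B = "leb ({0<..<ad} \<times> {0<..<24::real})"
  define r where "r n = inverse (real (Suc n))" for n
  have r0: "r n > 0" for n by (simp add: r_def)
  have rev: "eventually (\<lambda>n. r n < a) sequentially" if "a > 0" for a
    using LIMSEQ_inverse_real_of_nat that unfolding r_def by (intro order_tendstoD(2)) auto
  have dec: "decseq (\<lambda>n. E A (r n))"
    unfolding decseq_def by (intro allI impI E_mono r0 A) (simp add: r_def)
  have "\<forall>n. 0 \<le> E A (r n)"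
  proof
    fix n show "0 \<le> E A (r n)" using E_bounds(1)[OF r0[of n] A(2)] by simp
  qed
  from decseq_convergent[OF dec this]
  obtain E0 where E0: "(\<lambda>n. E A (r n)) \<longlonglongrightarrow> E0" "\<forall>n. E0 \<le> E A (r n)" .
  have E0n: "0 \<le> E0"
    using E0(1) by (rule LIMSEQ_le_const) (use E_bounds(1)[OF r0 A(2)] in \<open>auto intro: less_imp_le\<close>)
  have E0le: "E0 \<le> E A a" if a0: "a > 0" for a
  proof -
    obtain n where n: "r n < a" using rev[OF a0] by (auto simp: eventually_sequentially)
    show ?thesis using E0(2)[rule_format, of n] E_mono[OF r0[of n] less_imp_le[OF n] A(2)] by linarith
  qed
  have sw: "sqint ?M w" by (rule wsolD(1)[OF ws])
  have wme: "w \<in> borel_measurable ?M" "f \<in> borel_measurable ?M" "w0 \<in> borel_measurable ?B"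
    using sw sf sw0 by (auto simp: sqint_def)
  have inQ: "AE y in ?M. y \<in> QQ ad T" unfolding AE_leb_iff[OF QQ_sets] by simp
  have inB: "AE z in ?B. z \<in> {0<..<ad} \<times> {0<..<24}" unfolding AE_leb_iff[OF rect_sets] by simp
  have Elim: "(\<lambda>n. E A (max a (r n))) \<longlonglongrightarrow> E A a" if "a > 0" for a
  proof (rule tendsto_eventually)
    show "eventually (\<lambda>n. E A (max a (r n)) = E A a) sequentially"
      using rev[OF that] by eventually_elim (simp add: max_def)
  qed
  have Ebd: "\<bar>E A (max a (r n))\<bar> \<le> 1" for a n
  proof -
    have "0 < max a (r n)" using r0[of n] by (simp add: less_max_iff_disj)
    from E_bounds[OF this A(2)] show ?thesis by simp
  qed
  define \<epsilon> where "\<epsilon> y = exp (- lam * fst (snd y))" for y :: "real \<times> real \<times> real"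
  have [measurable]: "\<epsilon> \<in> borel_measurable borel" unfolding \<epsilon>_def by measurable
  define K2 where "K2 = exp (\<bar>lam\<bar> * T)"
  have eps: "0 < \<epsilon> y \<and> \<epsilon> y \<le> K2" if "y \<in> QQ ad T" for y
  proof -
    have t: "0 < fst (snd y)" "fst (snd y) < T" using that by (auto simp: QQ_def)
    have "- lam * fst (snd y) \<le> \<bar>lam\<bar> * fst (snd y)" using t by (intro mult_right_mono) auto
    also have "\<dots> \<le> \<bar>lam\<bar> * T" using t by (intro mult_left_mono) auto
    finally show ?thesis by (simp add: \<epsilon>_def K2_def)
  qed
  have ke: "\<bar>E A (max a (r n)) * \<epsilon> y\<bar> \<le> K2" if "y \<in> QQ ad T" for a n y
    unfolding abs_mult using mult_mono[OF Ebd[of a n], of "\<bar>\<epsilon> y\<bar>" K2] eps[OF that] by auto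
  have ke0: "\<bar>E A (r n) * \<epsilon> y\<bar> \<le> K2" if "y \<in> QQ ad T" for n y
    using ke[OF that, of 0 n] r0[of n] by (simp add: max_def)
  have main: "(\<integral>y. w y * (E A (fst y) * \<epsilon> y * (- \<phi>a y - \<phi>t y - \<delta> * \<phi>xx y + lam * \<phi> y - u y * \<phi> y)
             - E0 * \<epsilon> y * (\<beta> (fst y) * KT \<eta> \<phi> y)) \<partial>?M)
     = (\<integral>z. w0 z * (E A (fst z) * \<phi> (fst z, 0, snd z)) \<partial>?B) + (\<integral>y. f y * (E A (fst y) * \<epsilon> y * \<phi> y) \<partial>?M)"
    if ct: "ctest A ad T \<phi> \<phi>a \<phi>t \<phi>xx" for \<phi> \<phi>a \<phi>t \<phi>xx
  proof -
    have test: "test_fun ad T \<phi> \<phi>a \<phi>t \<phi>xx" using ct by (simp add: ctest_def)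
    note d = test_funD[OF test]
    have [measurable]: "\<phi> \<in> borel_measurable borel" "\<phi>a \<in> borel_measurable borel" "\<phi>t \<in> borel_measurable borel" "\<phi>xx \<in> borel_measurable borel"
      by (rule borel_measurable_continuous_onI, rule d)+
    define X where "X y = - \<phi>a y - \<phi>t y - \<delta> * \<phi>xx y + lam * \<phi> y - u y * \<phi> y" for y
    have Xm[measurable]: "X \<in> borel_measurable borel" unfolding X_def by measurable
    have sphi: "sqint ?M \<phi>" by (rule sqint_leb_continuous[OF d(1)]) (auto simp: QQ_box)
    have sX: "sqint ?M X"
    proof -
      have "sqint ?M (\<lambda>y. u y * \<phi> y)"
        by (rule sqint_bounded_mult[where C=Cu, OF sphi]) (use u in \<open>auto elim: eventually_mono\<close>)
      moreover have "sqint ?M (\<lambda>y. - \<phi>a y - \<phi>t y - \<delta> * \<phi>xx y + lam * \<phi> y)"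
        by (rule sqint_leb_continuous) (auto simp: QQ_box intro!: continuous_intros d)
      ultimately show ?thesis unfolding X_def by (rule sqint_diff[rotated])
    qed
    have skt: "sqint ?M (\<lambda>y. \<beta> (fst y) * KT \<eta> \<phi> y)"
      by (rule KT_L2_bound(1)[OF d(1) beta_meas beta_abs pos(1,2)])
    have imu: "integrable ?M (\<lambda>y. \<mu> (fst y) * w y * \<phi> y)" by (rule wsolD(2)[OF ws test])
    have kt: "KT \<eta> \<phi> \<in> borel_measurable borel" by (rule KT_measurable) measurable
    have phi0: "sqint ?B (\<lambda>z. \<phi> (fst z, 0, snd z))"
      by (rule sqint_leb_continuous, rule continuous_on_compose2[OF d(1)]) (auto simp: rect_box intro!: continuous_intros)
    define m where "m n a = \<mu> a - indicator {r n<..<A} a * \<mu> a" for n a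
    have [measurable]: "m n \<in> borel_measurable borel" for n unfolding m_def by measurable
    define Fn where "Fn n y = w y * (E A (max (fst y) (r n)) * \<epsilon> y * (X y + m n (fst y) * \<phi> y) - E A (r n) * \<epsilon> y * (\<beta> (fst y) * KT \<eta> \<phi> y))" for n y
    define F where "F y = w y * (E A (fst y) * \<epsilon> y * X y - E0 * \<epsilon> y * (\<beta> (fst y) * KT \<eta> \<phi> y))" for y
    have eqn: "(\<integral>y. Fn n y \<partial>?M) = (\<integral>z. w0 z * (E A (max (fst z) (r n)) * \<phi> (fst z, 0, snd z)) \<partial>?B) + (\<integral>y. f y * (E A (max (fst y) (r n)) * \<epsilon> y * \<phi> y) \<partial>?M)" for n
      using wsol_integrating_factor_truncated[OF A r0[of n] ct ws wm sw0 sf, of lam] unfolding Fn_def X_def \<epsilon>_def m_def .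
    have lim1: "(\<lambda>n. \<integral>y. Fn n y \<partial>?M) \<longlonglongrightarrow> (\<integral>y. F y \<partial>?M)"
    proof (rule integral_dominated_convergence[where w="\<lambda>y. K2 * (\<bar>w y * X y\<bar> + \<bar>\<mu> (fst y) * w y * \<phi> y\<bar> + 0 + \<bar>w y * (\<beta> (fst y) * KT \<eta> \<phi> y)\<bar>)"])
      show "integrable ?M (\<lambda>y. K2 * (\<bar>w y * X y\<bar> + \<bar>\<mu> (fst y) * w y * \<phi> y\<bar> + 0 + \<bar>w y * (\<beta> (fst y) * KT \<eta> \<phi> y)\<bar>))"
        using sqint_mult[OF sw sX] sqint_mult[OF sw skt] imu
        by (intro integrable_mult_right Bochner_Integration.integrable_add integrable_abs integrable_zero)
      show "AE y in ?M. (\<lambda>n. Fn n y) \<longlonglongrightarrow> F y"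
        using inQ
      proof eventually_elim
        case (elim y)
        have a: "0 < fst y" using QQ_fst[OF elim] by auto
        have "(\<lambda>n. m n (fst y) * \<phi> y) \<longlonglongrightarrow> 0"
        proof (rule tendsto_eventually)
          show "eventually (\<lambda>n. m n (fst y) * \<phi> y = 0) sequentially"
            using rev[OF a]
          proof eventually_elim
            case (elim n)
            show ?case
            proof (cases "fst y < A")
              case True then show ?thesis using elim by (simp add: m_def)
            next
              case False then show ?thesis using ct by (cases y) (auto simp: ctest_def)
            qed
          qed
        qed
        then have "(\<lambda>n. Fn n y) \<longlonglongrightarrow> w y * (E A (fst y) * \<epsilon> y * (X y + 0) - E0 * \<epsilon> y * (\<beta> (fst y) * KT \<eta> \<phi> y))"
          unfolding Fn_def by (intro tendsto_intros Elim a E0(1))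
        then show ?case by (simp add: F_def)
      qed
      show "AE y in ?M. norm (Fn n y) \<le> K2 * (\<bar>w y * X y\<bar> + \<bar>\<mu> (fst y) * w y * \<phi> y\<bar> + 0 + \<bar>w y * (\<beta> (fst y) * KT \<eta> \<phi> y)\<bar>)" for n
        using inQ
      proof eventually_elim
        case (elim y)
        have eqF: "Fn n y = (E A (max (fst y) (r n)) * \<epsilon> y) * (w y * X y + m n (fst y) * w y * \<phi> y - 0) - (E A (r n) * \<epsilon> y) * (w y * (\<beta> (fst y) * KT \<eta> \<phi> y))"
          by (simp add: Fn_def algebra_simps)
        have "\<bar>Fn n y\<bar> \<le> K2 * (\<bar>w y * X y\<bar> + \<bar>m n (fst y) * w y * \<phi> y\<bar> + 0 + \<bar>w y * (\<beta> (fst y) * KT \<eta> \<phi> y)\<bar>)"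
          unfolding eqF by (rule abs_lincomb_le[OF ke[OF elim] ke0[OF elim]]) simp
        also have "\<dots> \<le> K2 * (\<bar>w y * X y\<bar> + \<bar>\<mu> (fst y) * w y * \<phi> y\<bar> + 0 + \<bar>w y * (\<beta> (fst y) * KT \<eta> \<phi> y)\<bar>)"
        proof -
          have "\<bar>m n (fst y)\<bar> \<le> \<bar>\<mu> (fst y)\<bar>" by (auto simp: m_def indicator_def)
          then have "\<bar>m n (fst y) * w y * \<phi> y\<bar> \<le> \<bar>\<mu> (fst y) * w y * \<phi> y\<bar>" by (simp add: abs_mult mult_right_mono)
          then show ?thesis by (intro mult_left_mono) (auto simp: K2_def)
        qed
        finally show ?case by simp
      qed
      have "(\<lambda>y. E A (max (fst y) (r n)) * \<epsilon> y * (X y + m n (fst y) * \<phi> y) - E A (r n) * \<epsilon> y * (\<beta> (fst y) * KT \<eta> \<phi> y)) \<in> borel_measurable borel" for n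
        using kt by measurable
      from borel_measurable_times[OF wme(1) measurable_leb[OF this]] show "Fn n \<in> borel_measurable ?M" for n
        unfolding Fn_def[abs_def] .
      have "(\<lambda>y. E A (fst y) * \<epsilon> y * X y - E0 * \<epsilon> y * (\<beta> (fst y) * KT \<eta> \<phi> y)) \<in> borel_measurable borel"
        using kt by measurable
      from borel_measurable_times[OF wme(1) measurable_leb[OF this]] show "F \<in> borel_measurable ?M"
        unfolding F_def[abs_def] .
    qed
    have lim2: "(\<lambda>n. \<integral>z. w0 z * (E A (max (fst z) (r n)) * \<phi> (fst z, 0, snd z)) \<partial>?B) \<longlonglongrightarrow> (\<integral>z. w0 z * (E A (fst z) * \<phi> (fst z, 0, snd z)) \<partial>?B)"
    proof (rule integral_dominated_convergence[where w="\<lambda>z. \<bar>w0 z * \<phi> (fst z, 0, snd z)\<bar>"])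
      show "integrable ?B (\<lambda>z. \<bar>w0 z * \<phi> (fst z, 0, snd z)\<bar>)"
        by (intro integrable_abs sqint_mult sw0 phi0)
      show "AE z in ?B. (\<lambda>n. w0 z * (E A (max (fst z) (r n)) * \<phi> (fst z, 0, snd z))) \<longlonglongrightarrow> w0 z * (E A (fst z) * \<phi> (fst z, 0, snd z))"
        using inB by eventually_elim (intro tendsto_intros Elim; auto)
      show "AE z in ?B. norm (w0 z * (E A (max (fst z) (r n)) * \<phi> (fst z, 0, snd z))) \<le> \<bar>w0 z * \<phi> (fst z, 0, snd z)\<bar>" for n
      proof (rule AE_I2)
        fix z :: "real \<times> real"
        have "\<bar>E A (max (fst z) (r n))\<bar> * \<bar>w0 z * \<phi> (fst z, 0, snd z)\<bar> \<le> 1 * \<bar>w0 z * \<phi> (fst z, 0, snd z)\<bar>"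
          by (intro mult_right_mono Ebd) auto
        then show "norm (w0 z * (E A (max (fst z) (r n)) * \<phi> (fst z, 0, snd z))) \<le> \<bar>w0 z * \<phi> (fst z, 0, snd z)\<bar>"
          by (simp add: abs_mult ac_simps)
      qed
    qed (use wm in measurable)
    have lim3: "(\<lambda>n. \<integral>y. f y * (E A (max (fst y) (r n)) * \<epsilon> y * \<phi> y) \<partial>?M) \<longlonglongrightarrow> (\<integral>y. f y * (E A (fst y) * \<epsilon> y * \<phi> y) \<partial>?M)"
    proof (rule integral_dominated_convergence[where w="\<lambda>y. K2 * \<bar>f y * \<phi> y\<bar>"])
      show "integrable ?M (\<lambda>y. K2 * \<bar>f y * \<phi> y\<bar>)"
        by (intro integrable_mult_right integrable_abs sqint_mult sf sphi)
      show "AE y in ?M. (\<lambda>n. f y * (E A (max (fst y) (r n)) * \<epsilon> y * \<phi> y)) \<longlonglongrightarrow> f y * (E A (fst y) * \<epsilon> y * \<phi> y)"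
        using inQ by eventually_elim (intro tendsto_intros Elim; force dest: QQ_fst)
      show "AE y in ?M. norm (f y * (E A (max (fst y) (r n)) * \<epsilon> y * \<phi> y)) \<le> K2 * \<bar>f y * \<phi> y\<bar>" for n
        using inQ
      proof eventually_elim
        case (elim y)
        have "\<bar>E A (max (fst y) (r n)) * \<epsilon> y\<bar> * \<bar>f y * \<phi> y\<bar> \<le> K2 * \<bar>f y * \<phi> y\<bar>" by (intro mult_right_mono ke elim) simp
        then show ?case by (simp add: abs_mult ac_simps)
      qed
      have "(\<lambda>y. E A (max (fst y) (r n)) * \<epsilon> y * \<phi> y) \<in> borel_measurable borel" for n by measurable
      from borel_measurable_times[OF wme(2) measurable_leb[OF this]]
      show "(\<lambda>y. f y * (E A (max (fst y) (r n)) * \<epsilon> y * \<phi> y)) \<in> borel_measurable ?M" for n .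
      have "(\<lambda>y. E A (fst y) * \<epsilon> y * \<phi> y) \<in> borel_measurable borel" by measurable
      from borel_measurable_times[OF wme(2) measurable_leb[OF this]]
      show "(\<lambda>y. f y * (E A (fst y) * \<epsilon> y * \<phi> y)) \<in> borel_measurable ?M" .
    qed
    have "(\<integral>y. F y \<partial>?M) = (\<integral>z. w0 z * (E A (fst z) * \<phi> (fst z, 0, snd z)) \<partial>?B) + (\<integral>y. f y * (E A (fst y) * \<epsilon> y * \<phi> y) \<partial>?M)"
      by (rule LIMSEQ_unique[OF lim1]) (unfold eqn, rule tendsto_add[OF lim2 lim3])
    then show ?thesis unfolding F_def X_def .
  qed
  show ?thesis by (rule exI[of _ E0], intro conjI allI impI, rule E0n, erule E0le, erule main[unfolded \<epsilon>_def])
qed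

lemma weak_solution_nonneg:
  assumes ws: "wsol ad T \<delta> \<eta> \<mu> \<beta> u w w0 f"
    and wm[measurable]: "w \<in> borel_measurable borel" and w0m[measurable]: "w0 \<in> borel_measurable borel" and fm[measurable]: "f \<in> borel_measurable borel"
    and sw0: "sqint (leb ({0<..<ad} \<times> {0<..<24})) w0" and sf: "sqint (leb (QQ ad T)) f"
    and w0n: "AE z in leb ({0<..<ad} \<times> {0<..<24}). 0 \<le> w0 z" and fn: "AE y in leb (QQ ad T). 0 \<le> f y"
  shows "AE y in leb (QQ ad T). 0 \<le> w y"
proof -
  let ?M = "leb (QQ ad T)"
  note wpos = pos
  define lam where "lam = 8 * (1152 * Cb\<^sup>2 * ad + 1) + 4 * Cu"
  have lam0: "lam > 0"
  proof -
    have "0 \<le> 1152 * Cb\<^sup>2 * ad" using pos by simp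
    then have "0 < 8 * (1152 * Cb\<^sup>2 * ad + 1)" by (intro mult_pos_pos add_nonneg_pos) auto
    then show ?thesis unfolding lam_def using Cu by linarith
  qed
  have sw: "sqint ?M w" by (rule wsolD(1)[OF ws])
  define \<epsilon> where "\<epsilon> y = exp (- lam * fst (snd y))" for y :: "real \<times> real \<times> real"
  have em[measurable]: "\<epsilon> \<in> borel_measurable borel" unfolding \<epsilon>_def by measurable
  have ep: "0 < \<epsilon> y" for y by (simp add: \<epsilon>_def)
  have e1: "\<epsilon> y \<le> 1" if "y \<in> QQ B T" for y B using QQ_fst[OF that] lam0 by (simp add: \<epsilon>_def)
  define v where "v y = max 0 (- w y)" for y
  have vm[measurable]: "v \<in> borel_measurable borel" unfolding v_def by measurable
  have v0: "0 \<le> v y" for y by (simp add: v_def)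
  have wv: "w y * v y = - (v y)\<^sup>2" for y by (auto simp: v_def max_def power2_eq_square)
  have sv: "sqint ?M v"
    by (rule sqintI[OF _ sqint_integrable_square[OF sw]]) (auto simp: v_def intro!: AE_I2 max0_sq_le)
  define W where "W = (\<integral>y. (w y)\<^sup>2 \<partial>?M)"
  define \<Omega> where "\<Omega> A = (\<integral>y. (indicator {A..} (fst y) * w y)\<^sup>2 \<partial>?M)" for A :: real
  define c where "c = 576 * Cb\<^sup>2 * ad"
  have c0: "c \<ge> 0" using pos by (simp add: c_def)
  have W0: "W \<ge> 0" by (simp add: W_def)
  have O0: "\<Omega> A \<ge> 0" for A by (simp add: \<Omega>_def)
  have key: "(\<integral>y. \<epsilon> y * (v y)\<^sup>2 \<partial>leb (QQ A T)) \<le> 2 * sqrt (c * \<Omega> A * W)" if A: "0 < A" "A < ad" for A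
  proof -
    let ?Q = "leb (QQ A T)" and ?B = "leb ({0<..<A} \<times> {0<..<24::real})"
    have sub: "QQ A T \<subseteq> QQ ad T" using A by (intro QQ_mono) simp
    have subB: "{0<..<A} \<times> {0<..<24::real} \<subseteq> {0<..<ad} \<times> {0<..<24}" using A by auto
    obtain E0 where E0: "0 \<le> E0" "\<forall>a>0. E0 \<le> E A a" and red: "\<forall>\<phi> \<phi>a \<phi>t \<phi>xx. ctest A ad T \<phi> \<phi>a \<phi>t \<phi>xx \<longrightarrow>
      (\<integral>y. w y * (E A (fst y) * exp (- lam * fst (snd y)) * (- \<phi>a y - \<phi>t y - \<delta> * \<phi>xx y + lam * \<phi> y - u y * \<phi> y)
             - E0 * exp (- lam * fst (snd y)) * (\<beta> (fst y) * KT \<eta> \<phi> y)) \<partial>?M)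
       = (\<integral>z. w0 z * (E A (fst z) * \<phi> (fst z, 0, snd z)) \<partial>leb ({0<..<ad} \<times> {0<..<24}))
         + (\<integral>y. f y * (E A (fst y) * exp (- lam * fst (snd y)) * \<phi> y) \<partial>?M)"
      using wsol_integrating_factor[OF A ws w0m sw0 sf, of lam] by (elim exE conjE) (rule that)
    have inQ: "AE y in ?Q. y \<in> QQ A T" unfolding AE_leb_iff[OF QQ_sets] by simp
    define \<gamma> where "\<gamma> a = E0 * \<beta> a / E A a" for a
    have gm: "\<gamma> \<in> borel_measurable borel" unfolding \<gamma>_def by measurable
    have Eb: "0 < E A (fst y)" "E A (fst y) \<le> 1" "E0 \<le> E A (fst y)" if "y \<in> QQ A T" for y
      using QQ_fst[OF that] E_bounds[of "fst y" A] A E0(2) by auto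
    interpret dual_problem A ad T \<delta> \<eta> Cb Cu lam u \<gamma>
    proof
      show "AE y in ?Q. - Cu \<le> u y \<and> u y \<le> 0" by (rule AE_leb_subset[OF u sub]) auto
      show "AE y in ?Q. 0 \<le> \<gamma> (fst y) \<and> \<gamma> (fst y) \<le> Cb"
        using fst_AE[OF beta, of A T] inQ
      proof eventually_elim
        case (elim y)
        have b: "0 \<le> \<beta> (fst y)" "\<beta> (fst y) \<le> Cb" using elim QQ_fst[OF elim(2)] A by auto
        have "E0 * \<beta> (fst y) \<le> E A (fst y) * Cb" using b E0(1) Eb[OF elim(2)] by (intro mult_mono) auto
        then show ?case using b E0(1) Eb(1)[OF elim(2)] by (simp add: \<gamma>_def field_simps)
      qed
      have "1152 * Cb\<^sup>2 * A \<le> 1152 * Cb\<^sup>2 * ad" using A by (intro mult_left_mono) auto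
      then show "8 * (1152 * Cb\<^sup>2 * A + 1) + 4 * Cu \<le> lam" unfolding lam_def by simp
    qed (use A pos Cu gm in auto)
    define r where "r y = E A (fst y) * \<epsilon> y * w y" for y
    define r0 where "r0 z = E A (fst z) * w0 z" for z :: "real \<times> real"
    define g where "g y = E A (fst y) * \<epsilon> y * f y" for y
    define err where "err \<phi> = E0 * (\<integral>y. (indicator {A..} (fst y) * w y * \<epsilon> y) * (\<beta> (fst y) * KT \<eta> \<phi> y) \<partial>?M)" for \<phi>
    define \<kappa> where "\<kappa> = E0\<^sup>2 * (c * \<Omega> A)"
    have swQ: "sqint ?Q w" by (rule sqint_leb_subset[OF sw sub _ _ wm]) auto
    have svQ: "sqint ?Q v" by (rule sqint_leb_subset[OF sv sub _ _ vm]) auto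
    have sfQ: "sqint ?Q f" by (rule sqint_leb_subset[OF sf sub _ _ fm]) auto
    have sw0B: "sqint ?B w0" by (rule sqint_leb_subset[OF sw0 subB _ _ w0m]) auto
    have Ee: "AE y in ?Q. \<bar>E A (fst y) * \<epsilon> y\<bar> \<le> 1"
      using inQ
    proof eventually_elim
      case (elim y)
      have "E A (fst y) * \<epsilon> y \<le> 1 * 1" using Eb[OF elim] e1[OF elim] ep[of y] by (intro mult_mono) auto
      then show ?case using Eb(1)[OF elim] ep[of y] by simp
    qed
    have sr: "sqint ?Q r" unfolding r_def by (rule sqint_bounded_mult[OF swQ _ Ee]) measurable
    have sg: "sqint ?Q g" unfolding g_def by (rule sqint_bounded_mult[OF sfQ _ Ee]) measurable
    have inB: "AE z in ?B. z \<in> {0<..<A} \<times> {0<..<24}" unfolding AE_leb_iff[OF rect_sets] by simp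
    have sr0: "sqint ?B r0" unfolding r0_def
    proof (rule sqint_bounded_mult[OF sw0B])
      show "AE z in ?B. \<bar>E A (fst z)\<bar> \<le> 1" using inB
      proof eventually_elim
        case (elim z)
        then show ?case using E_bounds[of "fst z" A] A by auto
      qed
    qed measurable
    have r0n: "AE z in ?B. 0 \<le> r0 z"
      using AE_leb_subset[OF w0n subB] inB
      by (auto simp: r0_def elim!: eventually_elim2 intro!: mult_nonneg_nonneg less_imp_le[OF E_bounds(1)] A)
    have gn: "AE y in ?Q. 0 \<le> g y"
      using AE_leb_subset[OF fn sub QQ_sets QQ_sets] inQ
    proof eventually_elim
      case (elim y)
      then show ?case using Eb(1)[OF elim(2)] ep[of y] by (simp add: g_def)
    qed
    have sI: "sqint ?M (\<lambda>y. indicator {A..} (fst y) * w y)"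
      by (rule sqint_bounded_mult[OF sw, where C=1]) (auto simp: indicator_def intro!: AE_I2)
    have inM: "AE y in ?M. y \<in> QQ ad T" unfolding AE_leb_iff[OF QQ_sets] by simp
    have sIe: "sqint ?M (\<lambda>y. indicator {A..} (fst y) * w y * \<epsilon> y)"
    proof -
      have "sqint ?M (\<lambda>y. \<epsilon> y * (indicator {A..} (fst y) * w y))"
      proof (rule sqint_bounded_mult[OF sI, where C=1])
        show "AE y in ?M. \<bar>\<epsilon> y\<bar> \<le> 1" using inM by eventually_elim (use e1 ep in \<open>auto intro: order.trans[OF _ e1] simp: less_imp_le\<close>)
      qed measurable
      then show ?thesis by (simp add: mult.commute)
    qed
    have eqs: "(\<integral>y. r y * L \<phi> \<phi>a \<phi>t \<phi>xx y \<partial>?Q) = (\<integral>z. r0 z * \<phi> (fst z, 0, snd z) \<partial>?B)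
         + (\<integral>y. g y * \<phi> y \<partial>?Q) + err \<phi> \<and> (err \<phi>)\<^sup>2 \<le> \<kappa> * S0 \<phi>"
      if ct: "ctest A ad T \<phi> \<phi>a \<phi>t \<phi>xx" for \<phi> \<phi>a \<phi>t \<phi>xx
    proof -
      have test: "test_fun ad T \<phi> \<phi>a \<phi>t \<phi>xx" using ct by (simp add: ctest_def)
      note d = test_funD[OF test]
      have van: "\<phi> y = 0" "\<phi>a y = 0" "\<phi>t y = 0" "\<phi>xx y = 0" if "fst y \<ge> A" for y
        using ct that by (cases y; auto simp: ctest_def)+
      have kb: "sqint ?M (\<lambda>y. \<beta> (fst y) * KT \<eta> \<phi> y)"
         "(\<integral>y. (\<beta> (fst y) * KT \<eta> \<phi> y)\<^sup>2 \<partial>?M) \<le> 576 * Cb\<^sup>2 * ad * (\<integral>z. (\<phi> (0, z))\<^sup>2 \<partial>leb ({0<..<T} \<times> {0<..<24}))"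
        by (rule KT_L2_bound[OF d(1) beta_meas beta_abs wpos(1,2)])+
      define Y where "Y y = (indicator {A..} (fst y) * w y * \<epsilon> y) * (\<beta> (fst y) * KT \<eta> \<phi> y)" for y
      have iY: "integrable ?M Y" unfolding Y_def by (rule sqint_mult[OF sIe kb(1)])
      define Z where "Z y = w y * (E A (fst y) * \<epsilon> y * (- \<phi>a y - \<phi>t y - \<delta> * \<phi>xx y + lam * \<phi> y - u y * \<phi> y)
             - E0 * \<epsilon> y * (\<beta> (fst y) * KT \<eta> \<phi> y))" for y
      have ZY: "Z y + E0 * Y y = (if fst y < A then r y * L \<phi> \<phi>a \<phi>t \<phi>xx y else 0)" if "y \<in> QQ ad T" for y
      proof (cases "fst y < A")
        case True
        then have "y \<in> QQ A T" using that by (auto simp: QQ_def)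
        then have "E A (fst y) \<noteq> 0" using Eb(1)[of y] by simp
        then have "E A (fst y) * \<gamma> (fst y) = E0 * \<beta> (fst y)" by (simp add: \<gamma>_def)
        then have "E0 * \<epsilon> y * (\<beta> (fst y) * KT \<eta> \<phi> y) = E A (fst y) * \<epsilon> y * (\<gamma> (fst y) * KT \<eta> \<phi> y)"
          by (metis (no_types, opaque_lifting) mult.assoc mult.commute)
        then have "Z y = r y * L \<phi> \<phi>a \<phi>t \<phi>xx y"
          unfolding Z_def r_def L0_def P_def by (simp add: algebra_simps) metis
        then show ?thesis using True by (simp add: Y_def)
      next
        case False
        then show ?thesis using van[of y] by (simp add: Z_def Y_def)
      qed
      have iL: "integrable ?Q (\<lambda>y. r y * L \<phi> \<phi>a \<phi>t \<phi>xx y)" by (rule sqint_mult[OF sr sq_L[OF ct]])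
      have "integrable ?M (\<lambda>y. if fst y < A then r y * L \<phi> \<phi>a \<phi>t \<phi>xx y else 0)"
      proof -
        have "(\<lambda>y. indicator (QQ ad T) y *\<^sub>R (if fst y < A then r y * L \<phi> \<phi>a \<phi>t \<phi>xx y else 0))
          = (\<lambda>y. indicator (QQ A T) y *\<^sub>R (r y * L \<phi> \<phi>a \<phi>t \<phi>xx y))"
          using A by (auto simp: fun_eq_iff indicator_def QQ_def)
        then show ?thesis using iL unfolding integrable_leb_iff[OF QQ_sets] set_integrable_def by simp
      qed
      moreover have "integrable ?M (\<lambda>y. Z y + E0 * Y y) \<longleftrightarrow> integrable ?M (\<lambda>y. if fst y < A then r y * L \<phi> \<phi>a \<phi>t \<phi>xx y else 0)"
        by (rule Bochner_Integration.integrable_cong) (use ZY in \<open>auto simp: space_restrict_space\<close>)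
      ultimately have "integrable ?M (\<lambda>y. Z y + E0 * Y y)" by simp
      then have iZ: "integrable ?M Z"
        using Bochner_Integration.integrable_diff[of ?M "\<lambda>y. Z y + E0 * Y y" "\<lambda>y. E0 * Y y"] iY by simp
      have "(\<integral>y. r y * L \<phi> \<phi>a \<phi>t \<phi>xx y \<partial>?Q) = (\<integral>y. (if fst y < A then r y * L \<phi> \<phi>a \<phi>t \<phi>xx y else 0) \<partial>?Q)"
        unfolding integral_leb_eq[OF QQ_sets] set_lebesgue_integral_def
        by (rule Bochner_Integration.integral_cong) (auto simp: indicator_def QQ_def)
      also have "\<dots> = (\<integral>y. (if fst y < A then r y * L \<phi> \<phi>a \<phi>t \<phi>xx y else 0) \<partial>?M)"
        using A by (intro integral_QQ_restrict[symmetric]) auto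
      also have "\<dots> = (\<integral>y. Z y + E0 * Y y \<partial>?M)"
        by (rule Bochner_Integration.integral_cong) (use ZY in \<open>auto simp: space_restrict_space\<close>)
      also have "\<dots> = (\<integral>y. Z y \<partial>?M) + err \<phi>" unfolding err_def Y_def[symmetric] using iZ iY by simp
      also have "(\<integral>y. Z y \<partial>?M) = (\<integral>z. w0 z * (E A (fst z) * \<phi> (fst z, 0, snd z)) \<partial>leb ({0<..<ad} \<times> {0<..<24}))
         + (\<integral>y. f y * (E A (fst y) * \<epsilon> y * \<phi> y) \<partial>?M)"
        unfolding Z_def \<epsilon>_def by (rule red[rule_format, OF ct])
      also have "(\<integral>z. w0 z * (E A (fst z) * \<phi> (fst z, 0, snd z)) \<partial>leb ({0<..<ad} \<times> {0<..<24})) = (\<integral>z. r0 z * \<phi> (fst z, 0, snd z) \<partial>?B)"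
      proof -
        have "(\<integral>z. w0 z * (E A (fst z) * \<phi> (fst z, 0, snd z)) \<partial>leb ({0<..<ad} \<times> {0<..<24})) = (\<integral>z. w0 z * (E A (fst z) * \<phi> (fst z, 0, snd z)) \<partial>?B)"
        proof (rule integral_leb_restrict[OF subB rect_sets rect_sets])
          fix z assume "z \<in> {0<..<ad} \<times> {0<..<24} - {0<..<A} \<times> {0<..<24::real}"
          then have "A \<le> fst z" by auto
          then show "w0 z * (E A (fst z) * \<phi> (fst z, 0, snd z)) = 0" using van(1)[of "(fst z, 0, snd z)"] by simp
        qed
        then show ?thesis by (simp add: r0_def ac_simps)
      qed
      also have "(\<integral>y. f y * (E A (fst y) * \<epsilon> y * \<phi> y) \<partial>?M) = (\<integral>y. g y * \<phi> y \<partial>?Q)"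
        using A by (subst integral_QQ_restrict[of A]) (auto simp: van(1) g_def ac_simps)
      finally have 1: "(\<integral>y. r y * L \<phi> \<phi>a \<phi>t \<phi>xx y \<partial>?Q) = (\<integral>z. r0 z * \<phi> (fst z, 0, snd z) \<partial>?B) + (\<integral>y. g y * \<phi> y \<partial>?Q) + err \<phi>" .
      have "(\<integral>y. Y y \<partial>?M)\<^sup>2 \<le> (\<integral>y. (indicator {A..} (fst y) * w y * \<epsilon> y)\<^sup>2 \<partial>?M) * (\<integral>y. (\<beta> (fst y) * KT \<eta> \<phi> y)\<^sup>2 \<partial>?M)"
        unfolding Y_def by (rule Cauchy_Schwarz_integral[OF sIe kb(1)])
      also have "\<dots> \<le> \<Omega> A * (c * S0 \<phi>)"
      proof (rule mult_mono)
        show "(\<integral>y. (indicator {A..} (fst y) * w y * \<epsilon> y)\<^sup>2 \<partial>?M) \<le> \<Omega> A" unfolding \<Omega>_def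
        proof (rule integral_mono_AE)
          show "AE y in ?M. (indicator {A..} (fst y) * w y * \<epsilon> y)\<^sup>2 \<le> (indicator {A..} (fst y) * w y)\<^sup>2"
            using inM
          proof eventually_elim
            case (elim y)
            have "(\<epsilon> y)\<^sup>2 \<le> 1" using e1[OF elim] ep[of y] by (intro power_le_one) auto
            then have "(indicator {A..} (fst y) * w y)\<^sup>2 * (\<epsilon> y)\<^sup>2 \<le> (indicator {A..} (fst y) * w y)\<^sup>2 * 1"
              by (intro mult_left_mono) auto
            then show ?case by (simp add: power_mult_distrib)
          qed
        qed (use sqint_integrable_square[OF sIe] sqint_integrable_square[OF sI] in auto)
        show "(\<integral>y. (\<beta> (fst y) * KT \<eta> \<phi> y)\<^sup>2 \<partial>?M) \<le> c * S0 \<phi>" using kb(2) by (simp add: c_def S0_def)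
      qed (use O0 in auto)
      finally have "E0\<^sup>2 * (\<integral>y. Y y \<partial>?M)\<^sup>2 \<le> E0\<^sup>2 * (\<Omega> A * (c * S0 \<phi>))" by (rule mult_left_mono) simp
      then have "(err \<phi>)\<^sup>2 \<le> \<kappa> * S0 \<phi>" by (simp add: err_def Y_def \<kappa>_def power_mult_distrib ac_simps)
      with 1 show ?thesis by simp
    qed
    have k0: "\<kappa> \<ge> 0" using c0 O0[of A] by (simp add: \<kappa>_def)
    have ev: "integrable ?Q (\<lambda>y. \<epsilon> y * (v y)\<^sup>2)"
      by (rule Bochner_Integration.integrable_bound[OF sqint_integrable_square[OF svQ]])
         (use inQ in \<open>auto elim!: eventually_mono simp: abs_mult abs_of_pos[OF ep] intro!: mult_left_le_one_le e1 less_imp_le[OF ep]\<close>)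
    have R0: "0 \<le> 2 * sqrt (c * \<Omega> A * W)" using c0 O0[of A] W0 by simp
    show ?thesis
    proof (cases "E0 = 0")
      case True
      have "- sqrt (4 * \<kappa> * (\<integral>y. (v y)\<^sup>2 \<partial>?Q)) \<le> (\<integral>y. r y * v y \<partial>?Q)"
        by (rule dual_positivity[OF sr svQ _ sr0 r0n sg gn k0 eqs]) (auto simp: v0)
      moreover have "(\<integral>y. r y * v y \<partial>?Q) = - (\<integral>y. E A (fst y) * \<epsilon> y * (v y)\<^sup>2 \<partial>?Q)"
        unfolding Bochner_Integration.integral_minus[symmetric]
        by (rule Bochner_Integration.integral_cong) (simp_all add: r_def mult.assoc wv)
      ultimately have le0: "(\<integral>y. E A (fst y) * \<epsilon> y * (v y)\<^sup>2 \<partial>?Q) \<le> 0" using True by (simp add: \<kappa>_def)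
      have iE: "integrable ?Q (\<lambda>y. E A (fst y) * \<epsilon> y * (v y)\<^sup>2)"
      proof (rule Bochner_Integration.integrable_bound[OF sqint_integrable_square[OF svQ]])
        show "AE y in ?Q. norm (E A (fst y) * \<epsilon> y * (v y)\<^sup>2) \<le> norm ((v y)\<^sup>2)"
          using Ee
        proof eventually_elim
          case (elim y)
          have "\<bar>E A (fst y) * \<epsilon> y\<bar> * (v y)\<^sup>2 \<le> 1 * (v y)\<^sup>2" by (rule mult_right_mono[OF elim]) simp
          then show ?case by (simp add: abs_mult)
        qed
      qed measurable
      have nn: "AE y in ?Q. 0 \<le> E A (fst y) * \<epsilon> y * (v y)\<^sup>2"
        using inQ
      proof eventually_elim
        case (elim y)
        show ?case using less_imp_le[OF Eb(1)[OF elim]] less_imp_le[OF ep[of y]] by simp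
      qed
      have "(\<integral>y. E A (fst y) * \<epsilon> y * (v y)\<^sup>2 \<partial>?Q) = 0" using le0 integral_nonneg_AE[OF nn] by linarith
      then have "AE y in ?Q. E A (fst y) * \<epsilon> y * (v y)\<^sup>2 = 0"
        using integral_nonneg_eq_0_iff_AE[OF iE nn] by simp
      then have "AE y in ?Q. \<epsilon> y * (v y)\<^sup>2 = 0"
        using inQ
      proof eventually_elim
        case (elim y)
        then show ?case using Eb(1)[OF elim(2)] by simp
      qed
      then have "(\<integral>y. \<epsilon> y * (v y)\<^sup>2 \<partial>?Q) = 0" by (rule integral_eq_zero_AE)
      then show ?thesis using R0 by simp
    next
      case False
      then have E0p: "E0 > 0" using E0(1) by simp
      define \<psi> where "\<psi> y = E0 / E A (fst y) * v y" for y
      have psb: "AE y in ?Q. \<bar>E0 / E A (fst y)\<bar> \<le> 1"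
        using inQ
      proof eventually_elim
        case (elim y)
        then show ?case using Eb[OF elim] E0p by simp
      qed
      have spsi: "sqint ?Q \<psi>" unfolding \<psi>_def by (rule sqint_bounded_mult[OF svQ _ psb]) measurable
      have psn: "AE y in ?Q. 0 \<le> \<psi> y" using inQ
      proof eventually_elim
        case (elim y)
        then show ?case using Eb(1)[OF elim] E0p v0[of y] by (simp add: \<psi>_def)
      qed
      have "- sqrt (4 * \<kappa> * (\<integral>y. (\<psi> y)\<^sup>2 \<partial>?Q)) \<le> (\<integral>y. r y * \<psi> y \<partial>?Q)"
        by (rule dual_positivity[OF sr spsi psn sr0 r0n sg gn k0 eqs])
      moreover have "(\<integral>y. r y * \<psi> y \<partial>?Q) = - (E0 * (\<integral>y. \<epsilon> y * (v y)\<^sup>2 \<partial>?Q))"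
      proof -
        have "(\<integral>y. r y * \<psi> y \<partial>?Q) = (\<integral>y. - E0 * (\<epsilon> y * (v y)\<^sup>2) \<partial>?Q)"
        proof (rule Bochner_Integration.integral_cong)
          fix y assume "y \<in> space ?Q"
          then have "E A (fst y) \<noteq> 0" using Eb(1)[of y] by (simp add: space_restrict_space)
          then have "r y * \<psi> y = E0 * \<epsilon> y * (w y * v y)" by (simp add: r_def \<psi>_def)
          then show "r y * \<psi> y = - E0 * (\<epsilon> y * (v y)\<^sup>2)" unfolding wv by simp
        qed simp
        then show ?thesis by simp
      qed
      moreover have "sqrt (4 * \<kappa> * (\<integral>y. (\<psi> y)\<^sup>2 \<partial>?Q)) \<le> E0 * (2 * sqrt (c * \<Omega> A * W))"
      proof -
        have "(\<integral>y. (\<psi> y)\<^sup>2 \<partial>?Q) \<le> (\<integral>y. (w y)\<^sup>2 \<partial>?Q)"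
        proof (rule integral_mono_AE)
          show "AE y in ?Q. (\<psi> y)\<^sup>2 \<le> (w y)\<^sup>2"
            using psb
          proof eventually_elim
            case (elim y)
            have "(E0 / E A (fst y))\<^sup>2 \<le> 1" using power_mono[OF elim abs_ge_zero, of 2] unfolding power2_abs by simp
            then have "(E0 / E A (fst y))\<^sup>2 * (v y)\<^sup>2 \<le> 1 * (v y)\<^sup>2" by (rule mult_right_mono) simp
            also have "\<dots> \<le> (w y)\<^sup>2" using max0_sq_le(2)[of "w y"] by (simp add: v_def)
            finally show ?case unfolding \<psi>_def power_mult_distrib .
          qed
        qed (use sqint_integrable_square[OF spsi] sqint_integrable_square[OF swQ] in auto)
        also have "\<dots> \<le> W"
        proof -
          have "(\<integral>y. (w y)\<^sup>2 \<partial>?Q) = (\<integral>y. indicator (QQ A T) y * (w y)\<^sup>2 \<partial>?M)"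
          proof -
            have "(\<integral>y. (w y)\<^sup>2 \<partial>?Q) = (\<integral>y. indicator (QQ A T) y * (w y)\<^sup>2 \<partial>?Q)"
              by (rule Bochner_Integration.integral_cong) (auto simp: space_restrict_space)
            also have "\<dots> = (\<integral>y. indicator (QQ A T) y * (w y)\<^sup>2 \<partial>?M)"
              by (rule integral_leb_restrict[symmetric, OF sub]) auto
            finally show ?thesis .
          qed
          also have "\<dots> \<le> W" unfolding W_def
            by (rule integral_mono_AE') (use sqint_integrable_square[OF sw] in \<open>auto simp: indicator_def\<close>)
          finally show ?thesis .
        qed
        finally have "4 * \<kappa> * (\<integral>y. (\<psi> y)\<^sup>2 \<partial>?Q) \<le> 4 * \<kappa> * W" using k0 by (intro mult_left_mono) auto
        also have "\<dots> = (2 * E0)\<^sup>2 * (c * \<Omega> A * W)" by (simp add: \<kappa>_def power_mult_distrib)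
        finally have "sqrt (4 * \<kappa> * (\<integral>y. (\<psi> y)\<^sup>2 \<partial>?Q)) \<le> sqrt ((2 * E0)\<^sup>2 * (c * \<Omega> A * W))" by (rule real_sqrt_le_mono)
        also have "\<dots> = 2 * E0 * sqrt (c * \<Omega> A * W)" using E0p by (simp add: real_sqrt_mult)
        finally show ?thesis by simp
      qed
      ultimately have "E0 * (\<integral>y. \<epsilon> y * (v y)\<^sup>2 \<partial>?Q) \<le> E0 * (2 * sqrt (c * \<Omega> A * W))" by linarith
      then show ?thesis using E0p by simp
    qed
  qed
  define An where "An n = ad - ad * inverse (real (Suc (Suc n)))" for n
  have An: "0 < An n" "An n < ad" for n
  proof -
    have "inverse (real (Suc (Suc n))) < 1" by (simp add: inverse_less_1_iff)
    then have "ad * inverse (real (Suc (Suc n))) < ad * 1" using pos by (intro mult_strict_left_mono) auto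
    then show "0 < An n" "An n < ad" using pos by (auto simp: An_def)
  qed
  have Anl: "An \<longlonglongrightarrow> ad"
  proof -
    have "(\<lambda>n. ad - ad * inverse (real (Suc (Suc n)))) \<longlonglongrightarrow> ad - ad * 0"
      by (intro tendsto_intros LIMSEQ_Suc[OF LIMSEQ_inverse_real_of_nat])
    then show ?thesis by (simp add: An_def[abs_def])
  qed
  have ev: "eventually (\<lambda>n. a < An n) sequentially" if "a < ad" for a using order_tendstoD(1)[OF Anl that] .
  have inM: "AE y in ?M. y \<in> QQ ad T" unfolding AE_leb_iff[OF QQ_sets] by simp
  have lim1: "(\<lambda>n. \<Omega> (An n)) \<longlonglongrightarrow> (\<integral>y. 0 \<partial>?M)" unfolding \<Omega>_def
  proof (rule integral_dominated_convergence[OF _ _ sqint_integrable_square[OF sw]])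
    show "AE y in ?M. (\<lambda>n. (indicator {An n..} (fst y) * w y)\<^sup>2) \<longlonglongrightarrow> 0"
      using inM
    proof eventually_elim
      case (elim y)
      have "eventually (\<lambda>n. (indicator {An n..} (fst y) * w y)\<^sup>2 = 0) sequentially"
        using ev[OF conjunct1[OF conjunct2[OF QQ_fst[OF elim]]]] by eventually_elim simp
      then show ?case by (rule tendsto_eventually)
    qed
    show "AE y in ?M. norm ((indicator {An n..} (fst y) * w y)\<^sup>2) \<le> (w y)\<^sup>2" for n
      by (intro AE_I2) (auto simp: indicator_def)
  qed measurable
  have iev: "integrable ?M (\<lambda>y. \<epsilon> y * (v y)\<^sup>2)"
    by (rule Bochner_Integration.integrable_bound[OF sqint_integrable_square[OF sv]])
       (use inM in \<open>auto elim!: eventually_mono simp: abs_mult abs_of_pos[OF ep] intro!: mult_left_le_one_le e1 less_imp_le[OF ep]\<close>)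
  have lim2: "(\<lambda>n. \<integral>y. \<epsilon> y * (v y)\<^sup>2 \<partial>leb (QQ (An n) T)) \<longlonglongrightarrow> (\<integral>y. \<epsilon> y * (v y)\<^sup>2 \<partial>?M)"
  proof -
    have "(\<integral>y. \<epsilon> y * (v y)\<^sup>2 \<partial>leb (QQ (An n) T)) = (\<integral>y. indicator {..<An n} (fst y) * (\<epsilon> y * (v y)\<^sup>2) \<partial>?M)" for n
    proof -
      have "(\<integral>y. \<epsilon> y * (v y)\<^sup>2 \<partial>leb (QQ (An n) T)) = (\<integral>y. indicator {..<An n} (fst y) * (\<epsilon> y * (v y)\<^sup>2) \<partial>leb (QQ (An n) T))"
        by (rule Bochner_Integration.integral_cong) (auto simp: space_restrict_space QQ_def)
      also have "\<dots> = (\<integral>y. indicator {..<An n} (fst y) * (\<epsilon> y * (v y)\<^sup>2) \<partial>?M)"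
        using An(2)[of n] by (intro integral_QQ_restrict[symmetric]) auto
      finally show ?thesis .
    qed
    moreover have "(\<lambda>n. \<integral>y. indicator {..<An n} (fst y) * (\<epsilon> y * (v y)\<^sup>2) \<partial>?M) \<longlonglongrightarrow> (\<integral>y. \<epsilon> y * (v y)\<^sup>2 \<partial>?M)"
    proof (rule integral_dominated_convergence[where w="\<lambda>y. \<epsilon> y * (v y)\<^sup>2"])
      show "AE y in ?M. (\<lambda>n. indicator {..<An n} (fst y) * (\<epsilon> y * (v y)\<^sup>2)) \<longlonglongrightarrow> \<epsilon> y * (v y)\<^sup>2"
        using inM
      proof eventually_elim
        case (elim y)
        have "eventually (\<lambda>n. indicator {..<An n} (fst y) * (\<epsilon> y * (v y)\<^sup>2) = \<epsilon> y * (v y)\<^sup>2) sequentially"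
          using ev[OF conjunct1[OF conjunct2[OF QQ_fst[OF elim]]]] by eventually_elim simp
        then show ?case by (rule tendsto_eventually)
      qed
      show "AE y in ?M. norm (indicator {..<An n} (fst y) * (\<epsilon> y * (v y)\<^sup>2)) \<le> \<epsilon> y * (v y)\<^sup>2" for n
        by (intro AE_I2) (auto simp: indicator_def abs_mult abs_of_pos[OF ep] less_imp_le[OF ep])
    qed (use iev in auto)
    ultimately show ?thesis by simp
  qed
  have "(\<lambda>n. 2 * sqrt (c * \<Omega> (An n) * W)) \<longlonglongrightarrow> 2 * sqrt (c * (\<integral>y. 0 \<partial>?M) * W)"
    by (intro tendsto_intros lim1)
  from LIMSEQ_le[OF lim2 this] have "(\<integral>y. \<epsilon> y * (v y)\<^sup>2 \<partial>?M) \<le> 0"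
    using key[OF An] by simp
  moreover have nn: "AE y in ?M. 0 \<le> \<epsilon> y * (v y)\<^sup>2" by (intro AE_I2) (simp add: less_imp_le[OF ep])
  ultimately have "(\<integral>y. \<epsilon> y * (v y)\<^sup>2 \<partial>?M) = 0" using integral_nonneg_AE[OF nn] by linarith
  then have "AE y in ?M. \<epsilon> y * (v y)\<^sup>2 = 0" using integral_nonneg_eq_0_iff_AE[OF iev nn] by simp
  then show ?thesis
  proof eventually_elim
    case (elim y)
    then have "v y = 0" using ep[of y] by simp
    then show ?case by (simp add: v_def)
  qed
qed

end

section \<open>The control problem\<close>

lemma emeasure_lborel_Times:
  fixes X :: "'a::euclidean_space set" and Y :: "'b::euclidean_space set"
  assumes "X \<in> sets borel" "Y \<in> sets borel"
  shows "emeasure lborel (X \<times> Y) = emeasure lborel X * emeasure lborel Y"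
  using lborel.emeasure_pair_measure_Times[of X lborel Y] assms by (simp add: lborel_prod)

lemma box_Times: "box (a, b) (c, d) = box a c \<times> box b d"
  for a c :: "'a::euclidean_space" and b d :: "'b::euclidean_space"
  by (auto simp: mem_box Basis_prod_def ball_Un)

lemma lborel_permute4:
  "distr lborel borel (\<lambda>z :: (real \<times> real) \<times> real \<times> real. ((fst (snd z), fst (fst z), snd (snd z)), snd (fst z)))
   = (lborel :: ((real \<times> real \<times> real) \<times> real) measure)"
  (is "distr lborel borel ?\<pi> = _")
proof (rule lborel_eqI[symmetric])
  have pm: "?\<pi> \<in> borel_measurable borel" by (rule borel_measurable_continuous_onI) (intro continuous_intros)
  fix l u :: "(real \<times> real \<times> real) \<times> real"
  assume le: "\<And>b. b \<in> Basis \<Longrightarrow> l \<bullet> b \<le> u \<bullet> b"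
  obtain l1 l2 l3 l4 where l: "l = ((l1, l2, l3), l4)" by (metis prod.exhaust)
  obtain u1 u2 u3 u4 where u: "u = ((u1, u2, u3), u4)" by (metis prod.exhaust)
  have "emeasure (distr lborel borel ?\<pi>) (box l u) = emeasure lborel (?\<pi> -` box l u)"
    using pm by (simp add: emeasure_distr)
  also have "?\<pi> -` box l u = (box l2 u2 \<times> box l4 u4) \<times> (box l1 u1 \<times> box l3 u3)"
    unfolding l u box_Times by auto
  also have "emeasure lborel \<dots> = emeasure lborel (box l u)"
    unfolding l u box_Times by (simp add: emeasure_lborel_Times borel_Times ac_simps)
  also have "\<dots> = (\<Prod>b\<in>Basis. (u - l) \<bullet> b)" using le by (rule emeasure_lborel_box)
  finally show "emeasure (distr lborel borel ?\<pi>) (box l u) = ennreal (\<Prod>b\<in>Basis. (u - l) \<bullet> b)" .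
qed simp

lemma renewal_pairing:
  fixes p \<phi> :: "real \<times> real \<times> real \<Rightarrow> real"
  assumes pm[measurable]: "p \<in> borel_measurable borel" and sp: "sqint (leb (QQ ad T)) p"
    and c: "continuous_on UNIV \<phi>" and bm[measurable]: "\<beta> \<in> borel_measurable borel"
    and bb: "AE y in leb (QQ ad T). \<bar>\<beta> (fst y)\<bar> \<le> Cb"
  shows "(LINT z:{0<..<T} \<times> {0<..<24}|lborel. renewal ad \<eta> \<beta> p (fst z) (snd z) * \<phi> (0, fst z, snd z))
    = (\<integral>y. p y * (\<beta> (fst y) * KT \<eta> \<phi> y) \<partial>leb (QQ ad T))"
proof -
  let ?\<pi> = "\<lambda>z :: (real \<times> real) \<times> real \<times> real. ((fst (snd z), fst (fst z), snd (snd z)), snd (fst z))"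
  have fm[measurable]: "\<phi> \<in> borel_measurable borel" by (rule borel_measurable_continuous_onI[OF c])
  define H where "H y = indicator (QQ ad T) y * (p y * \<beta> (fst y))" for y
  define k where "k t s x = indicator {0<..<24} x * (kern \<eta> x s * \<phi> (0, t, x))" for t s x :: real
  define F where "F w = H (fst w) * k (fst (snd (fst w))) (snd (snd (fst w))) (snd w)" for w :: "(real \<times> real \<times> real) \<times> real"
  have Hm[measurable]: "H \<in> borel_measurable borel" unfolding H_def by measurable
  have Fm[measurable]: "F \<in> borel_measurable borel" unfolding F_def k_def by measurable
  have iH: "integrable lborel H"
  proof -
    have "sqint (leb (QQ ad T)) (\<lambda>y. \<beta> (fst y) * p y)" by (rule sqint_bounded_mult[OF sp _ bb]) measurable
    from sqint_integrable[OF finite_measure_QQ this] show ?thesis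
      unfolding H_def[abs_def] by (simp add: integrable_leb_iff set_integrable_def mult.commute)
  qed
  have "compact ((\<lambda>z. \<phi> (0, z)) ` cbox (0, 0) (T, 24))"
    by (rule compact_continuous_image[OF continuous_on_compose2[OF c]]) (auto intro!: continuous_intros)
  then obtain B where B: "\<And>z. z \<in> cbox (0, 0) (T, 24) \<Longrightarrow> \<bar>\<phi> (0, z)\<bar> \<le> B"
    using compact_imp_bounded[of "(\<lambda>z. \<phi> (0, z)) ` cbox (0, 0) (T, 24)"] unfolding bounded_iff by auto
  define B' where "B' = max 0 B"
  have B'0: "B' \<ge> 0" by (simp add: B'_def)
  have Fb: "\<bar>F w\<bar> \<le> B' * \<bar>H (fst w)\<bar> * indicator {0<..<24} (snd w)" for w
  proof (cases "fst w \<in> QQ ad T \<and> snd w \<in> {0<..<24}")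
    case True
    then have "\<bar>\<phi> (0, fst (snd (fst w)), snd w)\<bar> \<le> B'"
      using B[of "(fst (snd (fst w)), snd w)"] unfolding B'_def QQ_def by (auto simp: mem_box Basis_prod_def)
    then have "\<bar>kern \<eta> (snd w) (snd (snd (fst w)))\<bar> * \<bar>\<phi> (0, fst (snd (fst w)), snd w)\<bar> \<le> 1 * B'"
      using kern_bounds[of \<eta> "snd w" "snd (snd (fst w))"] by (intro mult_mono) auto
    then have "\<bar>H (fst w)\<bar> * (\<bar>kern \<eta> (snd w) (snd (snd (fst w)))\<bar> * \<bar>\<phi> (0, fst (snd (fst w)), snd w)\<bar>) \<le> \<bar>H (fst w)\<bar> * (1 * B')"
      by (rule mult_left_mono) simp
    then show ?thesis using True by (simp add: F_def k_def abs_mult ac_simps)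
  next
    case False
    then have "F w = 0" by (auto simp: F_def H_def k_def indicator_def)
    then show ?thesis using B'0 by (auto intro!: mult_nonneg_nonneg)
  qed
  have iF: "integrable lborel F"
  proof (rule integrableI_bounded)
    have "(\<integral>\<^sup>+ w. ennreal (norm (F w)) \<partial>lborel) \<le> (\<integral>\<^sup>+ w. ennreal (B' * \<bar>H (fst w)\<bar>) * indicator {0<..<24::real} (snd w) \<partial>lborel)"
    proof (rule nn_integral_mono)
      fix w :: "(real \<times> real \<times> real) \<times> real"
      show "ennreal (norm (F w)) \<le> ennreal (B' * \<bar>H (fst w)\<bar>) * indicator {0<..<24::real} (snd w)"
        using Fb[of w] by (cases "snd w \<in> {0<..<24}") (auto intro: ennreal_leI)
    qed
    also have "\<dots> = (\<integral>\<^sup>+ w. ennreal (B' * \<bar>H (fst w)\<bar>) * indicator {0<..<24::real} (snd w) \<partial>(lborel \<Otimes>\<^sub>M lborel))"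
      by (simp add: lborel_prod)
    also have "\<dots> = (\<integral>\<^sup>+ y. \<integral>\<^sup>+ x. ennreal (B' * \<bar>H y\<bar>) * indicator {0<..<24::real} x \<partial>lborel \<partial>lborel)"
      by (subst lborel.nn_integral_fst[symmetric]) auto
    also have "\<dots> = (\<integral>\<^sup>+ y. ennreal (B' * \<bar>H y\<bar>) * 24 \<partial>lborel)"
      by (simp add: nn_integral_cmult_indicator)
    also have "\<dots> = (\<integral>\<^sup>+ y. ennreal (B' * \<bar>H y\<bar>) \<partial>lborel) * 24"
      by (rule nn_integral_multc) auto
    also have "(\<integral>\<^sup>+ y. ennreal (B' * \<bar>H y\<bar>) \<partial>lborel) = ennreal (\<integral>y. B' * \<bar>H y\<bar> \<partial>lborel)"
      using iH B'0 by (intro nn_integral_eq_integral) auto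
    finally show "(\<integral>\<^sup>+ w. ennreal (norm (F w)) \<partial>lborel) < \<infinity>"
      by (rule le_less_trans) (simp add: ennreal_mult_less_top)
  qed measurable
  have "?\<pi> \<in> borel_measurable borel" by (rule borel_measurable_continuous_onI) (intro continuous_intros)
  then have pim: "?\<pi> \<in> lborel \<rightarrow>\<^sub>M borel" by simp
  have iFp: "integrable lborel (\<lambda>z. F (?\<pi> z))"
    using iF integrable_distr_eq[OF pim Fm] unfolding lborel_permute4 by simp
  have eqp: "(\<integral>w. F w \<partial>lborel) = (\<integral>z. F (?\<pi> z) \<partial>lborel)"
    using integral_distr[OF pim Fm] unfolding lborel_permute4 by simp
  have iF': "integrable (lborel \<Otimes>\<^sub>M lborel) F" using iF by (simp add: lborel_prod)
  have iFp': "integrable (lborel \<Otimes>\<^sub>M lborel) (\<lambda>z. F (?\<pi> z))" using iFp by (simp add: lborel_prod)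
  have "(\<integral>y. p y * (\<beta> (fst y) * KT \<eta> \<phi> y) \<partial>leb (QQ ad T)) = (\<integral>y. (\<integral>x. F (y, x) \<partial>lborel) \<partial>lborel)"
  proof -
    have KTe: "KT \<eta> \<phi> y = (\<integral>x. k (fst (snd y)) (snd (snd y)) x \<partial>lborel)" for y
      unfolding KT_def k_def by (simp add: integral_leb_eq set_lebesgue_integral_def)
    show ?thesis unfolding integral_leb_eq[OF QQ_sets] set_lebesgue_integral_def
      by (rule Bochner_Integration.integral_cong) (simp_all add: F_def H_def KTe mult.assoc)
  qed
  also have "\<dots> = (\<integral>w. F w \<partial>lborel)"
    using lborel_pair.integral_fst'[OF iF'] by (simp add: lborel_prod)
  also have "\<dots> = (\<integral>z. F (?\<pi> z) \<partial>lborel)" by (rule eqp)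
  also have "\<dots> = (\<integral>tx. (\<integral>as. F (?\<pi> (tx, as)) \<partial>lborel) \<partial>lborel)"
    using lborel_pair.integral_fst'[OF iFp'] by (simp add: lborel_prod)
  also have "\<dots> = (\<integral>z. indicator ({0<..<T} \<times> {0<..<24}) z *\<^sub>R (renewal ad \<eta> \<beta> p (fst z) (snd z) * \<phi> (0, fst z, snd z)) \<partial>lborel)"
  proof (rule integral_cong_AE)
    show "(\<lambda>tx. \<integral>as. F (?\<pi> (tx, as)) \<partial>lborel) \<in> borel_measurable lborel"
      using borel_measurable_integrable[OF lborel_pair.integrable_fst'[OF iFp']] by simp
    have pt: "(\<integral>a. (\<integral>s. F (?\<pi> (z, (a, s))) \<partial>lborel) \<partial>lborel)
        = indicator ({0<..<T} \<times> {0<..<24}) z *\<^sub>R (renewal ad \<eta> \<beta> p (fst z) (snd z) * \<phi> (0, fst z, snd z))" for z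
    proof -
      obtain t x where z: "z = (t, x)" by (cases z)
      have eqF: "F (?\<pi> (z, (a, s))) = (indicator ({0<..<T} \<times> {0<..<24}) z * \<phi> (0, t, x)) *
          (indicator {0<..<ad} a * (\<beta> a * (indicator {x - \<eta><..<x + \<eta>} s * (KK x s * p (a, t, s)))))" for a s
        by (auto simp: z F_def H_def k_def kern_def KK_def QQ_def indicator_def)
      have "(\<integral>a. (\<integral>s. F (?\<pi> (z, (a, s))) \<partial>lborel) \<partial>lborel) = (indicator ({0<..<T} \<times> {0<..<24}) z * \<phi> (0, t, x)) *
          (\<integral>a. indicator {0<..<ad} a * (\<beta> a * (\<integral>s. indicator {x - \<eta><..<x + \<eta>} s * (KK x s * p (a, t, s)) \<partial>lborel)) \<partial>lborel)"
        unfolding eqF by (simp only: integral_mult_right_zero)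
      then show ?thesis
        unfolding renewal_def set_lebesgue_integral_def by (simp add: z)
    qed
    have "(\<lambda>z. \<integral>a. (\<integral>s. F (?\<pi> (z, (a, s))) \<partial>lborel) \<partial>lborel) \<in> borel_measurable lborel"
      by (intro lborel.borel_measurable_lebesgue_integral) (simp add: split_beta)
    then show "(\<lambda>z. indicator ({0<..<T} \<times> {0<..<24}) z *\<^sub>R (renewal ad \<eta> \<beta> p (fst z) (snd z) * \<phi> (0, fst z, snd z))) \<in> borel_measurable lborel"
      unfolding pt .
    have "AE z in lborel. integrable lborel (\<lambda>as. F (?\<pi> (z, as)))"
      by (rule lborel_pair.AE_integrable_fst'[OF iFp'])
    then show "AE z in lborel. (\<integral>as. F (?\<pi> (z, as)) \<partial>lborel) =
        indicator ({0<..<T} \<times> {0<..<24}) z *\<^sub>R (renewal ad \<eta> \<beta> p (fst z) (snd z) * \<phi> (0, fst z, snd z))"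
    proof eventually_elim
      case (elim z)
      then have "integrable (lborel \<Otimes>\<^sub>M lborel) (\<lambda>as. F (?\<pi> (z, as)))" by (simp add: lborel_prod)
      from lborel_pair.integral_fst'[OF this] show ?case unfolding pt[symmetric] by (simp add: lborel_prod)
    qed
  qed
  finally show ?thesis unfolding set_lebesgue_integral_def by simp
qed

locale problem_data =
  fixes ad T \<delta> \<eta> Cb :: real and \<mu> \<beta> :: "real \<Rightarrow> real"
  assumes posd: "0 < ad" "0 < T" "0 < \<delta>"
    and mu_measd[measurable]: "\<mu> \<in> borel_measurable borel"
    and mu_locd: "\<And>c d. 0 < c \<Longrightarrow> d < ad \<Longrightarrow> \<exists>C. AE a in lborel. a \<in> {c..d} \<longrightarrow> \<bar>\<mu> a\<bar> \<le> C"
    and mu_nnd: "AE a in lborel. a \<in> {0<..<ad} \<longrightarrow> 0 \<le> \<mu> a"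
    and beta_measd[measurable]: "\<beta> \<in> borel_measurable borel"
    and betad: "AE a in lborel. a \<in> {0<..<ad} \<longrightarrow> 0 \<le> \<beta> a \<and> \<beta> a \<le> Cb"
begin

abbreviation "Q \<equiv> leb (QQ ad T)"
abbreviation "B0 \<equiv> leb ({0<..<ad} \<times> {0<..<24::real})"

lemma inQ: "AE y in Q. y \<in> QQ ad T" unfolding AE_leb_iff[OF QQ_sets] by simp

lemma beta_absd: "AE y in Q. \<bar>\<beta> (fst y)\<bar> \<le> Cb"
proof -
  have "AE y in Q. fst y \<in> {0<..<ad} \<longrightarrow> 0 \<le> \<beta> (fst y) \<and> \<beta> (fst y) \<le> Cb"
    unfolding AE_leb_iff[OF QQ_sets] using AE_lborel_fst[OF betad] by (auto elim: eventually_mono)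
  then show ?thesis using inQ by eventually_elim (auto dest: QQ_fst)
qed

definition Y where "Y \<phi> \<phi>a \<phi>t \<phi>xx y = - \<phi>a y - \<phi>t y - \<delta> * \<phi>xx y - \<beta> (fst y) * KT \<eta> \<phi> y"
  for \<phi> \<phi>a \<phi>t \<phi>xx :: "real \<times> real \<times> real \<Rightarrow> real" and y

lemma test_sq:
  assumes "test_fun ad T \<phi> \<phi>a \<phi>t \<phi>xx"
  shows "sqint Q \<phi>" "sqint Q (\<lambda>y. - \<phi>a y - \<phi>t y - \<delta> * \<phi>xx y)" "sqint Q (\<lambda>y. \<beta> (fst y) * KT \<eta> \<phi> y)"
    "sqint Q (Y \<phi> \<phi>a \<phi>t \<phi>xx)"
proof -
  note d = test_funD[OF assms]
  show "sqint Q \<phi>" by (rule sqint_leb_continuous[OF d(1)]) (auto simp: QQ_box)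
  show 1: "sqint Q (\<lambda>y. - \<phi>a y - \<phi>t y - \<delta> * \<phi>xx y)"
    by (rule sqint_leb_continuous) (auto simp: QQ_box intro!: continuous_intros d)
  show 2: "sqint Q (\<lambda>y. \<beta> (fst y) * KT \<eta> \<phi> y)"
    by (rule KT_L2_bound(1)[OF d(1) beta_measd beta_absd posd(1,2)])
  show "sqint Q (Y \<phi> \<phi>a \<phi>t \<phi>xx)" unfolding Y_def[abs_def] by (rule sqint_diff[OF 1 2])
qed

definition wsol0 where
  "wsol0 w w0 v \<longleftrightarrow> (\<forall>\<phi> \<phi>a \<phi>t \<phi>xx. test_fun ad T \<phi> \<phi>a \<phi>t \<phi>xx \<longrightarrow>
      integrable Q (\<lambda>y. \<mu> (fst y) * w y * \<phi> y) \<and>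
      (\<integral>y. w y * Y \<phi> \<phi>a \<phi>t \<phi>xx y \<partial>Q) + (\<integral>y. \<mu> (fst y) * w y * \<phi> y \<partial>Q)
      = (\<integral>z. w0 z * \<phi> (fst z, 0, snd z) \<partial>B0) + (\<integral>y. v y * \<phi> y \<partial>Q))"

lemma wsol0D:
  assumes "wsol0 w w0 v" "test_fun ad T \<phi> \<phi>a \<phi>t \<phi>xx"
  shows "integrable Q (\<lambda>y. \<mu> (fst y) * w y * \<phi> y)"
      "(\<integral>y. w y * Y \<phi> \<phi>a \<phi>t \<phi>xx y \<partial>Q) + (\<integral>y. \<mu> (fst y) * w y * \<phi> y \<partial>Q)
      = (\<integral>z. w0 z * \<phi> (fst z, 0, snd z) \<partial>B0) + (\<integral>y. v y * \<phi> y \<partial>Q)"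
  using assms by (simp_all add: wsol0_def)

lemma wsol0_imp_wsol:
  assumes ws: "wsol0 w w0 (\<lambda>y. f y + u y * w y)" and sw: "sqint Q w" and sf: "sqint Q f"
    and [measurable]: "u \<in> borel_measurable borel" and ub: "AE y in Q. \<bar>u y\<bar> \<le> Cu"
  shows "wsol ad T \<delta> \<eta> \<mu> \<beta> u w w0 f"
  unfolding wsol_def
proof (intro conjI allI impI)
  show "sqint Q w" by fact
  fix \<phi> \<phi>a \<phi>t \<phi>xx assume t: "test_fun ad T \<phi> \<phi>a \<phi>t \<phi>xx"
  show im: "integrable Q (\<lambda>y. \<mu> (fst y) * w y * \<phi> y)" by (rule wsol0D(1)[OF ws t])
  have iY: "integrable Q (\<lambda>y. w y * Y \<phi> \<phi>a \<phi>t \<phi>xx y)" by (rule sqint_mult[OF sw test_sq(4)[OF t]])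
  have iu: "integrable Q (\<lambda>y. u y * w y * \<phi> y)"
    by (rule sqint_mult[OF sqint_bounded_mult[OF sw _ ub] test_sq(1)[OF t]]) measurable
  have if': "integrable Q (\<lambda>y. f y * \<phi> y)" by (rule sqint_mult[OF sf test_sq(1)[OF t]])
  have "(\<integral>y. w y * (- \<phi>a y - \<phi>t y - \<delta> * \<phi>xx y + \<mu> (fst y) * \<phi> y - u y * \<phi> y - \<beta> (fst y) * KT \<eta> \<phi> y) \<partial>Q)
    = (\<integral>y. w y * Y \<phi> \<phi>a \<phi>t \<phi>xx y + \<mu> (fst y) * w y * \<phi> y - u y * w y * \<phi> y \<partial>Q)"
    by (rule Bochner_Integration.integral_cong) (simp_all add: Y_def algebra_simps)
  also have "\<dots> = (\<integral>y. w y * Y \<phi> \<phi>a \<phi>t \<phi>xx y \<partial>Q) + (\<integral>y. \<mu> (fst y) * w y * \<phi> y \<partial>Q) - (\<integral>y. u y * w y * \<phi> y \<partial>Q)"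
    using iY im iu by simp
  also have "(\<integral>y. w y * Y \<phi> \<phi>a \<phi>t \<phi>xx y \<partial>Q) + (\<integral>y. \<mu> (fst y) * w y * \<phi> y \<partial>Q)
     = (\<integral>z. w0 z * \<phi> (fst z, 0, snd z) \<partial>B0) + (\<integral>y. (f y + u y * w y) * \<phi> y \<partial>Q)"
    by (rule wsol0D(2)[OF ws t])
  also have "(\<integral>y. (f y + u y * w y) * \<phi> y \<partial>Q) = (\<integral>y. f y * \<phi> y \<partial>Q) + (\<integral>y. u y * w y * \<phi> y \<partial>Q)"
    using iu if' by (simp add: distrib_right)
  finally show "(\<integral>y. w y * (- \<phi>a y - \<phi>t y - \<delta> * \<phi>xx y + \<mu> (fst y) * \<phi> y - u y * \<phi> y - \<beta> (fst y) * KT \<eta> \<phi> y) \<partial>Q)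
    = (\<integral>z. w0 z * \<phi> (fst z, 0, snd z) \<partial>B0) + (\<integral>y. f y * \<phi> y \<partial>Q)" by simp
qed

lemma is_solution_iff:
  assumes [measurable]: "u \<in> borel_measurable borel" and ub: "AE y in Q. \<bar>u y\<bar> \<le> Cu"
  shows "is_solution ad T \<delta> \<eta> \<mu> \<beta> p0 u p \<longleftrightarrow> p \<in> borel_measurable borel \<and> sqint Q p \<and> wsol0 p p0 (\<lambda>y. u y * p y)"
proof -
  have L2: "L2_on (QQ ad T) p \<longleftrightarrow> p \<in> borel_measurable borel \<and> sqint Q p"
    by (auto simp: L2_on_def sqint_def integrable_leb_iff)
  have key: "(set_integrable lborel (QQ ad T) (\<lambda>y. \<mu> (fst y) * p y * \<phi> y) \<and>
        (LINT y:QQ ad T|lborel. p y * (- (\<phi>a y + \<phi>t y) - \<delta> * \<phi>xx y + \<mu> (fst y) * \<phi> y - u y * \<phi> y))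
        = (LINT z:{0<..<T} \<times> {0<..<24}|lborel. renewal ad \<eta> \<beta> p (fst z) (snd z) * \<phi> (0, fst z, snd z))
          + (LINT z:{0<..<ad} \<times> {0<..<24}|lborel. p0 z * \<phi> (fst z, 0, snd z)))
     \<longleftrightarrow> (integrable Q (\<lambda>y. \<mu> (fst y) * p y * \<phi> y) \<and>
      (\<integral>y. p y * Y \<phi> \<phi>a \<phi>t \<phi>xx y \<partial>Q) + (\<integral>y. \<mu> (fst y) * p y * \<phi> y \<partial>Q)
      = (\<integral>z. p0 z * \<phi> (fst z, 0, snd z) \<partial>B0) + (\<integral>y. u y * p y * \<phi> y \<partial>Q))"
    if pm: "p \<in> borel_measurable borel" and sp: "sqint Q p" and t: "test_fun ad T \<phi> \<phi>a \<phi>t \<phi>xx" for \<phi> \<phi>a \<phi>t \<phi>xx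
  proof (cases "integrable Q (\<lambda>y. \<mu> (fst y) * p y * \<phi> y)")
    case True
    have iY: "integrable Q (\<lambda>y. p y * Y \<phi> \<phi>a \<phi>t \<phi>xx y)" by (rule sqint_mult[OF sp test_sq(4)[OF t]])
    have ik: "integrable Q (\<lambda>y. p y * (\<beta> (fst y) * KT \<eta> \<phi> y))" by (rule sqint_mult[OF sp test_sq(3)[OF t]])
    have iu: "integrable Q (\<lambda>y. u y * p y * \<phi> y)"
      by (rule sqint_mult[OF sqint_bounded_mult[OF sp _ ub] test_sq(1)[OF t]]) measurable
    have "(LINT y:QQ ad T|lborel. p y * (- (\<phi>a y + \<phi>t y) - \<delta> * \<phi>xx y + \<mu> (fst y) * \<phi> y - u y * \<phi> y))
       = (\<integral>y. p y * Y \<phi> \<phi>a \<phi>t \<phi>xx y + p y * (\<beta> (fst y) * KT \<eta> \<phi> y) + \<mu> (fst y) * p y * \<phi> y - u y * p y * \<phi> y \<partial>Q)"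
      unfolding integral_leb_eq[OF QQ_sets, symmetric]
      by (rule Bochner_Integration.integral_cong) (simp_all add: Y_def algebra_simps)
    also have "\<dots> = (\<integral>y. p y * Y \<phi> \<phi>a \<phi>t \<phi>xx y \<partial>Q) + (\<integral>y. p y * (\<beta> (fst y) * KT \<eta> \<phi> y) \<partial>Q) + (\<integral>y. \<mu> (fst y) * p y * \<phi> y \<partial>Q) - (\<integral>y. u y * p y * \<phi> y \<partial>Q)"
      using iY ik True iu by simp
    finally have e1: "(LINT y:QQ ad T|lborel. p y * (- (\<phi>a y + \<phi>t y) - \<delta> * \<phi>xx y + \<mu> (fst y) * \<phi> y - u y * \<phi> y))
       = (\<integral>y. p y * Y \<phi> \<phi>a \<phi>t \<phi>xx y \<partial>Q) + (\<integral>y. p y * (\<beta> (fst y) * KT \<eta> \<phi> y) \<partial>Q) + (\<integral>y. \<mu> (fst y) * p y * \<phi> y \<partial>Q) - (\<integral>y. u y * p y * \<phi> y \<partial>Q)" .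
    have e2: "(LINT z:{0<..<T} \<times> {0<..<24}|lborel. renewal ad \<eta> \<beta> p (fst z) (snd z) * \<phi> (0, fst z, snd z))
      = (\<integral>y. p y * (\<beta> (fst y) * KT \<eta> \<phi> y) \<partial>Q)"
      by (rule renewal_pairing[OF pm sp test_funD(1)[OF t] beta_measd beta_absd])
    have e3: "(LINT z:{0<..<ad} \<times> {0<..<24}|lborel. p0 z * \<phi> (fst z, 0, snd z)) = (\<integral>z. p0 z * \<phi> (fst z, 0, snd z) \<partial>B0)"
      by (rule integral_leb_eq[OF rect_sets, symmetric])
    show ?thesis unfolding e1 e2 e3 integrable_leb_iff[OF QQ_sets] by auto
  next
    case False
    then show ?thesis by (simp add: integrable_leb_iff)
  qed
  show ?thesis unfolding is_solution_def L2 wsol0_def using key by auto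
qed

lemma wsol0_lincomb:
  assumes 1: "wsol0 w w0 v" "sqint Q w" "sqint B0 w0" "sqint Q v"
    and 2: "wsol0 w' w0' v'" "sqint Q w'" "sqint B0 w0'" "sqint Q v'"
  shows "wsol0 (\<lambda>y. a * w y + c * w' y) (\<lambda>z. a * w0 z + c * w0' z) (\<lambda>y. a * v y + c * v' y)"
  unfolding wsol0_def
proof (intro allI impI conjI)
  fix \<phi> \<phi>a \<phi>t \<phi>xx assume t: "test_fun ad T \<phi> \<phi>a \<phi>t \<phi>xx"
  have s0: "sqint B0 (\<lambda>z. \<phi> (fst z, 0, snd z))"
    by (rule sqint_leb_continuous, rule continuous_on_compose2[OF test_funD(1)[OF t]]) (auto simp: rect_box intro!: continuous_intros)
  note i = wsol0D(1)[OF 1(1) t] wsol0D(1)[OF 2(1) t] sqint_mult[OF 1(2) test_sq(4)[OF t]] sqint_mult[OF 2(2) test_sq(4)[OF t]]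
    sqint_mult[OF 1(3) s0] sqint_mult[OF 2(3) s0] sqint_mult[OF 1(4) test_sq(1)[OF t]] sqint_mult[OF 2(4) test_sq(1)[OF t]]
  have s: "(\<integral>y. (a * f y + c * g y) * h y \<partial>M) = a * (\<integral>y. f y * h y \<partial>M) + c * (\<integral>y. g y * h y \<partial>M)"
    if "integrable M (\<lambda>y. f y * h y)" "integrable M (\<lambda>y. g y * h y)" for f g h and M :: "'z measure"
    using that by (simp add: distrib_right mult.assoc)
  have e: "\<mu> (fst y) * (a * w y + c * w' y) * \<phi> y = a * (\<mu> (fst y) * w y * \<phi> y) + c * (\<mu> (fst y) * w' y * \<phi> y)" for y
    by (simp add: algebra_simps)
  show "integrable Q (\<lambda>y. \<mu> (fst y) * (a * w y + c * w' y) * \<phi> y)"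
    unfolding e using i(1,2) by simp
  have m: "(\<integral>y. \<mu> (fst y) * (a * w y + c * w' y) * \<phi> y \<partial>Q) = a * (\<integral>y. \<mu> (fst y) * w y * \<phi> y \<partial>Q) + c * (\<integral>y. \<mu> (fst y) * w' y * \<phi> y \<partial>Q)"
    unfolding e using i(1,2) by simp
  have "a * ((\<integral>y. w y * Y \<phi> \<phi>a \<phi>t \<phi>xx y \<partial>Q) + (\<integral>y. \<mu> (fst y) * w y * \<phi> y \<partial>Q)) + c * ((\<integral>y. w' y * Y \<phi> \<phi>a \<phi>t \<phi>xx y \<partial>Q) + (\<integral>y. \<mu> (fst y) * w' y * \<phi> y \<partial>Q))
    = a * ((\<integral>z. w0 z * \<phi> (fst z, 0, snd z) \<partial>B0) + (\<integral>y. v y * \<phi> y \<partial>Q)) + c * ((\<integral>z. w0' z * \<phi> (fst z, 0, snd z) \<partial>B0) + (\<integral>y. v' y * \<phi> y \<partial>Q))"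
    unfolding wsol0D(2)[OF 1(1) t] wsol0D(2)[OF 2(1) t] ..
  then show "(\<integral>y. (a * w y + c * w' y) * Y \<phi> \<phi>a \<phi>t \<phi>xx y \<partial>Q) + (\<integral>y. \<mu> (fst y) * (a * w y + c * w' y) * \<phi> y \<partial>Q)
      = (\<integral>z. (a * w0 z + c * w0' z) * \<phi> (fst z, 0, snd z) \<partial>B0) + (\<integral>y. (a * v y + c * v' y) * \<phi> y \<partial>Q)"
    unfolding m s[OF i(3,4)] s[OF i(5,6)] s[OF i(7,8)] by (simp add: algebra_simps)
qed

lemma wsol0_limit:
  assumes ws: "\<And>n. wsol0 (p n) p0 (v n)"
    and pm: "\<And>n. p n \<in> borel_measurable borel" "p' \<in> borel_measurable borel" and vm: "\<And>n. v n \<in> borel_measurable borel" "v' \<in> borel_measurable borel"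
    and lim: "AE y in Q. (\<lambda>n. p n y) \<longlonglongrightarrow> p' y" "AE y in Q. (\<lambda>n. v n y) \<longlonglongrightarrow> v' y"
    and dom: "\<And>n. AE y in Q. \<bar>p n y\<bar> \<le> P y" "\<And>n. AE y in Q. \<bar>v n y\<bar> \<le> C * P y"
    and P: "sqint Q P" "\<And>y. 0 \<le> P y" "\<And>\<phi> \<phi>a \<phi>t \<phi>xx. test_fun ad T \<phi> \<phi>a \<phi>t \<phi>xx \<Longrightarrow> integrable Q (\<lambda>y. \<mu> (fst y) * P y * \<phi> y)"
  shows "wsol0 p' p0 v'"
  unfolding wsol0_def
proof (intro allI impI conjI)
  fix \<phi> \<phi>a \<phi>t \<phi>xx assume t: "test_fun ad T \<phi> \<phi>a \<phi>t \<phi>xx"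
  note [measurable] = pm vm
  have [measurable]: "\<phi> \<in> borel_measurable borel" by (rule borel_measurable_continuous_onI[OF test_funD(1)[OF t]])
  have Ym: "Y \<phi> \<phi>a \<phi>t \<phi>xx \<in> borel_measurable Q" using test_sq(4)[OF t] by (simp add: sqint_def)
  have l1: "(\<lambda>n. \<integral>y. \<mu> (fst y) * p n y * \<phi> y \<partial>Q) \<longlonglongrightarrow> (\<integral>y. \<mu> (fst y) * p' y * \<phi> y \<partial>Q)"
   and i1: "integrable Q (\<lambda>y. \<mu> (fst y) * p' y * \<phi> y)"
  proof -
    have a: "AE y in Q. (\<lambda>n. \<mu> (fst y) * p n y * \<phi> y) \<longlonglongrightarrow> \<mu> (fst y) * p' y * \<phi> y"
      using lim(1) by eventually_elim (intro tendsto_intros)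
    have b: "AE y in Q. norm (\<mu> (fst y) * p n y * \<phi> y) \<le> \<bar>\<mu> (fst y) * P y * \<phi> y\<bar>" for n
      using dom(1)[of n]
    proof eventually_elim
      case (elim y)
      have "(\<bar>\<mu> (fst y)\<bar> * \<bar>\<phi> y\<bar>) * \<bar>p n y\<bar> \<le> (\<bar>\<mu> (fst y)\<bar> * \<bar>\<phi> y\<bar>) * P y" by (rule mult_left_mono[OF elim]) simp
      then show ?case using P(2)[of y] by (simp add: abs_mult ac_simps)
    qed
    show "(\<lambda>n. \<integral>y. \<mu> (fst y) * p n y * \<phi> y \<partial>Q) \<longlonglongrightarrow> (\<integral>y. \<mu> (fst y) * p' y * \<phi> y \<partial>Q)"
      by (rule integral_dominated_convergence[OF _ _ integrable_abs[OF P(3)[OF t]] a b]; rule measurable_leb; measurable)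
    show "integrable Q (\<lambda>y. \<mu> (fst y) * p' y * \<phi> y)"
      by (rule integrable_dominated_convergence[OF _ _ integrable_abs[OF P(3)[OF t]] a b]; rule measurable_leb; measurable)
  qed
  show "integrable Q (\<lambda>y. \<mu> (fst y) * p' y * \<phi> y)" by (rule i1)
  have l2: "(\<lambda>n. \<integral>y. p n y * Y \<phi> \<phi>a \<phi>t \<phi>xx y \<partial>Q) \<longlonglongrightarrow> (\<integral>y. p' y * Y \<phi> \<phi>a \<phi>t \<phi>xx y \<partial>Q)"
  proof (rule integral_dominated_convergence[OF _ _ integrable_abs[OF sqint_mult[OF P(1) test_sq(4)[OF t]]]])
    show "AE y in Q. (\<lambda>n. p n y * Y \<phi> \<phi>a \<phi>t \<phi>xx y) \<longlonglongrightarrow> p' y * Y \<phi> \<phi>a \<phi>t \<phi>xx y"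
      using lim(1) by eventually_elim (intro tendsto_intros)
    show "AE y in Q. norm (p n y * Y \<phi> \<phi>a \<phi>t \<phi>xx y) \<le> \<bar>P y * Y \<phi> \<phi>a \<phi>t \<phi>xx y\<bar>" for n
      using dom(1)[of n]
    proof eventually_elim
      case (elim y)
      have "\<bar>p n y\<bar> * \<bar>Y \<phi> \<phi>a \<phi>t \<phi>xx y\<bar> \<le> P y * \<bar>Y \<phi> \<phi>a \<phi>t \<phi>xx y\<bar>" by (rule mult_right_mono[OF elim]) simp
      then show ?case using P(2)[of y] by (simp add: abs_mult)
    qed
    show "(\<lambda>y. p' y * Y \<phi> \<phi>a \<phi>t \<phi>xx y) \<in> borel_measurable Q" by (rule borel_measurable_times[OF measurable_leb[OF pm(2)] Ym])
    show "(\<lambda>y. p n y * Y \<phi> \<phi>a \<phi>t \<phi>xx y) \<in> borel_measurable Q" for n by (rule borel_measurable_times[OF measurable_leb[OF pm(1)] Ym])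
  qed
  have l3: "(\<lambda>n. \<integral>y. v n y * \<phi> y \<partial>Q) \<longlonglongrightarrow> (\<integral>y. v' y * \<phi> y \<partial>Q)"
  proof (rule integral_dominated_convergence[OF _ _ integrable_abs[OF sqint_mult[OF sqint_cmult[OF P(1), of C] test_sq(1)[OF t]]]])
    show "AE y in Q. (\<lambda>n. v n y * \<phi> y) \<longlonglongrightarrow> v' y * \<phi> y"
      using lim(2) by eventually_elim (intro tendsto_intros)
    show "AE y in Q. norm (v n y * \<phi> y) \<le> \<bar>C * P y * \<phi> y\<bar>" for n
      using dom(2)[of n]
    proof eventually_elim
      case (elim y)
      have "\<bar>v n y\<bar> * \<bar>\<phi> y\<bar> \<le> \<bar>C * P y\<bar> * \<bar>\<phi> y\<bar>" using elim by (intro mult_right_mono) auto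
      then show ?case by (simp add: abs_mult)
    qed
  qed (rule measurable_leb; measurable)+
  have "(\<lambda>n. (\<integral>y. p n y * Y \<phi> \<phi>a \<phi>t \<phi>xx y \<partial>Q) + (\<integral>y. \<mu> (fst y) * p n y * \<phi> y \<partial>Q)) \<longlonglongrightarrow>
     (\<integral>z. p0 z * \<phi> (fst z, 0, snd z) \<partial>B0) + (\<integral>y. v' y * \<phi> y \<partial>Q)"
    unfolding wsol0D(2)[OF ws t] by (intro tendsto_intros l3)
  from LIMSEQ_unique[OF tendsto_add[OF l2 l1] this]
  show "(\<integral>y. p' y * Y \<phi> \<phi>a \<phi>t \<phi>xx y \<partial>Q) + (\<integral>y. \<mu> (fst y) * p' y * \<phi> y \<partial>Q)
     = (\<integral>z. p0 z * \<phi> (fst z, 0, snd z) \<partial>B0) + (\<integral>y. v' y * \<phi> y \<partial>Q)" .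
qed

lemma wsol0_nonneg:
  assumes ws: "wsol0 w w0 (\<lambda>y. f y + u y * w y)"
    and m: "w \<in> borel_measurable borel" "w0 \<in> borel_measurable borel" "f \<in> borel_measurable borel" "u \<in> borel_measurable borel"
    and s: "sqint Q w" "sqint B0 w0" "sqint Q f"
    and n: "AE z in B0. 0 \<le> w0 z" "AE y in Q. 0 \<le> f y" and u: "AE y in Q. - Cu \<le> u y \<and> u y \<le> 0" "Cu \<ge> 0"
  shows "AE y in Q. 0 \<le> w y"
proof -
  interpret weak_problem ad T \<delta> \<eta> Cb Cu \<mu> \<beta> u
    by unfold_locales (use posd mu_locd mu_nnd betad m u in auto)
  have ub: "AE y in Q. \<bar>u y\<bar> \<le> Cu" using u(1) by eventually_elim auto
  show ?thesis
    by (rule weak_solution_nonneg[OF wsol0_imp_wsol[OF ws s(1,3) m(4) ub] m(1,2,3) s(2,3) n])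
qed

end

theorem theorem2:
  fixes ad T \<delta> \<eta> :: real
    and \<mu> \<beta> :: "real \<Rightarrow> real"
    and p0 :: "real \<times> real \<Rightarrow> real"
    and \<sigma>1 \<sigma>2 :: "real \<times> real \<times> real \<Rightarrow> real"
  assumes pos: "ad > 0" "T > 0" "\<delta> > 0" "\<eta> > 0"
    and J1: "\<mu> \<in> borel_measurable lborel"
       "\<forall>c d. 0 < c \<and> d < ad \<longrightarrow> (\<exists>C. AE a in lborel. a \<in> {c..d} \<longrightarrow> \<bar>\<mu> a\<bar> \<le> C)"
       "AE a in lborel. a \<in> {0<..<ad} \<longrightarrow> \<mu> a \<ge> 0"
       "set_nn_integral lborel {0<..<ad} (\<lambda>a. ennreal (\<mu> a)) = \<infinity>"
    and J2: "Linf_on {0<..<ad} \<beta>" "AE a in lborel. a \<in> {0<..<ad} \<longrightarrow> \<beta> a \<ge> 0"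
    and J3: "L2_on ({0<..<ad} \<times> {0<..<24}) p0"
       "AE z in lborel. z \<in> {0<..<ad} \<times> {0<..<24} \<longrightarrow> p0 z \<ge> 0"
    and sig: "Linf_on (QQ ad T) \<sigma>1" "Linf_on (QQ ad T) \<sigma>2"
       "AE y in lborel. y \<in> QQ ad T \<longrightarrow> \<sigma>1 y \<le> \<sigma>2 y \<and> \<sigma>2 y \<le> 0"
    and thm1: "\<forall>u \<in> controls ad T \<sigma>1 \<sigma>2.
        (\<exists>p. is_solution ad T \<delta> \<eta> \<mu> \<beta> p0 u p) \<and>
        (\<forall>p q. is_solution ad T \<delta> \<eta> \<mu> \<beta> p0 u p \<longrightarrow> is_solution ad T \<delta> \<eta> \<mu> \<beta> p0 u q
               \<longrightarrow> (AE y in lborel. y \<in> QQ ad T \<longrightarrow> p y = q y))"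
  shows "\<exists>u\<^sub>s \<in> controls ad T \<sigma>1 \<sigma>2. \<exists>p\<^sub>s. is_solution ad T \<delta> \<eta> \<mu> \<beta> p0 u\<^sub>s p\<^sub>s \<and>
          (\<forall>u \<in> controls ad T \<sigma>1 \<sigma>2. \<forall>p. is_solution ad T \<delta> \<eta> \<mu> \<beta> p0 u p \<longrightarrow>
             (LINT y:QQ ad T|lborel. u\<^sub>s y * p\<^sub>s y) \<le> (LINT y:QQ ad T|lborel. u y * p y))"
proof -
  obtain Cb where Cb: "AE a in lborel. a \<in> {0<..<ad} \<longrightarrow> \<bar>\<beta> a\<bar> \<le> Cb" using J2(1) unfolding Linf_on_def by blast
  interpret problem_data ad T \<delta> \<eta> Cb \<mu> \<beta>
  proof
    show "AE a in lborel. a \<in> {0<..<ad} \<longrightarrow> 0 \<le> \<beta> a \<and> \<beta> a \<le> Cb"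
      using Cb J2(2) by eventually_elim auto
    show "\<exists>C. AE a in lborel. a \<in> {c..d} \<longrightarrow> \<bar>\<mu> a\<bar> \<le> C" if "0 < c" "d < ad" for c d
      using J1(2) that by blast
  qed (use pos J1 J2 in \<open>auto simp: Linf_on_def\<close>)
  obtain C1 C2 where C12: "AE y in Q. \<bar>\<sigma>1 y\<bar> \<le> C1" "AE y in Q. \<bar>\<sigma>2 y\<bar> \<le> C2"
    using sig(1,2) unfolding Linf_on_def AE_leb_iff[OF QQ_sets] by blast
  define Cu where "Cu = \<bar>C1\<bar> + \<bar>C2\<bar>"
  have Cu0: "Cu \<ge> 0" by (simp add: Cu_def)
  have sm[measurable]: "\<sigma>1 \<in> borel_measurable borel" "\<sigma>2 \<in> borel_measurable borel" using sig(1,2) by (auto simp: Linf_on_def)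
  have s12: "AE y in Q. \<sigma>1 y \<le> \<sigma>2 y \<and> \<sigma>2 y \<le> 0" unfolding AE_leb_iff[OF QQ_sets] by (rule sig(3))
  have sbd: "AE y in Q. - Cu \<le> \<sigma>1 y \<and> \<sigma>1 y \<le> \<sigma>2 y \<and> \<sigma>2 y \<le> 0"
    using C12(1) s12 by eventually_elim (auto simp: Cu_def)
  have ctrl: "u \<in> controls ad T \<sigma>1 \<sigma>2 \<longleftrightarrow> u \<in> borel_measurable borel \<and> (AE y in Q. \<sigma>1 y \<le> u y \<and> u y \<le> \<sigma>2 y)" for u
  proof -
    have "sqint Q u" if [measurable]: "u \<in> borel_measurable borel" and b: "AE y in Q. \<sigma>1 y \<le> u y \<and> u y \<le> \<sigma>2 y"
    proof (rule sqintI[where g="\<lambda>_. Cu\<^sup>2"])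
      show "AE y in Q. (norm (u y))\<^sup>2 \<le> Cu\<^sup>2"
        using b sbd by eventually_elim (auto simp: abs_le_square_iff[symmetric])
      interpret finite_measure Q by (rule finite_measure_QQ)
      show "integrable Q (\<lambda>_. Cu\<^sup>2)" by simp
    qed measurable
    then show ?thesis unfolding controls_def AE_leb_iff[OF QQ_sets] by (auto simp: L2_on_def sqint_def integrable_leb_iff)
  qed
  have cbd: "AE y in Q. - Cu \<le> u y \<and> u y \<le> 0" "AE y in Q. \<bar>u y\<bar> \<le> Cu" "u \<in> borel_measurable borel"
    if "u \<in> controls ad T \<sigma>1 \<sigma>2" for u
  proof -
    show um: "u \<in> borel_measurable borel" using that unfolding ctrl by simp
    have "AE y in Q. \<sigma>1 y \<le> u y \<and> u y \<le> \<sigma>2 y" using that unfolding ctrl by simp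
    then show *: "AE y in Q. - Cu \<le> u y \<and> u y \<le> 0" using sbd by eventually_elim auto
    show "AE y in Q. \<bar>u y\<bar> \<le> Cu" using * by eventually_elim auto
  qed
  have sol: "is_solution ad T \<delta> \<eta> \<mu> \<beta> p0 u p \<longleftrightarrow> p \<in> borel_measurable borel \<and> sqint Q p \<and> wsol0 p p0 (\<lambda>y. u y * p y)"
    if "u \<in> controls ad T \<sigma>1 \<sigma>2" for u p
    by (rule is_solution_iff[OF cbd(3)[OF that] cbd(2)[OF that]])
  have p0m[measurable]: "p0 \<in> borel_measurable borel" and sp0: "sqint B0 p0"
    using J3(1) by (auto simp: L2_on_def sqint_def integrable_leb_iff[OF rect_sets])
  have p0n: "AE z in B0. 0 \<le> p0 z" unfolding AE_leb_iff[OF rect_sets] by (rule J3(2))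
  have sup: "sqint Q (\<lambda>y. u y * p y)" if "u \<in> controls ad T \<sigma>1 \<sigma>2" "sqint Q p" for u p
    by (rule sqint_bounded_mult[OF that(2) _ cbd(2)[OF that(1)]]) (rule measurable_leb[OF cbd(3)[OF that(1)]])
  have nonneg: "AE y in Q. 0 \<le> p y"
    if u: "u \<in> controls ad T \<sigma>1 \<sigma>2" and p: "is_solution ad T \<delta> \<eta> \<mu> \<beta> p0 u p" for u p
  proof -
    note s = p[unfolded sol[OF u]]
    show ?thesis
    proof (rule wsol0_nonneg[where f="\<lambda>_. 0" and u=u])
      show "wsol0 p p0 (\<lambda>y. 0 + u y * p y)" using s by simp
      show "sqint Q (\<lambda>_. 0 :: real)" by (simp add: sqint_def)
    qed (use s p0m sp0 p0n cbd[OF u] Cu0 in auto)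
  qed
  have s2: "\<sigma>2 \<in> controls ad T \<sigma>1 \<sigma>2" unfolding ctrl using s12 by (auto elim: eventually_mono)
  obtain P0 where P0: "is_solution ad T \<delta> \<eta> \<mu> \<beta> p0 \<sigma>2 P0" using thm1 s2 by blast
  note sP0 = P0[unfolded sol[OF s2]]
  define P where "P y = max 0 (P0 y)" for y
  have PP0: "AE y in Q. P y = P0 y" using nonneg[OF s2 P0] by eventually_elim (simp add: P_def)
  have P0m[measurable]: "P0 \<in> borel_measurable borel" using sP0 by simp
  have Pm[measurable]: "P \<in> borel_measurable borel" unfolding P_def by measurable
  have Pn: "0 \<le> P y" for y by (simp add: P_def)
  have sP: "sqint Q P"
  proof (rule sqintI)
    show "integrable Q (\<lambda>y. (P0 y)\<^sup>2)" using sP0 by (simp add: sqint_def)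
    show "AE y in Q. (norm (P y))\<^sup>2 \<le> (P0 y)\<^sup>2" unfolding P_def real_norm_def power2_abs by (intro AE_I2 max0_sq_le)
  qed measurable
  have iP: "integrable Q (\<lambda>y. \<mu> (fst y) * P y * \<phi> y)" if "test_fun ad T \<phi> \<phi>a \<phi>t \<phi>xx" for \<phi> \<phi>a \<phi>t \<phi>xx
  proof -
    have [measurable]: "\<phi> \<in> borel_measurable borel" by (rule borel_measurable_continuous_onI[OF test_funD(1)[OF that]])
    have i: "integrable Q (\<lambda>y. \<mu> (fst y) * P0 y * \<phi> y)" using wsol0D(1)[OF _ that] sP0 by blast
    have "(\<lambda>y. \<mu> (fst y) * P y * \<phi> y) \<in> borel_measurable Q" by (rule measurable_leb) measurable
    moreover have "AE y in Q. \<mu> (fst y) * P0 y * \<phi> y = \<mu> (fst y) * P y * \<phi> y" using PP0 by eventually_elim simp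
    ultimately show ?thesis by (rule integrable_cong_AE_imp[OF i])
  qed
  have below: "AE y in Q. p y \<le> P y"
    if u: "u \<in> controls ad T \<sigma>1 \<sigma>2" and p: "is_solution ad T \<delta> \<eta> \<mu> \<beta> p0 u p" for u p
  proof -
    note s = p[unfolded sol[OF u]]
    have um[measurable]: "u \<in> borel_measurable borel" using u unfolding ctrl by simp
    have pm[measurable]: "p \<in> borel_measurable borel" "P0 \<in> borel_measurable borel" using s sP0 by auto
    have "wsol0 (\<lambda>y. 1 * P0 y + (-1) * p y) (\<lambda>z. 1 * p0 z + (-1) * p0 z) (\<lambda>y. 1 * (\<sigma>2 y * P0 y) + (-1) * (u y * p y))"
      by (rule wsol0_lincomb) (use s sP0 sp0 sup[OF u] sup[OF s2] in auto)
    then have ws: "wsol0 (\<lambda>y. P0 y - p y) (\<lambda>z. 0) (\<lambda>y. (\<sigma>2 y - u y) * p y + \<sigma>2 y * (P0 y - p y))"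
      by (simp add: algebra_simps)
    have "AE y in Q. 0 \<le> P0 y - p y"
    proof (rule wsol0_nonneg[OF ws])
      show "sqint Q (\<lambda>y. P0 y - p y)" using s sP0 by (intro sqint_diff) auto
      show "sqint B0 (\<lambda>_. 0)" by (simp add: sqint_def)
      have "sqint Q (\<lambda>y. \<sigma>2 y * p y - u y * p y)" by (intro sqint_diff sup u s2) (use s in auto)
      then show "sqint Q (\<lambda>y. (\<sigma>2 y - u y) * p y)" by (simp add: algebra_simps)
      have "AE y in Q. \<sigma>1 y \<le> u y \<and> u y \<le> \<sigma>2 y" using u unfolding ctrl by simp
      then show "AE y in Q. 0 \<le> (\<sigma>2 y - u y) * p y"
        using nonneg[OF u p] by eventually_elim simp
      show "AE y in Q. - Cu \<le> \<sigma>2 y \<and> \<sigma>2 y \<le> 0" using sbd by eventually_elim auto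
    qed (use Cu0 in auto)
    then show ?thesis using PP0 by eventually_elim simp
  qed
  define W where "W = {g :: real \<times> real \<times> real \<Rightarrow> real \<times> real. g \<in> borel_measurable borel \<and>
     wsol0 (\<lambda>y. fst (g y)) p0 (\<lambda>y. snd (g y)) \<and>
     (AE y in Q. 0 \<le> fst (g y) \<and> fst (g y) \<le> P y \<and> \<sigma>1 y * fst (g y) \<le> snd (g y) \<and> snd (g y) \<le> \<sigma>2 y * fst (g y))}"
  define J where "J g = (\<integral>y. snd (g y) \<partial>Q)" for g :: "real \<times> real \<times> real \<Rightarrow> real \<times> real"
  have bd: "AE y in Q. \<bar>fst (g y)\<bar> \<le> P y \<and> \<bar>snd (g y)\<bar> \<le> Cu * P y"
    if "AE y in Q. 0 \<le> fst (g y) \<and> fst (g y) \<le> P y \<and> \<sigma>1 y * fst (g y) \<le> snd (g y) \<and> snd (g y) \<le> \<sigma>2 y * fst (g y)"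
    for g :: "real \<times> real \<times> real \<Rightarrow> real \<times> real"
    using that sbd
  proof eventually_elim
    case (elim y)
    have "Cu * fst (g y) \<le> Cu * P y" using elim Cu0 by (intro mult_left_mono) auto
    moreover have "- Cu * fst (g y) \<le> \<sigma>1 y * fst (g y)" using elim by (intro mult_right_mono) auto
    moreover have "\<sigma>2 y * fst (g y) \<le> 0" using elim by (intro mult_nonpos_nonneg) auto
    moreover have "0 \<le> Cu * fst (g y)" using elim Cu0 by simp
    ultimately have "- (Cu * P y) \<le> snd (g y)" "snd (g y) \<le> Cu * P y" using elim by linarith+
    then show ?case using elim by auto
  qed
  have Wbd: "AE y in Q. \<bar>fst (g y)\<bar> \<le> P y \<and> \<bar>snd (g y)\<bar> \<le> Cu * P y" if "g \<in> W" for g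
    using bd that unfolding W_def by blast
  have comp: "sqint Q (\<lambda>y. fst (g y))" "sqint Q (\<lambda>y. snd (g y))" "sqint Q g"
     "(\<integral>y. (norm (g y))\<^sup>2 \<partial>Q) \<le> (1 + Cu\<^sup>2) * (\<integral>y. (P y)\<^sup>2 \<partial>Q)" if g: "g \<in> W" for g
  proof -
    have [measurable]: "g \<in> borel_measurable borel" using g by (simp add: W_def)
    have b: "AE y in Q. (fst (g y))\<^sup>2 \<le> (P y)\<^sup>2 \<and> (snd (g y))\<^sup>2 \<le> Cu\<^sup>2 * (P y)\<^sup>2"
      using Wbd[OF g]
    proof eventually_elim
      case (elim y)
      then show ?case
        using power_mono[of "\<bar>fst (g y)\<bar>" "P y" 2] power_mono[of "\<bar>snd (g y)\<bar>" "Cu * P y" 2] by (simp add: power_mult_distrib)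
    qed
    have iP2: "integrable Q (\<lambda>y. (P y)\<^sup>2)" by (rule sqint_integrable_square[OF sP])
    show "sqint Q (\<lambda>y. fst (g y))" by (rule sqintI[OF _ iP2]) (use b in auto)
    show "sqint Q (\<lambda>y. snd (g y))" by (rule sqintI[OF _ integrable_mult_right[OF iP2, of "Cu\<^sup>2"]]) (use b in auto)
    have n: "(norm (g y))\<^sup>2 = (fst (g y))\<^sup>2 + (snd (g y))\<^sup>2" for y by (simp add: norm_prod_def)
    have le: "AE y in Q. (norm (g y))\<^sup>2 \<le> (1 + Cu\<^sup>2) * (P y)\<^sup>2"
      unfolding n using b by eventually_elim (simp add: distrib_right)
    show sg: "sqint Q g" by (rule sqintI[OF _ integrable_mult_right[OF iP2] le]) measurable
    have "(\<integral>y. (norm (g y))\<^sup>2 \<partial>Q) \<le> (\<integral>y. (1 + Cu\<^sup>2) * (P y)\<^sup>2 \<partial>Q)"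
      by (rule integral_mono_AE[OF sqint_integrable_sq[OF sg] integrable_mult_right[OF iP2] le])
    then show "(\<integral>y. (norm (g y))\<^sup>2 \<partial>Q) \<le> (1 + Cu\<^sup>2) * (\<integral>y. (P y)\<^sup>2 \<partial>Q)" by simp
  qed
  have iJ: "integrable Q (\<lambda>y. snd (g y))" if "g \<in> W" for g
    by (rule sqint_integrable[OF finite_measure_QQ comp(2)[OF that]])
  have inW: "(\<lambda>y. (p y, u y * p y)) \<in> W"
    if u: "u \<in> controls ad T \<sigma>1 \<sigma>2" and p: "is_solution ad T \<delta> \<eta> \<mu> \<beta> p0 u p" for u p
  proof -
    note s = p[unfolded sol[OF u]]
    have [measurable]: "u \<in> borel_measurable borel" "p \<in> borel_measurable borel" using u s unfolding ctrl by auto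
    have "AE y in Q. \<sigma>1 y \<le> u y \<and> u y \<le> \<sigma>2 y" using u unfolding ctrl by simp
    then have "AE y in Q. 0 \<le> p y \<and> p y \<le> P y \<and> \<sigma>1 y * p y \<le> u y * p y \<and> u y * p y \<le> \<sigma>2 y * p y"
      using nonneg[OF u p] below[OF u p] by eventually_elim (auto intro: mult_right_mono)
    moreover have "(\<lambda>y. (p y, u y * p y)) \<in> borel_measurable borel" by (rule borel_measurable_Pair) measurable
    ultimately show ?thesis using s unfolding W_def by simp
  qed
  define m where "m = (INF g\<in>W. J g)"
  have Jlow: "- (Cu * (\<integral>y. P y \<partial>Q)) \<le> J g" if g: "g \<in> W" for g
  proof -
    have iPP: "integrable Q P" by (rule sqint_integrable[OF finite_measure_QQ sP])
    have "(\<integral>y. - (Cu * P y) \<partial>Q) \<le> J g" unfolding J_def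
      by (rule integral_mono_AE[OF _ iJ[OF g]]) (use iPP Wbd[OF g] in \<open>auto elim: eventually_mono\<close>)
    then show ?thesis by simp
  qed
  have bddJ: "bdd_below (J ` W)" by (rule bdd_belowI2[OF Jlow])
  have Wne: "W \<noteq> {}" using inW[OF s2 P0] by blast
  define C where "C n = {g \<in> W. J g \<le> m + inverse (real (Suc n))}" for n
  have "\<exists>x X. (\<forall>n. x n \<in> C n) \<and> sqint Q X \<and> (AE y in Q. (\<lambda>n. x n y) \<longlonglongrightarrow> X y) \<and>
     (\<forall>n. (\<integral>y. (norm (x n y - X y))\<^sup>2 \<partial>Q) \<le> (1/4)^n) \<and>
     (\<forall>n f. (\<forall>k. f \<in> C k) \<longrightarrow> (\<integral>y. (norm (x n y))\<^sup>2 \<partial>Q) \<le> (\<integral>y. (norm (f y))\<^sup>2 \<partial>Q) + (1/2)^n)"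
  proof (rule convex_chain_limit[OF finite_measure_QQ])
    show "f \<in> C n \<Longrightarrow> sqint Q f" for f n unfolding C_def using comp(3) by blast
    show "C (Suc n) \<subseteq> C n" for n
    proof
      fix g assume "g \<in> C (Suc n)"
      moreover have "inverse (real (Suc (Suc n))) \<le> inverse (real (Suc n))" by simp
      ultimately show "g \<in> C n" unfolding C_def mem_Collect_eq by linarith
    qed
    show "\<exists>f\<in>C n. (\<integral>y. (norm (f y))\<^sup>2 \<partial>Q) \<le> (1 + Cu\<^sup>2) * (\<integral>y. (P y)\<^sup>2 \<partial>Q)" for n
    proof -
      have "\<exists>g\<in>W. J g < m + inverse (real (Suc n))"
        using cInf_lessD[of "J ` W" "m + inverse (real (Suc n))"] Wne unfolding m_def by auto
      then show ?thesis unfolding C_def using comp(4) by (auto intro: less_imp_le)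
    qed
    fix n f g assume fg: "f \<in> C n" "g \<in> C n"
    then have f: "f \<in> W" and g: "g \<in> W" by (auto simp: C_def)
    have [measurable]: "f \<in> borel_measurable borel" "g \<in> borel_measurable borel" using f g by (auto simp: W_def)
    have "wsol0 (\<lambda>y. 1/2 * fst (f y) + 1/2 * fst (g y)) (\<lambda>z. 1/2 * p0 z + 1/2 * p0 z) (\<lambda>y. 1/2 * snd (f y) + 1/2 * snd (g y))"
      by (rule wsol0_lincomb) (use f g comp(1,2) sp0 in \<open>auto simp: W_def\<close>)
    then have ws: "wsol0 (\<lambda>y. fst ((1/2) *\<^sub>R (f y + g y))) p0 (\<lambda>y. snd ((1/2) *\<^sub>R (f y + g y)))"
      by (simp add: fst_add snd_add distrib_left)
    have "AE y in Q. 0 \<le> fst (f y) \<and> fst (f y) \<le> P y \<and> \<sigma>1 y * fst (f y) \<le> snd (f y) \<and> snd (f y) \<le> \<sigma>2 y * fst (f y)"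
      "AE y in Q. 0 \<le> fst (g y) \<and> fst (g y) \<le> P y \<and> \<sigma>1 y * fst (g y) \<le> snd (g y) \<and> snd (g y) \<le> \<sigma>2 y * fst (g y)"
      using f g by (auto simp: W_def)
    then have "AE y in Q. 0 \<le> fst ((1/2) *\<^sub>R (f y + g y)) \<and> fst ((1/2) *\<^sub>R (f y + g y)) \<le> P y
       \<and> \<sigma>1 y * fst ((1/2) *\<^sub>R (f y + g y)) \<le> snd ((1/2) *\<^sub>R (f y + g y)) \<and> snd ((1/2) *\<^sub>R (f y + g y)) \<le> \<sigma>2 y * fst ((1/2) *\<^sub>R (f y + g y))"
      by eventually_elim (simp add: fst_add snd_add algebra_simps)
    with ws have w: "(\<lambda>y. (1/2) *\<^sub>R (f y + g y)) \<in> W" unfolding W_def by simp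
    have "J (\<lambda>y. (1/2) *\<^sub>R (f y + g y)) = (\<integral>y. 1/2 * snd (f y) + 1/2 * snd (g y) \<partial>Q)"
      unfolding J_def by (simp add: snd_add distrib_left)
    also have "\<dots> = 1/2 * J f + 1/2 * J g" unfolding J_def using iJ[OF f] iJ[OF g] by simp
    finally have "J (\<lambda>y. (1/2) *\<^sub>R (f y + g y)) \<le> m + inverse (real (Suc n))" using fg by (simp add: C_def)
    with w show "(\<lambda>y. (1/2) *\<^sub>R (f y + g y)) \<in> C n" by (simp add: C_def)
  qed
  then obtain x X where x: "\<And>n. x n \<in> C n" and sX: "sqint Q X" and lim: "AE y in Q. (\<lambda>n. x n y) \<longlonglongrightarrow> X y" by auto
  have xW: "x n \<in> W" "J (x n) \<le> m + inverse (real (Suc n))" for n using x[of n] by (auto simp: C_def)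
  have xm[measurable]: "x n \<in> borel_measurable borel" for n using xW(1)[of n] by (simp add: W_def)
  define p where "p y = lim (\<lambda>n. fst (x n y))" for y
  define v where "v y = lim (\<lambda>n. snd (x n y))" for y
  have pm[measurable]: "p \<in> borel_measurable borel" "v \<in> borel_measurable borel" unfolding p_def v_def by measurable
  have limp: "AE y in Q. (\<lambda>n. fst (x n y)) \<longlonglongrightarrow> p y"
    using lim
  proof eventually_elim
    case (elim y)
    have "(\<lambda>n. fst (x n y)) \<longlonglongrightarrow> fst (X y)" by (rule tendsto_fst[OF elim])
    then show ?case by (simp add: p_def limI)
  qed
  have limv: "AE y in Q. (\<lambda>n. snd (x n y)) \<longlonglongrightarrow> v y"
    using lim
  proof eventually_elim
    case (elim y)
    have "(\<lambda>n. snd (x n y)) \<longlonglongrightarrow> snd (X y)" by (rule tendsto_snd[OF elim])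
    then show ?case by (simp add: v_def limI)
  qed
  have wsp: "wsol0 p p0 v"
  proof (rule wsol0_limit[where p="\<lambda>n y. fst (x n y)" and v="\<lambda>n y. snd (x n y)" and P=P and C=Cu, OF _ _ _ _ _ limp limv])
    show "wsol0 (\<lambda>y. fst (x n y)) p0 (\<lambda>y. snd (x n y))" for n using xW(1)[of n] by (simp add: W_def)
    show "AE y in Q. \<bar>fst (x n y)\<bar> \<le> P y" "AE y in Q. \<bar>snd (x n y)\<bar> \<le> Cu * P y" for n
      using Wbd[OF xW(1)[of n]] by (auto elim: eventually_mono)
  qed (use sP Pn iP in auto)
  have "AE y in Q. \<forall>n. 0 \<le> fst (x n y) \<and> fst (x n y) \<le> P y \<and> \<sigma>1 y * fst (x n y) \<le> snd (x n y) \<and> snd (x n y) \<le> \<sigma>2 y * fst (x n y)"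
    unfolding AE_all_countable using xW(1) by (auto simp: W_def)
  then have pv: "AE y in Q. 0 \<le> p y \<and> p y \<le> P y \<and> \<sigma>1 y * p y \<le> v y \<and> v y \<le> \<sigma>2 y * p y"
    using limp limv
  proof eventually_elim
    case (elim y)
    have l1: "(\<lambda>n. \<sigma>1 y * fst (x n y)) \<longlonglongrightarrow> \<sigma>1 y * p y" and l2: "(\<lambda>n. \<sigma>2 y * fst (x n y)) \<longlonglongrightarrow> \<sigma>2 y * p y"
      by (intro tendsto_intros elim)+
    show ?case
      using LIMSEQ_le_const[OF elim(2), of 0] LIMSEQ_le_const2[OF elim(2), of "P y"] LIMSEQ_le[OF l1 elim(3)] LIMSEQ_le[OF elim(3) l2] elim(1)
      by auto
  qed
  have gW: "(\<lambda>y. (p y, v y)) \<in> W"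
  proof -
    have "(\<lambda>y. (p y, v y)) \<in> borel_measurable borel" by (rule borel_measurable_Pair) measurable
    then show ?thesis unfolding W_def using wsp pv by simp
  qed
  have "(\<lambda>n. J (x n)) \<longlonglongrightarrow> (\<integral>y. v y \<partial>Q)" unfolding J_def
  proof (rule integral_dominated_convergence[where w="\<lambda>y. Cu * P y"])
    show "integrable Q (\<lambda>y. Cu * P y)" by (intro integrable_mult_right sqint_integrable[OF finite_measure_QQ sP])
    show "AE y in Q. (\<lambda>n. snd (x n y)) \<longlonglongrightarrow> v y" by (rule limv)
    show "AE y in Q. norm (snd (x n y)) \<le> Cu * P y" for n using Wbd[OF xW(1)[of n]] by (auto elim: eventually_mono)
  qed (rule measurable_leb; measurable)+
  moreover have "(\<lambda>n. m + inverse (real (Suc n))) \<longlonglongrightarrow> m + 0" by (intro tendsto_intros LIMSEQ_inverse_real_of_nat)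
  ultimately have Jv: "(\<integral>y. v y \<partial>Q) \<le> m" using xW(2) by (auto intro: LIMSEQ_le)
  define us where "us y = (if 0 < p y then v y / p y else \<sigma>2 y)" for y
  have usm[measurable]: "us \<in> borel_measurable borel" unfolding us_def by measurable
  have usv: "AE y in Q. us y * p y = v y"
    using pv by eventually_elim (auto simp: us_def)
  have usc: "us \<in> controls ad T \<sigma>1 \<sigma>2" unfolding ctrl
  proof (intro conjI usm)
    show "AE y in Q. \<sigma>1 y \<le> us y \<and> us y \<le> \<sigma>2 y"
      using pv s12 by eventually_elim (auto simp: us_def pos_le_divide_eq pos_divide_le_eq)
  qed
  have Jus: "(\<integral>y. us y * p y \<partial>Q) = (\<integral>y. v y \<partial>Q)"
    using usv by (intro integral_cong_AE measurable_leb) (auto intro!: borel_measurable_times)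
  have "wsol0 p p0 (\<lambda>y. us y * p y)"
    unfolding wsol0_def
  proof (intro allI impI conjI)
    fix \<phi> \<phi>a \<phi>t \<phi>xx assume t: "test_fun ad T \<phi> \<phi>a \<phi>t \<phi>xx"
    show "integrable Q (\<lambda>y. \<mu> (fst y) * p y * \<phi> y)" by (rule wsol0D(1)[OF wsp t])
    have [measurable]: "\<phi> \<in> borel_measurable borel" by (rule borel_measurable_continuous_onI[OF test_funD(1)[OF t]])
    have "(\<integral>y. us y * p y * \<phi> y \<partial>Q) = (\<integral>y. v y * \<phi> y \<partial>Q)"
    proof (rule integral_cong_AE)
      show "AE y in Q. us y * p y * \<phi> y = v y * \<phi> y" using usv by eventually_elim simp
    qed (rule measurable_leb; measurable)+
    with wsol0D(2)[OF wsp t]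
    show "(\<integral>y. p y * Y \<phi> \<phi>a \<phi>t \<phi>xx y \<partial>Q) + (\<integral>y. \<mu> (fst y) * p y * \<phi> y \<partial>Q)
      = (\<integral>z. p0 z * \<phi> (fst z, 0, snd z) \<partial>B0) + (\<integral>y. us y * p y * \<phi> y \<partial>Q)" by simp
  qed
  moreover have "sqint Q p" using comp(1)[OF gW] by simp
  ultimately have solp: "is_solution ad T \<delta> \<eta> \<mu> \<beta> p0 us p" unfolding sol[OF usc] using pm by simp
  have opt: "(LINT y:QQ ad T|lborel. us y * p y) \<le> (LINT y:QQ ad T|lborel. u y * q y)"
    if u: "u \<in> controls ad T \<sigma>1 \<sigma>2" and q: "is_solution ad T \<delta> \<eta> \<mu> \<beta> p0 u q" for u q
  proof -
    have "m \<le> J (\<lambda>y. (q y, u y * q y))" unfolding m_def by (rule cINF_lower[OF bddJ inW[OF u q]])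
    then show ?thesis using Jv Jus unfolding J_def integral_leb_eq[OF QQ_sets, symmetric] by simp
  qed
  show ?thesis using usc solp opt by blast
qed

end
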